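(* Let $\Omega\subset\mathbb R^3$ be a polyhedral domain and $\Delta$ a triangulation of $\Omega$. With the spaces $V_h^i,W_h^i$ ($i=0,1,2,3$) defined in the context, the sequence $$0\to\begin{pmatrix}V_h^0\\ W_h^0\end{pmatrix}\xrightarrow{\mathcal A^0}\begin{pmatrix}V_h^1\\ W_h^1\end{pmatrix}\xrightarrow{\mathcal A^1}\begin{pmatrix}V_h^2\\ W_h^2\end{pmatrix}\xrightarrow{\mathcal A^2}\begin{pmatrix}V_h^3\\ W_h^3\end{pmatrix}\to0,$$ $$\mathcal A^0=\begin{pmatrix}\mathrm{grad}&\mathrm{mskw}\\0&\mathrm{grad}\end{pmatrix},\quad \mathcal A^1=\begin{pmatrix}\mathrm{curl}&\mathcal S\\0&\mathrm{curl}\end{pmatrix},\quad \mathcal A^2=\begin{pmatrix}\mathrm{div}&-2\,\mathrm{vskw}\\0&\mathrm{div}\end{pmatrix},$$ is a complex, and its cohomology is isomorphic (in each degree) to that of the Regge complex $$0\to \mathbf{Lag}\xrightarrow{\mathrm{def}}\mathbf{Reg}\xrightarrow{\mathrm{inc}}(\mathbf{Reg}_0)'\xrightarrow{\mathrm{div}}(\mathbf{Lag}_0)'\to 0.$$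
   Context: Notation: $\mathbb V=\mathbb R^3$, $\mathbb M$ = real $3\times 3$ matrices, $\mathbb S$ = symmetric ones. $\mathsf V_0,\mathsf E_0,\mathsf F_0$: interior vertices, edges, faces of $\Delta$ (not contained in $\partial\Omega$); cells are the tetrahedra $K$. For a face $f$: $n=n_f$ unit normal, $t_1=t_1^f,t_2=t_2^f$ orthonormal tangents. For an edge $e$: $t_e$ unit tangent, $n_1,n_2$ two (orthonormal) normal vectors. $c\otimes d=cd^T$. For a simplex $s$, $\delta_s[a]$ ($a\in\mathbb V$) and $\delta_s[A]$ ($A\in\mathbb M$) are the distributions $v\mapsto\int_s a\cdot v$, $W\mapsto\int_s A:W$ (point evaluation if $s$ is a vertex). Algebraic maps: $\mathrm{mskw}(v)\in\mathbb M$ is the skew matrix with $\mathrm{mskw}(v)w=v\times w$; $\mathrm{vskw}=\mathrm{mskw}^{-1}\circ\mathrm{skw}$, where $\mathrm{skw}$ is the skew-symmetric part; $\mathcal S u=u^T-\mathrm{tr}(u)I$. They are applied pointwise (to matrix/vector valued distributions in the obvious way). Differential operators $\mathrm{grad},\mathrm{curl},\mathrm{div}$ act row-wise on matrix fields ($(\mathrm{grad}\,v)_{ij}=\partial_jv_i$), in the sense of distributions on $\Omega$. Regge complex: $\mathbf{Lag}$ = continuous piecewise affine $\mathbb V$-valued functions; $\mathbf{Reg}$ = piecewise constant $\mathbb S$-valued functions $\sigma$ with $n_f\times\sigma\times n_f$ (tangential-tangential part) continuous across interior faces; $(\mathbf{Reg}_0)'=\mathrm{span}\{\delta_e[t_et_e^T]:e\in\mathsf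 E_0\}$; $(\mathbf{Lag}_0)'=\mathrm{span}\{\delta_x[v]:v\in\mathbb V,x\in\mathsf V_0\}$; $\mathrm{def}=\mathrm{sym}\,\mathrm{grad}$, $\mathrm{inc}=\mathrm{curl}\circ T\circ\mathrm{curl}$ ($T$ transpose), all in the sense of distributions (tested with symmetric test matrices for $\mathrm{def},\mathrm{inc}$). Spaces: - $V_h^0=\mathbf{Lag}$. - $V_h^1=\mathbf{Reg}\oplus\{\mathrm{mskw}(c): c\ \text{piecewise constant}\ \mathbb V\text{-valued}\}$. - $V_h^2=\mathrm{span}_{f\in\mathsf F_0}\{\delta_f[nt_1^T],\ \delta_f[nt_2^T],\ \delta_f[t_1t_1^T+t_2t_2^T]\}$. - $V_h^3=\mathrm{span}_{e\in\mathsf E_0}\{\delta_e[n_1],\ \delta_e[n_2]\}$. - $W_h^0$ = piecewise constant $\mathbb V$-valued functions. - $W_h^1=\mathrm{span}_{f\in\mathsf F_0}\{\delta_f[c\otimes n_f]:c\in\mathbb V\}$, $W_h^2=\mathrm{span}_{e\in\mathsf E_0}\{\delta_e[c\otimes t_e]:c\in\mathbb V\}$, $W_h^3=\mathrm{span}_{x\in\mathsf V_0}\{\delta_x[c]:c\in\mathbb V\}$. *)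

theory Defs
  imports "HOL-Analysis.Analysis" "HOL-Library.Function_Algebras"
begin

type_synonym vec3 = "real^3"
type_synonym mat3 = "real^3^3"

text \<open>Pointwise real vector space structure on functions; it makes the library's
  \<^const>\<open>linear\<close>, \<^const>\<open>subspace\<close> and \<^const>\<open>span\<close> available for functionals.\<close>

instantiation "fun" :: (type, real_vector) real_vector
begin

definition scaleR_fun :: "real \<Rightarrow> ('a \<Rightarrow> 'b) \<Rightarrow> 'a \<Rightarrow> 'b" where
  "scaleR_fun c f = (\<lambda>x. c *\<^sub>R f x)"

instance
  by standard (simp_all add: scaleR_fun_def plus_fun_def scaleR_add_left scaleR_add_right)

end


section \<open>Polyhedral domains and triangulations\<close>

text \<open>The condition \<open>interior (closure \<Omega>) = \<Omega>\<close> excludes slits and punctures. It holds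
  for Lipschitz domains, but no Lipschitz condition is imposed. Boundedness
  follows from the last conjunct.\<close>

definition polyhedral_domain :: "vec3 set \<Rightarrow> bool" where
  "polyhedral_domain \<Omega> \<longleftrightarrow>
     open \<Omega> \<and> connected \<Omega> \<and> \<Omega> \<noteq> {} \<and> interior (closure \<Omega>) = \<Omega> \<and>
     (\<exists>\<P>. finite \<P> \<and> (\<forall>P\<in>\<P>. polytope P) \<and> closure \<Omega> = \<Union>\<P>)"

definition triangulation_of :: "vec3 set set \<Rightarrow> vec3 set \<Rightarrow> bool" where
  "triangulation_of \<Delta> \<Omega> \<longleftrightarrow> simplicial_complex \<Delta> \<and> \<Union>\<Delta> = closure \<Omega>"

definition cells :: "vec3 set set \<Rightarrow> vec3 set set" where
  "cells \<Delta> = {K \<in> \<Delta>. 3 simplex K}"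

definition interior_faces :: "vec3 set set \<Rightarrow> vec3 set \<Rightarrow> vec3 set set" where
  "interior_faces \<Delta> \<Omega> = {f \<in> \<Delta>. 2 simplex f \<and> \<not> f \<subseteq> frontier \<Omega>}"

definition interior_edges :: "vec3 set set \<Rightarrow> vec3 set \<Rightarrow> vec3 set set" where
  "interior_edges \<Delta> \<Omega> = {e \<in> \<Delta>. 1 simplex e \<and> \<not> e \<subseteq> frontier \<Omega>}"

definition interior_vertices :: "vec3 set set \<Rightarrow> vec3 set \<Rightarrow> vec3 set" where
  "interior_vertices \<Delta> \<Omega> = {x. {x} \<in> \<Delta> \<and> \<not> {x} \<subseteq> frontier \<Omega>}"

definition orthonormal3 :: "vec3 \<Rightarrow> vec3 \<Rightarrow> vec3 \<Rightarrow> bool" where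
  "orthonormal3 a b c \<longleftrightarrow>
     norm a = 1 \<and> norm b = 1 \<and> norm c = 1 \<and> a \<bullet> b = 0 \<and> a \<bullet> c = 0 \<and> b \<bullet> c = 0"

definition normal_to :: "vec3 \<Rightarrow> vec3 set \<Rightarrow> bool" where
  "normal_to n s \<longleftrightarrow> (\<forall>x\<in>s. \<forall>y\<in>s. n \<bullet> (x - y) = 0)"

text \<open>One frame \<open>(n, t\<^sub>1, t\<^sub>2)\<close> per face and one frame \<open>(t, n\<^sub>1, n\<^sub>2)\<close> per edge is fixed by choice.
  The remaining members of an orthonormal frame are then tangential.\<close>

definition face_frame :: "vec3 set \<Rightarrow> vec3 \<times> vec3 \<times> vec3" where
  "face_frame f = (SOME (n, t1, t2). orthonormal3 n t1 t2 \<and> normal_to n f)"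

definition face_normal :: "vec3 set \<Rightarrow> vec3" where
  "face_normal f = fst (face_frame f)"

definition face_tangent1 :: "vec3 set \<Rightarrow> vec3" where
  "face_tangent1 f = fst (snd (face_frame f))"

definition face_tangent2 :: "vec3 set \<Rightarrow> vec3" where
  "face_tangent2 f = snd (snd (face_frame f))"

definition edge_frame :: "vec3 set \<Rightarrow> vec3 \<times> vec3 \<times> vec3" where
  "edge_frame e = (SOME (t, n1, n2). orthonormal3 t n1 n2 \<and> normal_to n1 e \<and> normal_to n2 e)"

definition edge_tangent :: "vec3 set \<Rightarrow> vec3" where
  "edge_tangent e = fst (edge_frame e)"

definition edge_normal1 :: "vec3 set \<Rightarrow> vec3" where
  "edge_normal1 e = fst (snd (edge_frame e))"

definition edge_normal2 :: "vec3 set \<Rightarrow> vec3" where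
  "edge_normal2 e = snd (snd (edge_frame e))"


section \<open>Matrix algebra\<close>

definition outer :: "vec3 \<Rightarrow> vec3 \<Rightarrow> mat3" where
  "outer c d = (\<chi> i j. c $ i * d $ j)"

definition mskw :: "vec3 \<Rightarrow> mat3" where
  "mskw v = matrix (\<lambda>w. cross3 v w)"

definition symm :: "mat3 \<Rightarrow> mat3" where
  "symm A = (1/2) *\<^sub>R (A + transpose A)"

definition skw :: "mat3 \<Rightarrow> mat3" where
  "skw A = (1/2) *\<^sub>R (A - transpose A)"

text \<open>\<^const>\<open>mskw\<close> is injective and its range consists of all skew-symmetric matrices,
  so the inverse is only applied inside its range.\<close>

definition vskw :: "mat3 \<Rightarrow> vec3" where
  "vskw A = inv mskw (skw A)"

definition S_map :: "mat3 \<Rightarrow> mat3" where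
  "S_map A = transpose A - trace A *\<^sub>R mat 1"


section \<open>Smooth fields and test functions\<close>

definition partial :: "3 \<Rightarrow> (vec3 \<Rightarrow> 'b::real_normed_vector) \<Rightarrow> vec3 \<Rightarrow> 'b" where
  "partial j \<phi> x = frechet_derivative \<phi> (at x) (axis j 1)"

primrec C_k :: "nat \<Rightarrow> (vec3 \<Rightarrow> 'b::real_normed_vector) \<Rightarrow> bool" where
  "C_k 0 \<phi> \<longleftrightarrow> continuous_on UNIV \<phi>"
| "C_k (Suc k) \<phi> \<longleftrightarrow> (\<forall>x. \<phi> differentiable (at x)) \<and> (\<forall>j. C_k k (partial j \<phi>))"

definition test_functions :: "vec3 set \<Rightarrow> (vec3 \<Rightarrow> 'b::real_normed_vector) set" where
  "test_functions \<Omega> = {\<phi>. (\<forall>k. C_k k \<phi>) \<and>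
     compact (closure {x. \<phi> x \<noteq> 0}) \<and> closure {x. \<phi> x \<noteq> 0} \<subseteq> \<Omega>}"

text \<open>Classical row-wise operators.\<close>

definition grad_field :: "(vec3 \<Rightarrow> vec3) \<Rightarrow> vec3 \<Rightarrow> mat3" where
  "grad_field v x = (\<chi> i j. partial j v x $ i)"

definition curl_field :: "(vec3 \<Rightarrow> mat3) \<Rightarrow> vec3 \<Rightarrow> mat3" where
  "curl_field W x = (\<chi> i. vector
     [partial 2 W x $ i $ 3 - partial 3 W x $ i $ 2,
      partial 3 W x $ i $ 1 - partial 1 W x $ i $ 3,
      partial 1 W x $ i $ 2 - partial 2 W x $ i $ 1])"

definition div_field :: "(vec3 \<Rightarrow> mat3) \<Rightarrow> vec3 \<Rightarrow> vec3" where
  "div_field W x = (\<chi> i. \<Sum>j\<in>UNIV. partial j W x $ i $ j)"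


section \<open>Distributions\<close>

text \<open>A \<open>'b\<close>-valued distribution on \<open>\<Omega>\<close> is a functional on \<open>'b\<close>-valued test functions. Functionals
  are given the value \<open>0\<close> outside the test space, so that equality of distributions on
  \<open>\<Omega>\<close> is equality in HOL. On matrices, \<open>\<bullet>\<close> is the Frobenius product \<open>A : W\<close>.\<close>

type_synonym 'b distr = "(vec3 \<Rightarrow> 'b) \<Rightarrow> real"

definition on_tests :: "vec3 set \<Rightarrow> ((vec3 \<Rightarrow> 'b::real_normed_vector) \<Rightarrow> real) \<Rightarrow> 'b distr" where
  "on_tests \<Omega> l = (\<lambda>\<phi>. if \<phi> \<in> test_functions \<Omega> then l \<phi> else 0)"

definition regular :: "vec3 set \<Rightarrow> (vec3 \<Rightarrow> 'b::real_inner) \<Rightarrow> 'b distr" where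
  "regular \<Omega> u = on_tests \<Omega> (\<lambda>\<phi>. integral \<Omega> (\<lambda>x. u x \<bullet> \<phi> x))"

text \<open>Integrals over segments and triangles with respect to length and area, by the
  affine parametrization from the vertices, with its constant length/area factor.
  They do not depend on the chosen order of the vertices.\<close>

definition edge_integral :: "vec3 set \<Rightarrow> (vec3 \<Rightarrow> real) \<Rightarrow> real" where
  "edge_integral e g =
     (let (a, b) = (SOME (a, b). a \<noteq> b \<and> e = convex hull {a, b}) in
      norm (b - a) * integral {0..1} (\<lambda>r. g (a + r *\<^sub>R (b - a))))"

definition face_integral :: "vec3 set \<Rightarrow> (vec3 \<Rightarrow> real) \<Rightarrow> real" where
  "face_integral f g =
     (let (a, b, c) = (SOME (a, b, c). \<not> collinear {a, b, c} \<and> f = convex hull {a, b, c}) in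
      norm (cross3 (b - a) (c - a)) *
      integral {(r, s). 0 \<le> r \<and> 0 \<le> s \<and> r + s \<le> 1}
        (\<lambda>(r, s). g (a + r *\<^sub>R (b - a) + s *\<^sub>R (c - a))))"

definition delta_vertex :: "vec3 set \<Rightarrow> vec3 \<Rightarrow> 'b::real_inner \<Rightarrow> 'b distr" where
  "delta_vertex \<Omega> x a = on_tests \<Omega> (\<lambda>\<phi>. a \<bullet> \<phi> x)"

definition delta_edge :: "vec3 set \<Rightarrow> vec3 set \<Rightarrow> 'b::real_inner \<Rightarrow> 'b distr" where
  "delta_edge \<Omega> e a = on_tests \<Omega> (\<lambda>\<phi>. edge_integral e (\<lambda>x. a \<bullet> \<phi> x))"

definition delta_face :: "vec3 set \<Rightarrow> vec3 set \<Rightarrow> 'b::real_inner \<Rightarrow> 'b distr" where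
  "delta_face \<Omega> f a = on_tests \<Omega> (\<lambda>\<phi>. face_integral f (\<lambda>x. a \<bullet> \<phi> x))"

text \<open>A linear map \<open>L\<close> acts pointwise on distributions by duality: \<open>\<langle>L T, \<phi>\<rangle> = \<langle>T, L\<^sup>* \<phi>\<rangle>\<close>.\<close>

definition pointwise ::
    "vec3 set \<Rightarrow> ('a::real_inner \<Rightarrow> 'b::real_inner) \<Rightarrow> 'a distr \<Rightarrow> 'b distr" where
  "pointwise \<Omega> L T = on_tests \<Omega> (\<lambda>\<phi>. T (\<lambda>x. adjoint L (\<phi> x)))"

definition grad_distr :: "vec3 set \<Rightarrow> vec3 distr \<Rightarrow> mat3 distr" where
  "grad_distr \<Omega> T = on_tests \<Omega> (\<lambda>W. - T (div_field W))"

definition curl_distr :: "vec3 set \<Rightarrow> mat3 distr \<Rightarrow> mat3 distr" where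
  "curl_distr \<Omega> T = on_tests \<Omega> (\<lambda>W. T (curl_field W))"

definition div_distr :: "vec3 set \<Rightarrow> mat3 distr \<Rightarrow> vec3 distr" where
  "div_distr \<Omega> T = on_tests \<Omega> (\<lambda>v. - T (grad_field v))"

text \<open>Distributions with values in the symmetric matrices, i.e. functionals on symmetric test
  matrices, are identified with those matrix distributions \<open>T\<close> for which
  \<open>T W = T (symm W)\<close>. Under this identification, testing a matrix distribution with symmetric
  matrices only amounts to applying \<^const>\<open>symm\<close> pointwise.\<close>

definition def_distr :: "vec3 set \<Rightarrow> vec3 distr \<Rightarrow> mat3 distr" where
  "def_distr \<Omega> T = pointwise \<Omega> symm (grad_distr \<Omega> T)"

definition inc_distr :: "vec3 set \<Rightarrow> mat3 distr \<Rightarrow> mat3 distr" where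
  "inc_distr \<Omega> T = pointwise \<Omega> symm (curl_distr \<Omega> (pointwise \<Omega> transpose (curl_distr \<Omega> T)))"


section \<open>The discrete spaces\<close>

text \<open>Spaces of functions are represented by the associated regular distributions; values on
  the null set outside the open cells are irrelevant.\<close>

definition piecewise_constant :: "vec3 set set \<Rightarrow> (vec3 \<Rightarrow> 'b) \<Rightarrow> bool" where
  "piecewise_constant \<Delta> u \<longleftrightarrow> (\<forall>K\<in>cells \<Delta>. u constant_on interior K)"

definition piecewise_affine :: "vec3 set set \<Rightarrow> vec3 set \<Rightarrow> (vec3 \<Rightarrow> vec3) \<Rightarrow> bool" where
  "piecewise_affine \<Delta> \<Omega> u \<longleftrightarrow>
     (\<forall>K\<in>cells \<Delta>. \<exists>(A::mat3) b. \<forall>x \<in> K \<inter> \<Omega>. u x = A *v x + b)"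

definition Lag :: "vec3 set set \<Rightarrow> vec3 set \<Rightarrow> vec3 distr set" where
  "Lag \<Delta> \<Omega> = {regular \<Omega> u | u. continuous_on \<Omega> u \<and> piecewise_affine \<Delta> \<Omega> u}"

text \<open>Since right multiplication by \<open>mskw n\<close> is the row-wise cross product with \<open>n\<close> from the right,
  \<open>n \<times> \<sigma> \<times> n = mskw n ** \<sigma> ** mskw n\<close>.\<close>

definition tt_continuous :: "vec3 set set \<Rightarrow> vec3 set \<Rightarrow> (vec3 \<Rightarrow> mat3) \<Rightarrow> bool" where
  "tt_continuous \<Delta> \<Omega> \<sigma> \<longleftrightarrow>
     (\<forall>f \<in> interior_faces \<Delta> \<Omega>. \<forall>K \<in> cells \<Delta>. \<forall>K' \<in> cells \<Delta>.
        f face_of K \<and> f face_of K' \<longrightarrow>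
        (\<forall>x \<in> interior K. \<forall>y \<in> interior K'.
           mskw (face_normal f) ** \<sigma> x ** mskw (face_normal f) =
           mskw (face_normal f) ** \<sigma> y ** mskw (face_normal f)))"

definition Reg :: "vec3 set set \<Rightarrow> vec3 set \<Rightarrow> mat3 distr set" where
  "Reg \<Delta> \<Omega> = {regular \<Omega> \<sigma> | \<sigma>. piecewise_constant \<Delta> \<sigma> \<and> (\<forall>x. transpose (\<sigma> x) = \<sigma> x) \<and>
     tt_continuous \<Delta> \<Omega> \<sigma>}"

definition Reg0_dual :: "vec3 set set \<Rightarrow> vec3 set \<Rightarrow> mat3 distr set" where
  "Reg0_dual \<Delta> \<Omega> = span {delta_edge \<Omega> e (outer (edge_tangent e) (edge_tangent e)) | e.
     e \<in> interior_edges \<Delta> \<Omega>}"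

definition Lag0_dual :: "vec3 set set \<Rightarrow> vec3 set \<Rightarrow> vec3 distr set" where
  "Lag0_dual \<Delta> \<Omega> = span {delta_vertex \<Omega> x v | x v. x \<in> interior_vertices \<Delta> \<Omega>}"

definition Vh0 :: "vec3 set set \<Rightarrow> vec3 set \<Rightarrow> vec3 distr set" where
  "Vh0 \<Delta> \<Omega> = Lag \<Delta> \<Omega>"

text \<open>The sum is direct because symmetric and skew-symmetric matrices intersect trivially.\<close>

definition Vh1 :: "vec3 set set \<Rightarrow> vec3 set \<Rightarrow> mat3 distr set" where
  "Vh1 \<Delta> \<Omega> = {\<sigma> + regular \<Omega> (\<lambda>x. mskw (c x)) | \<sigma> c.
     \<sigma> \<in> Reg \<Delta> \<Omega> \<and> piecewise_constant \<Delta> c}"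

definition Vh2 :: "vec3 set set \<Rightarrow> vec3 set \<Rightarrow> mat3 distr set" where
  "Vh2 \<Delta> \<Omega> = span (\<Union>f \<in> interior_faces \<Delta> \<Omega>.
     {delta_face \<Omega> f (outer (face_normal f) (face_tangent1 f)),
      delta_face \<Omega> f (outer (face_normal f) (face_tangent2 f)),
      delta_face \<Omega> f (outer (face_tangent1 f) (face_tangent1 f) +
                      outer (face_tangent2 f) (face_tangent2 f))})"

definition Vh3 :: "vec3 set set \<Rightarrow> vec3 set \<Rightarrow> vec3 distr set" where
  "Vh3 \<Delta> \<Omega> = span (\<Union>e \<in> interior_edges \<Delta> \<Omega>.
     {delta_edge \<Omega> e (edge_normal1 e), delta_edge \<Omega> e (edge_normal2 e)})"

definition Wh0 :: "vec3 set set \<Rightarrow> vec3 set \<Rightarrow> vec3 distr set" where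
  "Wh0 \<Delta> \<Omega> = {regular \<Omega> c | c. piecewise_constant \<Delta> c}"

definition Wh1 :: "vec3 set set \<Rightarrow> vec3 set \<Rightarrow> mat3 distr set" where
  "Wh1 \<Delta> \<Omega> = span {delta_face \<Omega> f (outer c (face_normal f)) | f c. f \<in> interior_faces \<Delta> \<Omega>}"

definition Wh2 :: "vec3 set set \<Rightarrow> vec3 set \<Rightarrow> mat3 distr set" where
  "Wh2 \<Delta> \<Omega> = span {delta_edge \<Omega> e (outer c (edge_tangent e)) | e c. e \<in> interior_edges \<Delta> \<Omega>}"

definition Wh3 :: "vec3 set set \<Rightarrow> vec3 set \<Rightarrow> vec3 distr set" where
  "Wh3 \<Delta> \<Omega> = span {delta_vertex \<Omega> x c | x c. x \<in> interior_vertices \<Delta> \<Omega>}"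

definition A0 :: "vec3 set \<Rightarrow> vec3 distr \<times> vec3 distr \<Rightarrow> mat3 distr \<times> mat3 distr" where
  "A0 \<Omega> = (\<lambda>(v, w). (grad_distr \<Omega> v + pointwise \<Omega> mskw w, grad_distr \<Omega> w))"

definition A1 :: "vec3 set \<Rightarrow> mat3 distr \<times> mat3 distr \<Rightarrow> mat3 distr \<times> mat3 distr" where
  "A1 \<Omega> = (\<lambda>(v, w). (curl_distr \<Omega> v + pointwise \<Omega> S_map w, curl_distr \<Omega> w))"

definition A2 :: "vec3 set \<Rightarrow> mat3 distr \<times> mat3 distr \<Rightarrow> vec3 distr \<times> vec3 distr" where
  "A2 \<Omega> = (\<lambda>(v, w). (div_distr \<Omega> v - 2 *\<^sub>R pointwise \<Omega> vskw w, div_distr \<Omega> w))"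


section \<open>Complexes and cohomology\<close>

text \<open>\<open>0 \<rightarrow> X0 \<rightarrow> X1 \<rightarrow> X2 \<rightarrow> X3 \<rightarrow> 0\<close> with differentials \<open>d0\<close>, \<open>d1\<close>, \<open>d2\<close>.\<close>

definition is_complex ::
    "'a::real_vector set \<Rightarrow> ('a \<Rightarrow> 'b::real_vector) \<Rightarrow> 'b set \<Rightarrow> ('b \<Rightarrow> 'c::real_vector) \<Rightarrow>
     'c set \<Rightarrow> ('c \<Rightarrow> 'd::real_vector) \<Rightarrow> 'd set \<Rightarrow> bool" where
  "is_complex X0 d0 X1 d1 X2 d2 X3 \<longleftrightarrow>
     subspace X0 \<and> subspace X1 \<and> subspace X2 \<and> subspace X3 \<and>
     linear d0 \<and> linear d1 \<and> linear d2 \<and>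
     d0 ` X0 \<subseteq> X1 \<and> d1 ` X1 \<subseteq> X2 \<and> d2 ` X2 \<subseteq> X3 \<and>
     (\<forall>x\<in>X0. d1 (d0 x) = 0) \<and> (\<forall>x\<in>X1. d2 (d1 x) = 0)"

definition ker_on :: "'a set \<Rightarrow> ('a \<Rightarrow> 'b::zero) \<Rightarrow> 'a set" where
  "ker_on X d = {x \<in> X. d x = 0}"

text \<open>The quotient space \<open>Z / B\<close> as the set of cosets, with its vector space operations.\<close>

definition quotient_by :: "'a::real_vector set \<Rightarrow> 'a set \<Rightarrow> 'a set set" where
  "quotient_by Z B = (\<lambda>z. {z + b | b. b \<in> B}) ` Z"

definition coset_add :: "'a::real_vector set \<Rightarrow> 'a set \<Rightarrow> 'a set" where
  "coset_add X Y = {x + y | x y. x \<in> X \<and> y \<in> Y}"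

text \<open>Adding \<open>B\<close> matters for \<open>r = 0\<close>, where \<open>{r *\<^sub>R x | x \<in> X}\<close> is not a coset.\<close>

definition coset_scale :: "'a::real_vector set \<Rightarrow> real \<Rightarrow> 'a set \<Rightarrow> 'a set" where
  "coset_scale B r X = {r *\<^sub>R x + b | x b. x \<in> X \<and> b \<in> B}"

definition quotients_isomorphic ::
    "'a::real_vector set \<Rightarrow> 'a set \<Rightarrow> 'b::real_vector set \<Rightarrow> 'b set \<Rightarrow> bool" where
  "quotients_isomorphic Z B Z' B' \<longleftrightarrow>
     (\<exists>F. bij_betw F (quotient_by Z B) (quotient_by Z' B') \<and>
        (\<forall>X \<in> quotient_by Z B. \<forall>Y \<in> quotient_by Z B. F (coset_add X Y) = coset_add (F X) (F Y)) \<and>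
        (\<forall>r. \<forall>X \<in> quotient_by Z B. F (coset_scale B r X) = coset_scale B' r (F X)))"

end

theory Submission
  imports Defs
begin

text \<open>
  The proof is the BGG elimination. The connecting maps \<open>S0 = mskw\<close>, \<open>S1 = S_map\<close>, \<open>S2 = -2 vskw\<close>
  anticommute with the differentials; \<open>S0\<close> is injective on \<open>Wh0\<close> with complement \<open>Reg\<close> in \<open>Vh1\<close>, \<open>S1\<close> maps
  \<open>Wh1\<close> bijectively onto \<open>Vh2\<close>, and \<open>S2\<close> maps \<open>Wh2\<close> onto \<open>Vh3\<close> with kernel \<open>Reg0_dual\<close>. Eliminating
  along these maps leaves \<open>def\<close>, \<open>curl \<circ> S1\<^sup>-\<^sup>1 \<circ> curl = inc\<close> and \<open>div\<close>; the isomorphisms are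
  \<open>(v, w) \<mapsto> symm v\<close> in low degrees and \<open>\<rho> \<mapsto> (0, \<rho>)\<close> in high degrees.

  That the differentials respect the discrete spaces follows from the divergence theorem on tetrahedra,
  Stokes' theorem on triangles and the fundamental theorem of calculus on edges. Only the existence
  of coefficients in these formulas is used: that the two cells adjacent to an interior face contribute
  with opposite signs is recovered by testing with bump functions. Bump functions also separate the
  edges, which gives the kernel of \<open>S2\<close>.
\<close>

section \<open>Cohomology of a BGG diagram\<close>

text \<open>The connecting maps dictate the generators. On a face, \<open>S_map\<close> turns the
  three components of c in c (x) n into coefficients of n (x) t1, n (x) t2 and t1 (x) t1 + t2 (x)
  t2. On an edge, -2 vskw sends c (x) t to the cross product of c and t, with range the normal plane
  and kernel spanned by t (x) t. The 2 stems from the Frobenius adjoint of \<open>mskw\<close>,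
  which is 2 vskw. Tangential-tangential continuity says that the jump across a face, crossed with
  n, is n (x) a tangent vector, which puts the curl into \<open>Vh2\<close>. The frames are chosen
  without a coherent orientation, so the signs in the integral formulas stay unknown coefficients.
  Boundary simplices drop out because test functions vanish on them. Identities between operators on
  distributions are dual to identities on test functions; these reduce to algebra of the
  coefficients of first-order operators and to the symmetry of second derivatives.\<close>

lemma mem_coset_iff: "x \<in> {z + b | b. b \<in> B} \<longleftrightarrow> x - z \<in> B" for x z :: "'a::real_vector"
proof
  assume "x - z \<in> B"
  then show "x \<in> {z + b | b. b \<in> B}" by (intro CollectI exI[of _ "x - z"]) simp
qed auto

lemma coset_eq_iff:
  fixes z z' :: "'a::real_vector"
  assumes B: "subspace B"
  shows "{z + b | b. b \<in> B} = {z' + b | b. b \<in> B} \<longleftrightarrow> z - z' \<in> B"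
proof
  assume eq: "{z + b | b. b \<in> B} = {z' + b | b. b \<in> B}"
  have "z \<in> {z + b | b. b \<in> B}"
    unfolding mem_coset_iff by (simp add: subspace_0[OF B])
  then show "z - z' \<in> B" unfolding eq mem_coset_iff .
next
  assume *: "z - z' \<in> B"
  have "x - z \<in> B \<longleftrightarrow> x - z' \<in> B" for x
    using subspace_add[OF B _ *, of "x - z"] subspace_diff[OF B _ *, of "x - z'"] by auto
  then show "{z + b | b. b \<in> B} = {z' + b | b. b \<in> B}"
    by (intro set_eqI) (simp only: mem_coset_iff)
qed

lemma coset_add_cosets:
  fixes z z' :: "'a::real_vector"
  assumes B: "subspace B"
  shows "coset_add {z + b | b. b \<in> B} {z' + b | b. b \<in> B} = {(z + z') + b | b. b \<in> B}"
proof (intro equalityI subsetI)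
  fix x assume "x \<in> coset_add {z + b | b. b \<in> B} {z' + b | b. b \<in> B}"
  then obtain u v where "x = u + v" "u - z \<in> B" "v - z' \<in> B"
    unfolding coset_add_def mem_coset_iff by auto
  then show "x \<in> {(z + z') + b | b. b \<in> B}"
    unfolding mem_coset_iff using subspace_add[OF B, of "u - z" "v - z'"]
        by (simp add: algebra_simps)
next
  fix x assume "x \<in> {(z + z') + b | b. b \<in> B}"
  then have "x = (x - z') + z'" "(x - z') - z \<in> B" "z' - z' \<in> B"
    unfolding mem_coset_iff by (auto simp: algebra_simps subspace_0[OF B])
  then show "x \<in> coset_add {z + b | b. b \<in> B} {z' + b | b. b \<in> B}"
    unfolding coset_add_def mem_coset_iff mem_Collect_eq by blast
qed

lemma coset_scale_coset:
  fixes z :: "'a::real_vector"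
  assumes B: "subspace B"
  shows "coset_scale B r {z + b | b. b \<in> B} = {r *\<^sub>R z + b | b. b \<in> B}"
proof (intro equalityI subsetI)
  fix x assume "x \<in> coset_scale B r {z + b | b. b \<in> B}"
  then obtain u b where "u - z \<in> B" "b \<in> B" "x = r *\<^sub>R u + b"
    unfolding coset_scale_def mem_coset_iff by auto
  then show "x \<in> {r *\<^sub>R z + b | b. b \<in> B}"
    unfolding mem_coset_iff using subspace_add[OF B subspace_scale[OF B, of "u - z" r], of b]
    by (simp add: algebra_simps)
next
  fix x assume "x \<in> {r *\<^sub>R z + b | b. b \<in> B}"
  then have "x = r *\<^sub>R z + (x - r *\<^sub>R z)" "x - r *\<^sub>R z \<in> B" "z - z \<in> B"
    unfolding mem_coset_iff by (auto simp: subspace_0[OF B])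
  then show "x \<in> coset_scale B r {z + b | b. b \<in> B}"
    unfolding coset_scale_def mem_coset_iff mem_Collect_eq by blast
qed

text \<open>A constant in place of the comprehension, so that the three rules below can be used as
  rewrite rules for cosets.\<close>

definition coset :: "'a::real_vector set \<Rightarrow> 'a \<Rightarrow> 'a set" where
  "coset B z = {z + b | b. b \<in> B}"

lemma quotient_by_coset: "quotient_by Z B = coset B ` Z"
  unfolding quotient_by_def coset_def ..

lemma coset_eq: "subspace B \<Longrightarrow> coset B z = coset B z' \<longleftrightarrow> z - z' \<in> B"
  unfolding coset_def by (rule coset_eq_iff)

lemma coset_add: "subspace B \<Longrightarrow> coset_add (coset B z) (coset B z') = coset B (z + z')"
  unfolding coset_def by (rule coset_add_cosets)

lemma coset_scale: "subspace B \<Longrightarrow> coset_scale B r (coset B z) = coset B (r *\<^sub>R z)"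
  unfolding coset_def by (rule coset_scale_coset)

text \<open>The condition \<open>inj\<close> does double duty: applied to a difference of
  representatives, one direction makes the induced map well defined and the other makes it
  injective. Surjectivity is only required up to \<open>B'\<close>.\<close>

lemma quotients_isomorphicI:
  fixes h :: "'a::real_vector \<Rightarrow> 'b::real_vector"
  assumes Z: "subspace Z" and B: "subspace B" and B': "subspace B'"
    and h: "linear h" "\<And>z. z \<in> Z \<Longrightarrow> h z \<in> Z'"
    and inj: "\<And>z. z \<in> Z \<Longrightarrow> h z \<in> B' \<longleftrightarrow> z \<in> B"
    and surj: "\<And>z'. z' \<in> Z' \<Longrightarrow> \<exists>z\<in>Z. z' - h z \<in> B'"
  shows "quotients_isomorphic Z B Z' B'"
proof -
  have eq_iff: "coset B' (h x) = coset B' (h y) \<longleftrightarrow> coset B x = coset B y" if "x \<in> Z" "y \<in> Z" for x y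
    using inj[OF subspace_diff[OF Z that]] unfolding coset_eq[OF B] coset_eq[OF B'] linear_diff[OF
        h(1)] .
  \<comment> \<open>A representative is picked by choice; \<open>eq_iff\<close> shows that the value
    does not depend on it.\<close>
  define F where "F X = coset B' (h (SOME z. z \<in> Z \<and> X = coset B z))" for X
  have F: "F (coset B z) = coset B' (h z)" if z: "z \<in> Z" for z
  proof -
    define y where "y = (SOME y. y \<in> Z \<and> coset B z = coset B y)"
    have y: "y \<in> Z \<and> coset B z = coset B y"
      unfolding y_def by (rule someI[of _ z]) (use z in simp)
    then have "coset B' (h y) = coset B' (h z)" using eq_iff[of y z] z by simp
    then show ?thesis unfolding F_def y_def[symmetric] .
  qed
  have "bij_betw F (quotient_by Z B) (quotient_by Z' B')"
    unfolding bij_betw_def quotient_by_coset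
  proof
    show "inj_on F (coset B ` Z)"
    proof (rule inj_onI)
      fix X Y assume "X \<in> coset B ` Z" "Y \<in> coset B ` Z" and eq: "F X = F Y"
      then obtain x y where xy: "x \<in> Z" "y \<in> Z" "X = coset B x" "Y = coset B y" by blast
      show "X = Y" using eq unfolding xy F[OF xy(1)] F[OF xy(2)] eq_iff[OF xy(1,2)] .
    qed
    show "F ` coset B ` Z = coset B' ` Z'"
    proof
      show "F ` coset B ` Z \<subseteq> coset B' ` Z'"
      proof (intro subsetI, elim imageE)
        fix X Y z assume "X = F Y" "Y = coset B z" "z \<in> Z"
        then show "X \<in> coset B' ` Z'" using F[of z] h(2)[of z] by simp
      qed
      show "coset B' ` Z' \<subseteq> F ` coset B ` Z"
      proof
        fix X assume "X \<in> coset B' ` Z'"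
        then obtain x where x: "x \<in> Z'" "X = coset B' x" by blast
        obtain z where z: "z \<in> Z" "x - h z \<in> B'" using surj x by blast
        then have "X = F (coset B z)" using x by (simp add: F coset_eq B')
        then show "X \<in> F ` coset B ` Z" using z by blast
      qed
    qed
  qed
  moreover have "F (coset_add X Y) = coset_add (F X) (F Y)"
    if XY: "X \<in> quotient_by Z B" "Y \<in> quotient_by Z B" for X Y
  proof -
    obtain x y where xy: "x \<in> Z" "y \<in> Z" "X = coset B x" "Y = coset B y"
      using XY unfolding quotient_by_coset by blast
    show ?thesis
      by (simp only: xy coset_add[OF B] coset_add[OF B'] F subspace_add[OF Z] linear_add[OF h(1)])
  qed
  moreover have "F (coset_scale B r X) = coset_scale B' r (F X)"
    if X: "X \<in> quotient_by Z B" for r X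
  proof -
    obtain x where x: "x \<in> Z" "X = coset B x"
      using X unfolding quotient_by_coset by blast
    show ?thesis
      by (simp only: x coset_scale[OF B] coset_scale[OF B'] F subspace_scale[OF Z] linear_scale[OF
          h(1)])
  qed
  ultimately show ?thesis unfolding quotients_isomorphic_def by (intro exI[of _ F]) simp
qed

text \<open>In degrees 2 and 3 the explicit map starts from the Regge side, while the isomorphisms
  are stated from the twisted side.\<close>

lemma quotients_isomorphic_sym:
  assumes Z: "subspace Z" and B: "subspace B" and iso: "quotients_isomorphic Z B Z' B'"
  shows "quotients_isomorphic Z' B' Z B"
proof -
  obtain F where F: "bij_betw F (quotient_by Z B) (quotient_by Z' B')"
    and add: "\<And>X Y. X \<in> quotient_by Z B \<Longrightarrow> Y \<in> quotient_by Z B \<Longrightarrow>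
      F (coset_add X Y) = coset_add (F X) (F Y)"
    and scale: "\<And>r X. X \<in> quotient_by Z B \<Longrightarrow> F (coset_scale B r X) = coset_scale B' r (F X)"
    using iso unfolding quotients_isomorphic_def by blast
  define G where "G = inv_into (quotient_by Z B) F"
  have G: "bij_betw G (quotient_by Z' B') (quotient_by Z B)"
    unfolding G_def by (rule bij_betw_inv_into[OF F])
  have GF: "G (F X) = X" if "X \<in> quotient_by Z B" for X
    unfolding G_def by (rule bij_betw_inv_into_left[OF F that])
  have FG: "F (G X) = X" if "X \<in> quotient_by Z' B'" for X
    unfolding G_def by (rule bij_betw_inv_into_right[OF F that])
  have Gin: "G X \<in> quotient_by Z B" if "X \<in> quotient_by Z' B'" for X
    by (rule bij_betwE[OF G, rule_format, OF that])
  have cadd: "coset_add X Y \<in> quotient_by Z B"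
    if "X \<in> quotient_by Z B" "Y \<in> quotient_by Z B" for X Y
    using that subspace_add[OF Z] by (auto simp: quotient_by_coset coset_add B)
  have cscale: "coset_scale B r X \<in> quotient_by Z B" if "X \<in> quotient_by Z B" for r X
    using that subspace_scale[OF Z] by (auto simp: quotient_by_coset coset_scale B)
  have "G (coset_add X Y) = coset_add (G X) (G Y)"
    if X: "X \<in> quotient_by Z' B'" and Y: "Y \<in> quotient_by Z' B'" for X Y
  proof -
    have "coset_add X Y = F (coset_add (G X) (G Y))"
      by (simp add: add[OF Gin[OF X] Gin[OF Y]] FG X Y)
    then show ?thesis by (simp add: GF cadd[OF Gin[OF X] Gin[OF Y]])
  qed
  moreover have "G (coset_scale B' r X) = coset_scale B r (G X)"
    if X: "X \<in> quotient_by Z' B'" for r X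
  proof -
    have "coset_scale B' r X = F (coset_scale B r (G X))"
      by (simp add: scale[OF Gin[OF X]] FG X)
    then show ?thesis by (simp add: GF cscale[OF Gin[OF X]])
  qed
  ultimately show ?thesis unfolding quotients_isomorphic_def using G by (intro exI[of _ G]) simp
qed

lemma subspace_ker_on: "subspace X \<Longrightarrow> linear d \<Longrightarrow> subspace (ker_on X d)"
  unfolding subspace_def ker_on_def by (auto simp: linear_0 linear_add linear_scale)

text \<open>\<open>S0\<close>, \<open>S1\<close>, \<open>S2\<close> connect the two rows of the twisted complex; \<open>Q\<close> inverts \<open>S1\<close>, and \<open>p\<close>
  projects \<open>V1\<close> onto the complement \<open>R\<close> of \<open>S0 ` W0\<close>.\<close>

locale bgg_diagram =
  fixes V0 :: "'v0::real_vector set" and V1 :: "'v1::real_vector set"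
    and V2 :: "'v2::real_vector set" and V3 :: "'v3::real_vector set"
    and W0 :: "'w0::real_vector set" and W1 :: "'w1::real_vector set"
    and W2 :: "'w2::real_vector set" and W3 :: "'w3::real_vector set"
    and d0 :: "'v0 \<Rightarrow> 'v1" and d1 :: "'v1 \<Rightarrow> 'v2" and d2 :: "'v2 \<Rightarrow> 'v3"
    and e0 :: "'w0 \<Rightarrow> 'w1" and e1 :: "'w1 \<Rightarrow> 'w2" and e2 :: "'w2 \<Rightarrow> 'w3"
    and S0 :: "'w0 \<Rightarrow> 'v1" and S1 :: "'w1 \<Rightarrow> 'v2" and S2 :: "'w2 \<Rightarrow> 'v3"
    and Q :: "'v2 \<Rightarrow> 'w1" and R :: "'v1 set" and p :: "'v1 \<Rightarrow> 'v1"
  assumes V: "subspace V0" "subspace V1" "subspace V2" "subspace V3"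
    and W: "subspace W0" "subspace W1" "subspace W2" "subspace W3"
    and d_lin: "linear d0" "linear d1" "linear d2"
    and e_lin: "linear e0" "linear e1" "linear e2"
    and S_lin: "linear S0" "linear S1" "linear S2" "linear Q" "linear p"
    and R: "subspace R"
    and d0V: "\<And>v. v \<in> V0 \<Longrightarrow> d0 v \<in> V1"
    and d1V: "\<And>v. v \<in> R \<Longrightarrow> d1 v \<in> V2"
    and e0W: "\<And>w. w \<in> W0 \<Longrightarrow> e0 w \<in> W1"
    and e1W: "\<And>w. w \<in> W1 \<Longrightarrow> e1 w \<in> W2"
    and e2W: "\<And>w. w \<in> W2 \<Longrightarrow> e2 w \<in> W3"
    and V1_eq: "V1 = {r + S0 w | r w. r \<in> R \<and> w \<in> W0}"
    and V2_eq: "V2 = S1 ` W1"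
    and V3_eq: "V3 = S2 ` W2"
    and dd: "\<And>v. v \<in> V0 \<Longrightarrow> d1 (d0 v) = 0" "\<And>v. v \<in> V1 \<Longrightarrow> d2 (d1 v) = 0"
    and ee: "\<And>w. w \<in> W0 \<Longrightarrow> e1 (e0 w) = 0" "\<And>w. w \<in> W1 \<Longrightarrow> e2 (e1 w) = 0"
    and dS0: "\<And>w. w \<in> W0 \<Longrightarrow> d1 (S0 w) = - S1 (e0 w)"
    and dS1: "\<And>w. w \<in> W1 \<Longrightarrow> d2 (S1 w) = - S2 (e1 w)"
    and S0_inj: "\<And>w. w \<in> W0 \<Longrightarrow> S0 w = 0 \<Longrightarrow> w = 0"
    and QS: "\<And>w. w \<in> W1 \<Longrightarrow> Q (S1 w) = w"
    and pR: "\<And>r. r \<in> R \<Longrightarrow> p r = r"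
    and pS0: "\<And>w. w \<in> W0 \<Longrightarrow> p (S0 w) = 0"
begin

text \<open>Third space of the reduced complex; it becomes the span of the edge deltas of t (x) t.
  Its differentials are \<open>D0\<close>, which forgets the \<open>S0\<close> component, and the
  zigzag \<open>D1\<close>, which climbs from the upper to the lower row through the inverse
  \<open>Q\<close> of \<open>S1\<close>.\<close>

definition "K2 = {w \<in> W2. S2 w = 0}"

definition "D0 v = p (d0 v)"
definition "D1 v = e1 (Q (d1 v))"
definition "B0 = (\<lambda>(v, w). (d0 v + S0 w, e0 w))"
definition "B1 = (\<lambda>(v, w). (d1 v + S1 w, e1 w))"
definition "B2 = (\<lambda>(v, w). (d2 v + S2 w, e2 w))"

lemmas lin = d_lin e_lin S_lin

lemma lin0 [simp]: "d0 0 = 0" "d1 0 = 0" "d2 0 = 0" "e0 0 = 0" "e1 0 = 0" "e2 0 = 0"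
    "S0 0 = 0" "S1 0 = 0" "S2 0 = 0" "Q 0 = 0" "p 0 = 0"
  using lin linear_0 by auto

lemmas lin_simps = lin[THEN linear_add] lin[THEN linear_diff] lin[THEN linear_scale] lin[THEN
    linear_neg]

lemma subspace_K2: "subspace K2"
  unfolding K2_def using W(3) by (auto simp: subspace_def lin_simps)

lemma linear_D: "linear D0" "linear D1"
  unfolding D0_def D1_def by (auto intro!: linearI simp: lin_simps)

lemma linear_B: "linear B0" "linear B1" "linear B2"
  unfolding B0_def B1_def B2_def by (auto intro!: linearI simp: lin_simps algebra_simps)

lemma RV1: "r \<in> R \<Longrightarrow> r \<in> V1"
  unfolding V1_eq using subspace_0[OF W(1)] by force

lemma S0V: "w \<in> W0 \<Longrightarrow> S0 w \<in> V1"
  unfolding V1_eq using subspace_0[OF R] by force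

lemma S1V: "w \<in> W1 \<Longrightarrow> S1 w \<in> V2"
  by (simp add: V2_eq)

lemma S2V: "w \<in> W2 \<Longrightarrow> S2 w \<in> V3"
  by (simp add: V3_eq)

lemma SQ: "v \<in> V2 \<Longrightarrow> S1 (Q v) = v"
  and QW: "v \<in> V2 \<Longrightarrow> Q v \<in> W1"
  unfolding V2_eq using QS by auto

text \<open>\<open>p\<close> projects along the image of \<open>S0\<close>, so the \<open>R\<close>
  component can be named as \<open>p v\<close> instead of an anonymous \<open>r\<close>.\<close>

lemma V1_cases:
  assumes "v \<in> V1"
  obtains w where "w \<in> W0" "v = p v + S0 w" "p v \<in> R"
proof -
  obtain r w where rw: "r \<in> R" "w \<in> W0" and v: "v = r + S0 w" using assms unfolding V1_eq by blast
  have "p v = r" unfolding v using rw by (simp add: lin_simps pR pS0)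
  then show ?thesis using that[OF rw(2)] rw(1) v by simp
qed

text \<open>Only the \<open>R\<close> component needs an analytic argument; on \<open>S0 w\<close>
  the anticommutation turns \<open>d1\<close> into \<open>- S1 (e0 w)\<close>.\<close>

lemma d1V1: "v \<in> V1 \<Longrightarrow> d1 v \<in> V2"
proof -
  assume "v \<in> V1"
  then obtain w where w: "w \<in> W0" "v = p v + S0 w" "p v \<in> R" by (rule V1_cases)
  have "d1 v = d1 (p v + S0 w)" using w(2) by (rule arg_cong)
  then have "d1 v = d1 (p v) - S1 (e0 w)" using dS0[OF w(1)] by (simp add: lin_simps)
  then show ?thesis using w(1,3) d1V e0W S1V subspace_diff[OF V(3)] by auto
qed

text \<open>Every element of \<open>V2\<close> is some \<open>S1 w\<close>, so this follows from the
  lower row: no integration by parts is done for the divergence on \<open>Vh2\<close>.\<close>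

lemma d2V2: "v \<in> V2 \<Longrightarrow> d2 v \<in> V3"
proof -
  assume "v \<in> V2"
  then obtain w where "w \<in> W1" "v = S1 w" unfolding V2_eq by blast
  then show ?thesis using dS1 e1W S2V subspace_neg[OF V(4)] by auto
qed

text \<open>Pushing \<open>S2\<close> past \<open>e1\<close> gives
  \<open>- d2 (S1 (Q (d1 v)))\<close>, which is \<open>- d2 (d1 v)\<close>.\<close>

lemma D1_K2: "v \<in> V1 \<Longrightarrow> D1 v \<in> K2"
proof -
  assume v: "v \<in> V1"
  then have Q: "Q (d1 v) \<in> W1" "S1 (Q (d1 v)) = d1 v" using d1V1 SQ QW by auto
  then have "S2 (D1 v) = - d2 (d1 v)" unfolding D1_def using dS1[OF Q(1)] by simp
  then show ?thesis using v dd Q e1W unfolding K2_def D1_def by auto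
qed

text \<open>The zigzag applied to \<open>S0 w\<close> collapses to \<open>- e1 (e0 w)\<close>. Hence
  \<open>D1\<close> depends on the \<open>R\<close> component only, which is
  \<open>D1_p\<close>.\<close>

lemma D1_S0: "w \<in> W0 \<Longrightarrow> D1 (S0 w) = 0"
  unfolding D1_def by (simp add: dS0 lin_simps QS e0W ee)

lemma D1_p:
  assumes "v \<in> V1"
  shows "D1 (p v) = D1 v"
proof -
  obtain w where w: "w \<in> W0" "v = p v + S0 w" using assms by (rule V1_cases)
  have "D1 v = D1 (p v + S0 w)" using w(2) by (rule arg_cong)
  then show ?thesis by (simp add: linear_add[OF linear_D(2)] D1_S0 w(1))
qed

lemma pV1: "v \<in> V1 \<Longrightarrow> p v \<in> R"
  by (rule V1_cases)

text \<open>The cross terms \<open>d1 (S0 w) + S1 (e0 w)\<close> and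
  \<open>d2 (S1 w) + S2 (e1 w)\<close> cancel by anticommutation.\<close>

lemma twisted_complex:
  "is_complex (V0 \<times> W0) B0 (V1 \<times> W1) B1 (V2 \<times> W2) B2 (V3 \<times> W3)"
proof -
  have "B0 (v, w) \<in> V1 \<times> W1" "B1 (B0 (v, w)) = 0" if "v \<in> V0" "w \<in> W0" for v w
    using that by (auto simp: B0_def B1_def zero_prod_def lin_simps dd ee dS0
      intro!: subspace_add V d0V S0V e0W)
  moreover have "B1 (v, w) \<in> V2 \<times> W2" "B2 (B1 (v, w)) = 0" if "v \<in> V1" "w \<in> W1" for v w
    using that by (auto simp: B1_def B2_def zero_prod_def lin_simps dd ee dS1
      intro!: subspace_add V d1V1 S1V e1W)
  moreover have "B2 (v, w) \<in> V3 \<times> W3" if "v \<in> V2" "w \<in> W2" for v w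
    using that by (auto simp: B2_def intro!: subspace_add V d2V2 S2V e2W)
  ultimately show ?thesis
    unfolding is_complex_def by (intro conjI subspace_Times V W linear_B) blast+
qed

lemma derived_complex: "is_complex V0 D0 R D1 K2 e2 W3"
  unfolding is_complex_def
proof (intro conjI ballI)
  show "D0 ` V0 \<subseteq> R"
    unfolding D0_def using pV1 d0V by blast
  show "D1 (D0 x) = 0" if "x \<in> V0" for x
    using that D1_p[OF d0V] unfolding D0_def by (simp add: D1_def dd)
  show "e2 (D1 x) = 0" if "x \<in> R" for x
    unfolding D1_def using QW[OF d1V[OF that]] ee by simp
  show "D1 ` R \<subseteq> K2" using D1_K2 RV1 by blast
  show "e2 ` K2 \<subseteq> W3" unfolding K2_def using e2W by blast
qed (fact V W R e_lin linear_D subspace_K2)+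

lemma mem_ker_B:
  "(v, w) \<in> ker_on (V0 \<times> W0) B0 \<longleftrightarrow> v \<in> V0 \<and> w \<in> W0 \<and> d0 v = - S0 w \<and> e0 w = 0"
  "(v1, w1) \<in> ker_on (V1 \<times> W1) B1 \<longleftrightarrow> v1 \<in> V1 \<and> w1 \<in> W1 \<and> d1 v1 = - S1 w1 \<and> e1 w1 = 0"
  "(v2, w2) \<in> ker_on (V2 \<times> W2) B2 \<longleftrightarrow> v2 \<in> V2 \<and> w2 \<in> W2 \<and> d2 v2 = - S2 w2 \<and> e2 w2 = 0"
  unfolding ker_on_def B0_def B1_def B2_def by (auto simp: zero_prod_def eq_neg_iff_add_eq_0)

lemma W1_inj: "w \<in> W1 \<Longrightarrow> S1 w = 0 \<Longrightarrow> w = 0"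
  using QS by force

text \<open>In a kernel pair the second component is determined by the first, because
  \<open>S0\<close> is injective. Conversely \<open>p (d0 v) = 0\<close> says that
  \<open>d0 v\<close> is some \<open>S0 w\<close>, and \<open>- w\<close> completes \<open>v\<close>
  to a pair.\<close>

lemma cohomology0: "quotients_isomorphic (ker_on (V0 \<times> W0) B0) {0} (ker_on V0 D0) {0}"
proof (rule quotients_isomorphicI[where h=fst])
  show "subspace (ker_on (V0 \<times> W0) B0)"
    by (intro subspace_ker_on subspace_Times V W linear_B)
  fix z assume z: "z \<in> ker_on (V0 \<times> W0) B0"
  obtain v w where vw: "z = (v, w)" by force
  have *: "v \<in> V0" "w \<in> W0" "d0 v = - S0 w" "e0 w = 0" using z unfolding vw mem_ker_B by auto
  have "p (d0 v) = 0" using * pS0 by (simp add: lin_simps)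
  then show "fst z \<in> ker_on V0 D0"
    using * by (auto simp: vw ker_on_def D0_def)
  show "fst z \<in> {0} \<longleftrightarrow> z \<in> {0}"
    using * S0_inj[OF *(2)] by (auto simp: vw zero_prod_def)
next
  fix v assume v: "v \<in> ker_on V0 D0"
  then have "d0 v \<in> V1" "p (d0 v) = 0" by (auto simp: ker_on_def D0_def d0V)
  obtain w where w: "w \<in> W0" "d0 v = p (d0 v) + S0 w" using \<open>d0 v \<in> V1\<close> by (rule V1_cases)
  have w2: "d0 v = S0 w" using w(2) unfolding \<open>p (d0 v) = 0\<close> by simp
  \<comment> \<open>The equation in the lower row comes for free from \<open>d1 (d0 v) = 0\<close>
    and the injectivity of \<open>S1\<close>.\<close>
  have "S1 (e0 w) = 0" using dS0[OF w(1)] dd(1)[of v] v w2 by (auto simp: ker_on_def)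
  then have "e0 w = 0" using W1_inj e0W w(1) by blast
  moreover have "v \<in> V0" using v by (simp add: ker_on_def)
  ultimately have "(v, - w) \<in> ker_on (V0 \<times> W0) B0"
    unfolding mem_ker_B using w(1) w2 subspace_neg[OF W(1)] by (auto simp: lin_simps)
  then show "\<exists>z\<in>ker_on (V0 \<times> W0) B0. v - fst z \<in> {0}" by force
qed (auto simp: linear_fst)

text \<open>A kernel pair is determined by \<open>v\<close>, since \<open>S1 w = - d1 v\<close>, and
  its \<open>S0\<close> component can be removed by the image of a pair (0, c).\<close>

lemma cohomology1:
  "quotients_isomorphic (ker_on (V1 \<times> W1) B1) (B0 ` (V0 \<times> W0)) (ker_on R D1) (D0 ` V0)"
proof (rule quotients_isomorphicI[where h="\<lambda>x. p (fst x)"])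
  show "subspace (ker_on (V1 \<times> W1) B1)"
    by (intro subspace_ker_on subspace_Times V W linear_B)
  show "subspace (B0 ` (V0 \<times> W0))" "subspace (D0 ` V0)"
    by (intro linear_subspace_image subspace_Times V W linear_B linear_D)+
  show "linear (\<lambda>x. p (fst x :: 'v1) :: 'v1)" by (auto intro!: linearI simp: lin_simps)
  fix z assume z: "z \<in> ker_on (V1 \<times> W1) B1"
  obtain v w where vw: "z = (v, w)" by force
  have *: "v \<in> V1" "w \<in> W1" "d1 v = - S1 w" "e1 w = 0" using z unfolding vw mem_ker_B by auto
  obtain c where c: "c \<in> W0" "v = p v + S0 c" "p v \<in> R" using *(1) by (rule V1_cases)
  have "D1 v = 0" unfolding D1_def using * QS by (simp add: lin_simps)
  then show "p (fst z) \<in> ker_on R D1"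
    using D1_p[OF *(1)] c(3) by (auto simp: vw ker_on_def)
  show "p (fst z) \<in> D0 ` V0 \<longleftrightarrow> z \<in> B0 ` (V0 \<times> W0)"
  proof
    assume "p (fst z) \<in> D0 ` V0"
    then obtain u where u: "u \<in> V0" "p v = p (d0 u)" by (auto simp: vw D0_def)
    obtain c' where c': "c' \<in> W0" "d0 u = p (d0 u) + S0 c'" using d0V[OF u(1)] by (rule V1_cases)
    \<comment> \<open>The difference of the two \<open>S0\<close> components is the second entry of
      the wanted preimage under \<open>B0\<close>.\<close>
    have cc: "c - c' \<in> W0" using c c' subspace_diff[OF W(1)] by blast
    have "d0 u - S0 c' = p v" using c'(2) u(2) by (metis add_diff_cancel_right')
    then have "v = (d0 u - S0 c') + S0 c" using c(2) by metis
    then have v: "v = d0 u + S0 (c - c')" by (subst linear_diff[OF S_lin(1)]) simp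
    then have "d1 v = - S1 (e0 (c - c'))" using dS0[OF cc] dd(1)[OF u(1)] by (simp add: lin_simps)
    then have "S1 w = S1 (e0 (c - c'))" using *(3) by simp
    then have "S1 (w - e0 (c - c')) = 0" by (subst linear_diff[OF S_lin(2)]) simp
    moreover have "w - e0 (c - c') \<in> W1" using * cc e0W subspace_diff[OF W(2)] by blast
    ultimately have "w = e0 (c - c')" using W1_inj by force
    then have "z = B0 (u, c - c')" using v by (simp add: vw B0_def)
    then show "z \<in> B0 ` (V0 \<times> W0)" using u cc by blast
  next
    assume "z \<in> B0 ` (V0 \<times> W0)"
    then show "p (fst z) \<in> D0 ` V0"
      by (auto simp: B0_def D0_def lin_simps pS0)
  qed
next
  fix r assume r: "r \<in> ker_on R D1"
  then have rR: "r \<in> R" and "e1 (Q (d1 r)) = 0" by (auto simp: ker_on_def D1_def)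
  \<comment> \<open>The lift of \<open>r\<close> is forced: its second entry must solve
    \<open>S1 w = - d1 r\<close>.\<close>
  moreover have "Q (d1 r) \<in> W1" "S1 (Q (d1 r)) = d1 r" using d1V QW SQ rR by auto
  ultimately have "(r, - Q (d1 r)) \<in> ker_on (V1 \<times> W1) B1"
    using RV1 subspace_neg[OF W(2)] by (auto simp: mem_ker_B lin_simps)
  moreover have "r - p (fst (r, - Q (d1 r))) = D0 0" using pR rR by (simp add: D0_def)
  ultimately show "\<exists>z\<in>ker_on (V1 \<times> W1) B1. r - p (fst z) \<in> D0 ` V0"
    using subspace_0[OF V(1)] by blast
qed

text \<open>Subtracting \<open>B1 (0, Q v)\<close> moves any cocycle into the lower row, where the
  kernel condition leaves an element of \<open>K2\<close>.\<close>

lemma cohomology2: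
  "quotients_isomorphic (ker_on (V2 \<times> W2) B2) (B1 ` (V1 \<times> W1)) (ker_on K2 e2) (D1 ` R)"
proof (rule quotients_isomorphic_sym)
  have s: "subspace (ker_on K2 e2)" "subspace (D1 ` R)"
    "subspace (ker_on (V2 \<times> W2) B2)" "subspace (B1 ` (V1 \<times> W1))"
    by (intro linear_subspace_image subspace_Times subspace_ker_on V W R linear_B linear_D
      subspace_K2 e_lin)+
  show "subspace (ker_on K2 e2)" "subspace (D1 ` R)" by (fact s)+
  show "quotients_isomorphic (ker_on K2 e2) (D1 ` R) (ker_on (V2 \<times> W2) B2) (B1 ` (V1 \<times> W1))"
  proof (rule quotients_isomorphicI[where h="\<lambda>x. (0, x)"])
    show "linear (\<lambda>x. (0::'v2, x :: 'w2))" by (auto intro!: linearI)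
    fix z assume z: "z \<in> ker_on K2 e2"
    then show "(0, z) \<in> ker_on (V2 \<times> W2) B2"
      unfolding mem_ker_B using subspace_0[OF V(3)] by (auto simp: ker_on_def K2_def)
    show "(0, z) \<in> B1 ` (V1 \<times> W1) \<longleftrightarrow> z \<in> D1 ` R"
    proof
      assume "(0, z) \<in> B1 ` (V1 \<times> W1)"
      then obtain v w where *: "v \<in> V1" "w \<in> W1" "d1 v = - S1 w" "z = e1 w"
        by (auto simp: B1_def eq_neg_iff_add_eq_0)
      then have "Q (d1 v) = - w" using QS by (simp add: lin_simps)
      then have "z = - D1 v" using * by (simp add: D1_def lin_simps)
      then have "z = D1 (- p v)" using D1_p[OF *(1)] linear_neg[OF linear_D(2)] by simp
      moreover have "- p v \<in> R" using pV1[OF *(1)] subspace_neg[OF R] by blast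
      ultimately show "z \<in> D1 ` R" by blast
    next
      assume "z \<in> D1 ` R"
      then obtain r where r: "r \<in> R" "z = D1 r" by blast
      \<comment> \<open>With first entry \<open>- r\<close> the upper component
        \<open>- d1 r + S1 (Q (d1 r))\<close> vanishes and the lower one is
        \<open>D1 r\<close>.\<close>
      have q: "Q (d1 r) \<in> W1" "S1 (Q (d1 r)) = d1 r" using d1V QW SQ r by auto
      then have "(0, z) = B1 (- r, Q (d1 r))"
        unfolding B1_def r D1_def by (simp add: lin_simps)
      then show "(0, z) \<in> B1 ` (V1 \<times> W1)" using q r RV1 subspace_neg[OF V(2)] by blast
    qed
  next
    fix z' assume z': "z' \<in> ker_on (V2 \<times> W2) B2"
    obtain v w where vw: "z' = (v, w)" by force
    have *: "v \<in> V2" "w \<in> W2" "d2 v = - S2 w" "e2 w = 0" using z' unfolding vw mem_ker_B by auto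
    have q: "Q v \<in> W1" "S1 (Q v) = v" using QW SQ * by auto
    define z where "z = w - e1 (Q v)"
    have "S2 z = 0" using dS1[OF q(1)] q(2) *(3) by (simp add: z_def lin_simps)
    moreover have "z \<in> W2" unfolding z_def using * q e1W subspace_diff[OF W(3)] by auto
    moreover have "e2 z = 0" unfolding z_def using ee(2)[OF q(1)] * by (simp add: lin_simps)
    ultimately have "z \<in> ker_on K2 e2" by (auto simp: ker_on_def K2_def)
    moreover have "z' - (0, z) = B1 (0, Q v)" by (simp add: vw z_def B1_def q)
    ultimately show "\<exists>z\<in>ker_on K2 e2. z' - (0, z) \<in> B1 ` (V1 \<times> W1)"
      using q subspace_0[OF V(2)] by blast
  qed (fact s)+
qed

text \<open>Surjectivity of \<open>S2\<close> removes the upper component. If \<open>(0, z)\<close>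
  is the image of \<open>(v, w)\<close>, then correcting \<open>w\<close> by \<open>e1 (Q v)\<close>
  puts it into \<open>K2\<close> without changing its image under \<open>e2\<close>.\<close>

lemma cohomology3: "quotients_isomorphic (V3 \<times> W3) (B2 ` (V2 \<times> W2)) W3 (e2 ` K2)"
proof (rule quotients_isomorphic_sym)
  have s: "subspace W3" "subspace (e2 ` K2)" "subspace (V3 \<times> W3)" "subspace (B2 ` (V2 \<times> W2))"
    by (intro linear_subspace_image subspace_Times V W linear_B subspace_K2 e_lin)+
  show "subspace W3" "subspace (e2 ` K2)" by (fact s)+
  show "quotients_isomorphic W3 (e2 ` K2) (V3 \<times> W3) (B2 ` (V2 \<times> W2))"
  proof (rule quotients_isomorphicI[where h="\<lambda>x. (0, x)"])
    show "linear (\<lambda>x. (0::'v3, x :: 'w3))" by (auto intro!: linearI)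
    fix z assume z: "z \<in> W3"
    then show "(0, z) \<in> V3 \<times> W3" using subspace_0[OF V(4)] by auto
    show "(0, z) \<in> B2 ` (V2 \<times> W2) \<longleftrightarrow> z \<in> e2 ` K2"
    proof
      assume "(0, z) \<in> B2 ` (V2 \<times> W2)"
      then obtain v w where *: "v \<in> V2" "w \<in> W2" "d2 v = - S2 w" "z = e2 w"
        by (auto simp: B2_def eq_neg_iff_add_eq_0)
      have q: "Q v \<in> W1" "S1 (Q v) = v" using QW SQ * by auto
      have "S2 (w - e1 (Q v)) = 0" using dS1[OF q(1)] q(2) *(3) by (simp add: lin_simps)
      moreover have "w - e1 (Q v) \<in> W2" using * q e1W subspace_diff[OF W(3)] by auto
      moreover have "e2 (w - e1 (Q v)) = z" using ee(2)[OF q(1)] * by (simp add: lin_simps)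
      ultimately show "z \<in> e2 ` K2" unfolding K2_def by blast
    next
      assume "z \<in> e2 ` K2"
      then obtain w where "w \<in> W2" "S2 w = 0" "z = e2 w" unfolding K2_def by blast
      then have "(0, z) = B2 (0, w)" "(0, w) \<in> V2 \<times> W2"
        using subspace_0[OF V(3)] by (auto simp: B2_def)
      then show "(0, z) \<in> B2 ` (V2 \<times> W2)" by blast
    qed
  next
    fix z' assume "z' \<in> V3 \<times> W3"
    then obtain y z where yz: "z' = (y, z)" "y \<in> V3" "z \<in> W3" by blast
    then obtain w where w: "w \<in> W2" "y = S2 w" unfolding V3_eq by blast
    have "z' - (0, z - e2 w) = B2 (0, w)" by (simp add: yz B2_def w)
    moreover have "z - e2 w \<in> W3" using w yz e2W subspace_diff[OF W(4)] by blast
    moreover have "(0, w) \<in> V2 \<times> W2" using subspace_0[OF V(3)] w by blast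
    ultimately show "\<exists>z\<in>W3. z' - (0, z) \<in> B2 ` (V2 \<times> W2)" by blast
  qed (fact s)+
qed

end

section \<open>Smooth functions and test functions\<close>

lemma partial_eqI: "(\<phi> has_derivative D) (at x) \<Longrightarrow> partial j \<phi> x = D (axis j 1)"
  unfolding partial_def using frechet_derivative_at by metis

lemma has_derivative_partials:
  assumes "\<phi> differentiable (at x)"
  shows "(\<phi> has_derivative (\<lambda>h. \<Sum>j\<in>UNIV. h $ j *\<^sub>R partial j \<phi> x)) (at x)"
proof -
  let ?D = "frechet_derivative \<phi> (at x)"
  have D: "(\<phi> has_derivative ?D) (at x)" using assms frechet_derivative_works by blast
  have lin: "linear ?D" using D has_derivative_linear by blast
  have "?D h = (\<Sum>j\<in>UNIV. h $ j *\<^sub>R partial j \<phi> x)" for h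
  proof -
    have "?D h = ?D (\<Sum>j\<in>UNIV. h $ j *\<^sub>R axis j 1)"
      by (simp add: basis_expansion scalar_mult_eq_scaleR[symmetric])
    then show ?thesis by (simp add: linear_sum[OF lin] linear_scale[OF lin] partial_def)
  qed
  then show ?thesis using D by presburger
qed

lemma C_k_Suc_differentiable: "C_k (Suc k) \<phi> \<Longrightarrow> \<phi> differentiable (at x)"
  and C_k_Suc_partial: "C_k (Suc k) \<phi> \<Longrightarrow> C_k k (partial j \<phi>)"
  by auto

lemma C_k_SucD: "C_k (Suc k) \<phi> \<Longrightarrow> C_k k \<phi>"
proof (induction k arbitrary: \<phi>)
  case 0
  then show ?case
    by (auto intro!: differentiable_imp_continuous_on simp: differentiable_on_def)
qed auto

lemma C_k_mono: "C_k k \<phi> \<Longrightarrow> m \<le> k \<Longrightarrow> C_k m \<phi>"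
  by (induction k) (auto simp: le_Suc_eq dest: C_k_SucD simp del: C_k.simps)

lemma C_k_continuous: "C_k k \<phi> \<Longrightarrow> continuous_on S \<phi>"
  using C_k_mono[of k \<phi> 0] continuous_on_subset by (metis C_k.simps(1) le0 subset_UNIV)

lemma partial_bounded_linear:
  assumes "bounded_linear L" "\<phi> differentiable (at x)"
  shows "partial j (\<lambda>x. L (\<phi> x)) x = L (partial j \<phi> x)"
proof -
  have "((\<lambda>x. L (\<phi> x)) has_derivative (\<lambda>h. L (frechet_derivative \<phi> (at x) h))) (at x)"
    by (rule bounded_linear.has_derivative[OF assms(1) frechet_derivative_works[THEN iffD1, OF
        assms(2)]])
  from partial_eqI[OF this] show ?thesis by (simp add: partial_def)
qed

lemma differentiable_bounded_linear:
  "bounded_linear L \<Longrightarrow> \<phi> differentiable (at x) \<Longrightarrow> (\<lambda>x. L (\<phi> x)) differentiable (at x)"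
  unfolding differentiable_def using bounded_linear.has_derivative by blast

lemma C_k_bounded_linear: "bounded_linear L \<Longrightarrow> C_k k \<phi> \<Longrightarrow> C_k k (\<lambda>x. L (\<phi> x))"
proof (induction k arbitrary: \<phi>)
  case 0
  then show ?case
    by (auto intro: bounded_linear.continuous_on)
next
  case (Suc k)
  have "partial j (\<lambda>x. L (\<phi> x)) = (\<lambda>x. L (partial j \<phi> x))" for j
    by (rule ext, rule partial_bounded_linear[OF Suc.prems(1)]) (use Suc.prems in auto)
  then show ?case using Suc by (auto intro: differentiable_bounded_linear)
qed

lemma partial_add:
  "\<phi> differentiable (at x) \<Longrightarrow> \<psi> differentiable (at x) \<Longrightarrow>
    partial j (\<lambda>x. \<phi> x + \<psi> x) x = partial j \<phi> x + partial j \<psi> x"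
  by (rule trans[OF partial_eqI[OF has_derivative_add[OF has_derivative_partials
      has_derivative_partials]]])
    (auto simp: axis_def sum.delta if_distrib[of "\<lambda>c. c *\<^sub>R _"] cong: if_cong)

lemma C_k_add: "C_k k \<phi> \<Longrightarrow> C_k k \<psi> \<Longrightarrow> C_k k (\<lambda>x. \<phi> x + \<psi> x)"
proof (induction k arbitrary: \<phi> \<psi>)
  case 0
  then show ?case by (auto intro: continuous_on_add)
next
  case (Suc k)
  then have "partial j (\<lambda>x. \<phi> x + \<psi> x) = (\<lambda>x. partial j \<phi> x + partial j \<psi> x)" for j
    using partial_add by fastforce
  then show ?case using Suc by auto
qed

lemma partial_const: "partial j (\<lambda>x. c) = (\<lambda>x. 0)"
  using partial_eqI[OF has_derivative_const] by fastforce

lemma C_k_const: "C_k k (\<lambda>x. c)"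
  by (induction k arbitrary: c) (auto simp: partial_const)

lemma C_k_sum: "finite A \<Longrightarrow> (\<And>i. i \<in> A \<Longrightarrow> C_k k (f i)) \<Longrightarrow> C_k k (\<lambda>x. \<Sum>i\<in>A. f i x)"
  by (induction A rule: finite_induct) (auto intro: C_k_const C_k_add simp del: C_k.simps)

lemma partial_scaleR:
  assumes "f differentiable (at x)" "\<phi> differentiable (at x)"
  shows "partial j (\<lambda>x. f x *\<^sub>R \<phi> x) x = f x *\<^sub>R partial j \<phi> x + partial j f x *\<^sub>R \<phi> x"
  by (rule trans[OF partial_eqI[OF has_derivative_scaleR[OF has_derivative_partials[OF assms(1)]
            has_derivative_partials[OF assms(2)]]]])
    (auto simp: axis_def sum.delta if_distrib[of "\<lambda>c. c *\<^sub>R _"] if_distrib[of "\<lambda>c. c * _"] cong: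
        if_cong)

lemma C_k_scaleR: "C_k k f \<Longrightarrow> C_k k \<phi> \<Longrightarrow> C_k k (\<lambda>x. f x *\<^sub>R \<phi> x)"
proof (induction k arbitrary: f \<phi>)
  case 0
  then show ?case by (auto intro: continuous_on_scaleR)
next
  case (Suc k)
  then have "partial j (\<lambda>x. f x *\<^sub>R \<phi> x) = (\<lambda>x. f x *\<^sub>R partial j \<phi> x + partial j f x *\<^sub>R \<phi> x)"
      for j
    using partial_scaleR by fastforce
  moreover have "C_k k f" "C_k k \<phi>" using Suc.prems C_k_SucD by blast+
  ultimately show ?case using Suc by (auto intro!: C_k_add)
qed

lemma C_k_mult: "C_k k f \<Longrightarrow> C_k k g \<Longrightarrow> C_k k (\<lambda>x. f x * g x :: real)"
  using C_k_scaleR[of k f g] by simp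

lemma C_k_linear: "bounded_linear L \<Longrightarrow> C_k k L"
proof (induction k)
  case 0
  then show ?case by (simp add: linear_continuous_on)
next
  case (Suc k)
  have "partial j L = (\<lambda>x. L (axis j 1))" for j
    using partial_eqI[OF bounded_linear_imp_has_derivative[OF Suc.prems]] by auto
  then show ?case using Suc
    by (auto intro: C_k_const bounded_linear_imp_differentiable)
qed

text \<open>The second difference over a square of side h is symmetric in the two directions. Two
  applications of the mean value theorem, in either order, turn it into h^2 times a mixed derivative
  at a nearby point; continuity finishes as h tends to 0.\<close>

lemma mixed_partials_real:
  fixes f :: "vec3 \<Rightarrow> real"
  assumes f: "C_k 2 f"
  shows "partial i (partial j f) x = partial j (partial i f) x"
proof -
  have diff: "f differentiable (at y)" "partial k f differentiable (at y)" for y k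
    using f by (auto simp: numeral_2_eq_2)
  have line: "((\<lambda>t. g (y + t *\<^sub>R axis k 1)) has_real_derivative partial k g (y + t *\<^sub>R axis k 1))
      (at t)"
    if "\<And>y. g differentiable (at y)" for g :: "vec3 \<Rightarrow> real" and y k t
  proof -
    have "((\<lambda>t. g (y + t *\<^sub>R axis k 1)) has_derivative
        (\<lambda>h. \<Sum>j\<in>UNIV. (h *\<^sub>R axis k 1) $ j *\<^sub>R partial j g (y + t *\<^sub>R axis k 1))) (at t)"
      by (rule has_derivative_compose[OF _ has_derivative_partials[OF that]])
        (auto intro!: derivative_eq_intros)
    then show ?thesis
      unfolding has_field_derivative_def
      by (rule has_derivative_eq_rhs)
        (auto simp: axis_def sum.delta if_distrib[of "\<lambda>c. c * _"] if_distrib[of "\<lambda>c. _ * c"] cong: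
            if_cong)
  qed
  have key: "\<exists>a b. 0 < a \<and> a < h \<and> 0 < b \<and> b < h \<and>
      f (x + h *\<^sub>R axis k 1 + h *\<^sub>R axis l 1) - f (x + h *\<^sub>R axis k 1) - f (x + h *\<^sub>R axis l 1) + f
          x
       = h * h * partial l (partial k f) (x + a *\<^sub>R axis k 1 + b *\<^sub>R axis l 1)" if h: "0 <
           h" for h k l
  proof -
    let ?g = "\<lambda>s. f ((x + h *\<^sub>R axis l 1) + s *\<^sub>R axis k 1) - f (x + s *\<^sub>R axis k 1)"
    have "\<And>s. (?g has_real_derivative
         (partial k f ((x + h *\<^sub>R axis l 1) + s *\<^sub>R axis k 1) - partial k f (x + s *\<^sub>R axis k 1)))
             (at s)"
      by (intro DERIV_diff line diff)
    then obtain a where a: "0 < a" "a < h" "?g h - ?g 0 = h *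
        (partial k f ((x + h *\<^sub>R axis l 1) + a *\<^sub>R axis k 1) - partial k f (x + a *\<^sub>R axis k 1))"
      using MVT2[of 0 h ?g "\<lambda>s. partial k f ((x + h *\<^sub>R axis l 1) + s *\<^sub>R axis k 1) - partial k f (x
          + s *\<^sub>R axis k 1)"] h
      by auto
    let ?p = "\<lambda>t. partial k f ((x + a *\<^sub>R axis k 1) + t *\<^sub>R axis l 1)"
    obtain b where b: "0 < b" "b < h" "?p h - ?p 0 = h *
        partial l (partial k f) ((x + a *\<^sub>R axis k 1) + b *\<^sub>R axis l 1)"
      using MVT2[of 0 h ?p "\<lambda>t. partial l (partial k f) ((x + a *\<^sub>R axis k 1) + t *\<^sub>R axis l 1)"] h
        line[OF diff(2)] by auto
    show ?thesis
      using a b by (intro exI[of _ a] exI[of _ b]) (auto simp: algebra_simps)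
  qed
  \<comment> \<open>Any positive null sequence would do; the intermediate points are squeezed
    between 0 and \<open>h n\<close>.\<close>
  define h where "h n = 1 / real (Suc n)" for n
  have h: "0 < h n" for n by (simp add: h_def)
  have hlim: "h \<longlonglongrightarrow> 0" unfolding h_def by (rule lim_1_over_n[THEN LIMSEQ_Suc])
  obtain a b where ab: "\<And>n. 0 < a n \<and> a n < h n \<and> 0 < b n \<and> b n < h n \<and>
      f (x + h n *\<^sub>R axis i 1 + h n *\<^sub>R axis j 1) - f (x + h n *\<^sub>R axis i 1) - f
          (x + h n *\<^sub>R axis j 1) + f x
       = h n * h n * partial j (partial i f) (x + a n *\<^sub>R axis i 1 + b n *\<^sub>R axis j 1)"
    using key[OF h, of _ i j] by metis
  obtain a' b' where ab': "\<And>n. 0 < a' n \<and> a' n < h n \<and> 0 < b' n \<and> b' n < h n \<and>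
      f (x + h n *\<^sub>R axis j 1 + h n *\<^sub>R axis i 1) - f (x + h n *\<^sub>R axis j 1) - f
          (x + h n *\<^sub>R axis i 1) + f x
       = h n * h n * partial i (partial j f) (x + a' n *\<^sub>R axis j 1 + b' n *\<^sub>R axis i 1)"
    using key[OF h, of _ j i] by metis
  have lim0: "c \<longlonglongrightarrow> 0" if "\<And>n. 0 < c n \<and> c n < h n" for c
    by (rule tendsto_sandwich[OF _ _ tendsto_const hlim]) (use that in \<open>auto intro!:
        always_eventually less_imp_le\<close>)
  have cont: "isCont (partial k (partial l f)) x" for k l
    using f by (auto simp: numeral_2_eq_2 continuous_on_eq_continuous_at)
  have lim: "(\<lambda>n. partial k (partial l f) (x + c n *\<^sub>R axis m 1 + d n *\<^sub>R axis m' 1)) \<longlonglongrightarrow> partial k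
      (partial l f) x"
    if "c \<longlonglongrightarrow> 0" "d \<longlonglongrightarrow> 0" for k l m m' c d
  proof -
    have "(\<lambda>n. x + c n *\<^sub>R axis m 1 + d n *\<^sub>R axis m' 1) \<longlonglongrightarrow> x + 0 *\<^sub>R axis m 1 + 0 *\<^sub>R axis m' 1"
      using that by (intro tendsto_intros)
    then show ?thesis using isCont_tendsto_compose[OF cont] by simp
  qed
  have "a \<longlonglongrightarrow> 0" "b \<longlonglongrightarrow> 0" "a' \<longlonglongrightarrow> 0" "b' \<longlonglongrightarrow> 0"
    using ab ab' by (auto intro!: lim0)
  moreover have "partial j (partial i f) (x + a n *\<^sub>R axis i 1 + b n *\<^sub>R axis j 1) =
      partial i (partial j f) (x + a' n *\<^sub>R axis j 1 + b' n *\<^sub>R axis i 1)" for n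
    using ab[of n] ab'[of n] h[of n] by (simp add: algebra_simps)
  ultimately show ?thesis
    using LIMSEQ_unique[OF lim[of a b j i i j] ] lim[of a' b' i j j i] by simp
qed

subsection \<open>Bump functions\<close>

text \<open>The derivatives of \<open>exp (- 1 / t)\<close> are combinations of these functions.\<close>

definition flat :: "nat \<Rightarrow> real \<Rightarrow> real" where
  "flat n t = (if t > 0 then (1 / t) ^ n * exp (- (1 / t)) else 0)"

text \<open>From the right, the exponential beats every power of 1 / t; from the left the function
  is 0.\<close>

lemma flat_tendsto_0: "(flat n \<longlongrightarrow> 0) (at 0)"
proof -
  have "((\<lambda>t. (inverse t) ^ n / exp (inverse t)) \<longlongrightarrow> 0) (at_right (0::real))"
    by (rule filterlim_compose[OF tendsto_power_div_exp_0 filterlim_inverse_at_top_right])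
  moreover have "\<forall>\<^sub>F t in at_right 0. (inverse t) ^ n / exp (inverse t) = flat n t"
    by (auto simp: flat_def eventually_at_right_less exp_minus divide_simps eventually_at_filter)
  ultimately have "(flat n \<longlongrightarrow> 0) (at_right 0)"
    by (rule Lim_transform_eventually)
  moreover have "(flat n \<longlongrightarrow> 0) (at_left 0)"
    by (rule Lim_transform_eventually[OF tendsto_const]) (auto simp: flat_def eventually_at_filter)
  ultimately show ?thesis by (simp add: filterlim_at_split)
qed

text \<open>The family is closed under differentiation up to linear combinations, which gives
  smoothness by induction, also at 0.\<close>

lemma flat_has_derivative:
  "(flat n has_real_derivative flat (n + 2) t - real n * flat (n + 1) t) (at t)"
proof (cases t "0::real" rule: linorder_cases)
  case less
  have "((\<lambda>t. 0) has_real_derivative flat (n + 2) t - real n * flat (n + 1) t) (at t)"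
    using less by (simp add: flat_def)
  then show ?thesis
    by (rule has_field_derivative_transform_within_open[of _ _ _ "{..<0}"])
      (use less in \<open>auto simp: flat_def\<close>)
next
  case equal
  have "((\<lambda>h. (flat n (0 + h) - flat n 0) / h) \<longlongrightarrow> 0) (at 0)"
  proof (rule Lim_transform_eventually[OF flat_tendsto_0[of "n + 1"]])
    \<comment> \<open>The difference quotient of \<open>flat n\<close> at 0 is itself a member of
      the family, with index \<open>n + 1\<close>.\<close>
    show "\<forall>\<^sub>F h in at 0. flat (n + 1) h = (flat n (0 + h) - flat n 0) / h"
      by (auto simp: flat_def eventually_at_filter)
  qed
  then show ?thesis by (simp add: equal DERIV_def flat_def)
next
  case greater
  have 1: "((\<lambda>t. 1 / t) has_real_derivative - ((1 / t)\<^sup>2)) (at t)"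
    using greater by (auto intro!: derivative_eq_intros simp: power2_eq_square)
  have "real n * (- ((1 / t)\<^sup>2) * (1 / t) ^ (n - Suc 0)) = - real n * (1 / t) ^ (n + 1)"
    by (cases n) (auto simp: power2_eq_square divide_simps algebra_simps)
  then have 2: "((\<lambda>t. (1 / t) ^ n) has_real_derivative - real n * (1 / t) ^ (n + 1)) (at t)"
    using DERIV_power[OF 1, of n] by metis
  have 3: "((\<lambda>t. exp (- (1 / t))) has_real_derivative exp (- (1 / t)) * (1 / t)\<^sup>2) (at t)"
    using DERIV_chain2[OF DERIV_exp DERIV_minus[OF 1]] by simp
  have "- real n * (1 / t) ^ (n + 1) * exp (- (1 / t)) + exp (- (1 / t)) * (1 / t)\<^sup>2 * (1 / t) ^ n
      = flat (n + 2) t - real n * flat (n + 1) t"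
    using greater by (simp add: flat_def power_add power2_eq_square algebra_simps)
  then have "((\<lambda>t. (1 / t) ^ n * exp (- (1 / t))) has_real_derivative
      flat (n + 2) t - real n * flat (n + 1) t) (at t)"
    using DERIV_mult[OF 2 3] by metis
  then show ?thesis
    by (rule has_field_derivative_transform_within_open[of _ _ _ "{0<..}"])
      (use greater in \<open>auto simp: flat_def\<close>)
qed

text \<open>The induction must leave \<open>n\<close> free, because the derivative brings in the
  indices \<open>n + 1\<close> and \<open>n + 2\<close>.\<close>

lemma C_k_flat:
  assumes "\<And>k. C_k k q"
  shows "C_k k (\<lambda>x. flat n (q x))"
proof (induction k arbitrary: n)
  case 0
  have "continuous_on UNIV (flat n)"
    using flat_has_derivative DERIV_isCont continuous_at_imp_continuous_on by blast
  then have "continuous_on UNIV (flat n \<circ> q)"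
    using C_k_continuous[OF assms] continuous_on_compose continuous_on_subset by (metis subset_UNIV)
  then show ?case by (simp add: o_def)
next
  case (Suc k)
  have q: "q differentiable (at x)" for x using C_k_Suc_differentiable[OF assms[of "Suc 0"]] .
  have d: "((\<lambda>x. flat n (q x)) has_derivative
      (\<lambda>h. (flat (n + 2) (q x) - real n * flat (n + 1) (q x)) * frechet_derivative q (at x) h))
          (at x)" for x
    using has_derivative_compose[OF frechet_derivative_works[THEN iffD1, OF q]
        flat_has_derivative[unfolded has_field_derivative_def]] .
  have eq: "partial j (\<lambda>x. flat n (q x)) =
      (\<lambda>x. (flat (n + 2) (q x) + (- real n) * flat (n + 1) (q x)) * partial j q x)" for j
    using partial_eqI[OF d] by (auto simp: partial_def)
  have "C_k k (partial j q)" for j using C_k_Suc_partial[OF assms] .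
  then have "C_k k (partial j (\<lambda>x. flat n (q x)))" for j
    unfolding eq by (intro C_k_mult C_k_add C_k_const Suc.IH)
  then show ?case using d by (auto simp: differentiable_def)
qed

lemma bump_exists:
  fixes x0 :: vec3
  assumes "0 < r"
  obtains \<phi> :: "vec3 \<Rightarrow> real" where "\<And>k. C_k k \<phi>" "\<And>x. 0 \<le> \<phi> x" "\<phi> x0 > 0"
    "\<And>x. \<phi> x \<noteq> 0 \<Longrightarrow> x \<in> ball x0 r"
proof
  \<comment> \<open>This is r^2 - |x - x0|^2, spelled with sums and products of coordinates only, so
    that the closure rules for \<open>C_k\<close> apply literally.\<close>
  define q :: "vec3 \<Rightarrow> real" where "q x = r\<^sup>2 + (- 1) * (\<Sum>i\<in>UNIV. (x $ i + - x0 $ i) * (x $ i + - x0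
      $ i))" for x
  have q: "C_k k q" for k
    unfolding q_def by (intro C_k_add C_k_mult C_k_const C_k_sum C_k_linear bounded_linear_vec_nth
        finite)
  have q_eq: "q x = r\<^sup>2 - (dist x0 x)\<^sup>2" for x
    unfolding q_def dist_commute[of x0 x]
        by (simp add: dist_norm power2_norm_eq_inner inner_vec_def)
  show "C_k k (\<lambda>x. flat 0 (q x))" for k by (rule C_k_flat[OF q])
  show "0 \<le> flat 0 (q x)" for x by (simp add: flat_def)
  show "flat 0 (q x0) > 0" using assms by (simp add: flat_def q_eq)
  show "x \<in> ball x0 r" if "flat 0 (q x) \<noteq> 0" for x
  proof -
    have "(dist x0 x)\<^sup>2 < r\<^sup>2" using that by (simp add: flat_def q_eq split: if_splits)
    then show ?thesis using assms by (simp add: power2_less_imp_less)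
  qed
qed

section \<open>Test functions and their closure properties\<close>

lemma test_functionsD:
  assumes "\<phi> \<in> test_functions \<Omega>"
  shows "C_k k \<phi>" "compact (closure {x. \<phi> x \<noteq> 0})" "closure {x. \<phi> x \<noteq> 0} \<subseteq> \<Omega>"
    "\<phi> differentiable (at x)" "continuous_on S \<phi>" "x \<notin> \<Omega> \<Longrightarrow> \<phi> x = 0"
proof -
  show k: "C_k k \<phi>" for k
    using assms unfolding test_functions_def by auto
  show sup: "closure {x. \<phi> x \<noteq> 0} \<subseteq> \<Omega>" and "compact (closure {x. \<phi> x \<noteq> 0})"
    using assms unfolding test_functions_def by auto
  show "\<phi> differentiable (at x)" using C_k_Suc_differentiable[OF k[of "Suc 0"]] .
  show "continuous_on S \<phi>" using C_k_continuous[OF k] .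
  show "x \<notin> \<Omega> \<Longrightarrow> \<phi> x = 0" using sup closure_subset[of "{x. \<phi> x \<noteq> 0}"] by blast
qed

lemma test_functionsI:
  assumes \<phi>: "\<phi> \<in> test_functions \<Omega>" and \<psi>: "\<And>k. C_k k \<psi>"
    and sub: "{x. \<psi> x \<noteq> 0} \<subseteq> closure {x. \<phi> x \<noteq> 0}"
  shows "\<psi> \<in> test_functions \<Omega>"
proof -
  have c: "closure {x. \<psi> x \<noteq> 0} \<subseteq> closure {x. \<phi> x \<noteq> 0}"
    using sub closure_mono closure_closure by metis
  have "compact (closure {x. \<psi> x \<noteq> 0})"
    using bounded_subset[OF compact_imp_bounded[OF test_functionsD(2)[OF \<phi>]] c]
    by (simp add: compact_eq_bounded_closed)
  then show ?thesis
    using c \<psi> test_functionsD(3)[OF \<phi>] unfolding test_functions_def by blast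
qed

lemma test_functions_linear:
  fixes L :: "'b::euclidean_space \<Rightarrow> 'c::euclidean_space"
  assumes \<phi>: "\<phi> \<in> test_functions \<Omega>" and L: "linear L"
  shows "(\<lambda>x. L (\<phi> x)) \<in> test_functions \<Omega>"
proof (rule test_functionsI[OF \<phi>])
  show "C_k k (\<lambda>x. L (\<phi> x))" for k
    using C_k_bounded_linear[OF _ test_functionsD(1)[OF \<phi>]] L linear_conv_bounded_linear by blast
  have "{x. L (\<phi> x) \<noteq> 0} \<subseteq> {x. \<phi> x \<noteq> 0}" using linear_0[OF L] by auto
  then show "{x. L (\<phi> x) \<noteq> 0} \<subseteq> closure {x. \<phi> x \<noteq> 0}" using closure_subset by blast
qed

lemma test_functions_scaleR: "\<phi> \<in> test_functions \<Omega> \<Longrightarrow> (\<lambda>x. c *\<^sub>R \<phi> x) \<in> test_functions \<Omega>"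
  for \<phi> :: "vec3 \<Rightarrow> 'b::euclidean_space"
  by (rule test_functions_linear) (auto intro!: linearI simp: scaleR_add_right)

lemma test_functions_add:
  assumes \<phi>: "\<phi> \<in> test_functions \<Omega>" and \<psi>: "\<psi> \<in> test_functions \<Omega>"
  shows "(\<lambda>x. \<phi> x + \<psi> x) \<in> test_functions \<Omega>"
proof -
  let ?S = "closure {x. \<phi> x \<noteq> 0} \<union> closure {x. \<psi> x \<noteq> 0}"
  have "{x. \<phi> x + \<psi> x \<noteq> 0} \<subseteq> {x. \<phi> x \<noteq> 0} \<union> {x. \<psi> x \<noteq> 0}" by auto
  then have c: "closure {x. \<phi> x + \<psi> x \<noteq> 0} \<subseteq> ?S"
    using closure_mono[of _ "{x. \<phi> x \<noteq> 0} \<union> {x. \<psi> x \<noteq> 0}"] by (simp add: closure_Un)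
  have "compact ?S" using test_functionsD(2)[OF \<phi>] test_functionsD(2)[OF \<psi>] by (rule compact_Un)
  then have "compact (closure {x. \<phi> x + \<psi> x \<noteq> 0})"
    using bounded_subset[OF compact_imp_bounded c] by (simp add: compact_eq_bounded_closed)
  moreover have "C_k k (\<lambda>x. \<phi> x + \<psi> x)" for k
    using C_k_add test_functionsD(1) \<phi> \<psi> by blast
  ultimately show ?thesis
    using c test_functionsD(3)[OF \<phi>] test_functionsD(3)[OF \<psi>] unfolding test_functions_def by blast
qed

lemma test_functions_zero: "(\<lambda>x. 0) \<in> test_functions \<Omega>"
  unfolding test_functions_def by (simp add: C_k_const)

lemma test_functions_sum:
  fixes \<phi> :: "'i \<Rightarrow> vec3 \<Rightarrow> 'b::euclidean_space"
  shows "finite A \<Longrightarrow> (\<And>i. i \<in> A \<Longrightarrow> \<phi> i \<in> test_functions \<Omega>) \<Longrightarrow> (\<lambda>x. \<Sum>i\<in>A. \<phi> i x) \<in> test_functions \<Omega>"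
  by (induction A rule: finite_induct) (auto intro: test_functions_zero test_functions_add)

lemma partial_eq_0:
  assumes "x \<notin> closure {x. \<phi> x \<noteq> 0}"
  shows "partial j \<phi> x = 0"
proof -
  have "(\<phi> has_derivative (\<lambda>h. 0)) (at x)"
    by (rule has_derivative_transform_within_open[of "\<lambda>x. 0" _ _ _ "- closure {x. \<phi> x \<noteq> 0}"])
      (use assms closure_subset[of "{x. \<phi> x \<noteq> 0}"] in auto)
  then show ?thesis using partial_eqI by blast
qed

lemma test_functions_partial:
  assumes \<phi>: "\<phi> \<in> test_functions \<Omega>"
  shows "partial j \<phi> \<in> test_functions \<Omega>"
  by (rule test_functionsI[OF \<phi>])
    (use partial_eq_0[of _ \<phi>] C_k_Suc_partial[OF test_functionsD(1)[OF \<phi>]] in blast)+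

lemma partial_linear:
  fixes L :: "'b::euclidean_space \<Rightarrow> 'c::euclidean_space"
  assumes "linear L" "\<phi> \<in> test_functions \<Omega>"
  shows "partial j (\<lambda>x. L (\<phi> x)) x = L (partial j \<phi> x)"
  using partial_bounded_linear test_functionsD(4)[OF assms(2)] assms(1) linear_conv_bounded_linear
      by blast

text \<open>General first-order operator with constant coefficients. Row-wise grad, curl and div are
  instances, so closure of the test functions, composition and integration by parts are treated
  once.\<close>

definition pdo :: "(3 \<Rightarrow> 'b \<Rightarrow> 'c) \<Rightarrow> (vec3 \<Rightarrow> 'b::euclidean_space) \<Rightarrow> vec3 \<Rightarrow> 'c::euclidean_space" where
  "pdo L \<phi> x = (\<Sum>j\<in>UNIV. L j (partial j \<phi> x))"

lemma test_functions_pdo: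
  assumes "\<phi> \<in> test_functions \<Omega>" "\<And>j. linear (L j)"
  shows "pdo L \<phi> \<in> test_functions \<Omega>"
proof -
  have "(\<lambda>x. L j (partial j \<phi> x)) \<in> test_functions \<Omega>" for j
    by (rule test_functions_linear[OF test_functions_partial[OF assms(1)] assms(2)])
  then have "(\<lambda>x. \<Sum>j\<in>UNIV. L j (partial j \<phi> x)) \<in> test_functions \<Omega>"
    by (rule test_functions_sum[OF finite])
  then show ?thesis unfolding pdo_def[abs_def] .
qed

lemma partial_sum:
  fixes f :: "'i \<Rightarrow> vec3 \<Rightarrow> 'b::euclidean_space"
  assumes "finite A" "\<And>i. i \<in> A \<Longrightarrow> f i \<in> test_functions \<Omega>"
  shows "partial j (\<lambda>x. \<Sum>i\<in>A. f i x) x = (\<Sum>i\<in>A. partial j (f i) x)"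
  using assms
proof (induction A rule: finite_induct)
  case empty
  then show ?case by (simp add: partial_const)
next
  case (insert i A)
  then have "f i \<in> test_functions \<Omega>" "(\<lambda>x. \<Sum>i\<in>A. f i x) \<in> test_functions \<Omega>"
    by (auto intro: test_functions_sum)
  from partial_add[OF this[THEN test_functionsD(4)]] insert show ?case by simp
qed

lemma pdo_pdo:
  assumes "\<phi> \<in> test_functions \<Omega>" "\<And>j. linear (L j)" "\<And>j. linear (M j)"
  shows "pdo M (pdo L \<phi>) x = (\<Sum>k\<in>UNIV. \<Sum>j\<in>UNIV. M k (L j (partial k (partial j \<phi>) x)))"
proof -
  have L: "(\<lambda>x. L j (partial j \<phi> x)) \<in> test_functions \<Omega>" for j
    by (rule test_functions_linear[OF test_functions_partial[OF assms(1)] assms(2)])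
  have "partial k (\<lambda>x. L j (partial j \<phi> x)) x = L j (partial k (partial j \<phi>) x)" for j k
    by (rule partial_linear[OF assms(2) test_functions_partial[OF assms(1)]])
  then have "partial k (pdo L \<phi>) x = (\<Sum>j\<in>UNIV. L j (partial k (partial j \<phi>) x))" for k
    unfolding pdo_def[abs_def] partial_sum[OF finite L] by simp
  then show ?thesis unfolding pdo_def[of M] using assms(3) by (simp add: linear_sum)
qed

text \<open>Pairing with a basis vector commutes with partial derivatives and reduces the claim to
  real functions.\<close>

lemma mixed_partials:
  fixes \<phi> :: "vec3 \<Rightarrow> 'b::euclidean_space"
  assumes \<phi>: "\<phi> \<in> test_functions \<Omega>"
  shows "partial i (partial j \<phi>) x = partial j (partial i \<phi>) x"
proof (rule euclidean_eqI)
  fix b :: 'b assume "b \<in> Basis"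
  let ?f = "\<lambda>x. \<phi> x \<bullet> b"
  have lin: "linear (\<lambda>v::'b. v \<bullet> b)" by (auto intro!: linearI simp: inner_add_left)
  have 1: "partial k ?f = (\<lambda>x. partial k \<phi> x \<bullet> b)" for k
    using partial_linear[OF lin \<phi>] by blast
  have "partial k (partial l ?f) x = partial k (partial l \<phi>) x \<bullet> b" for k l
    unfolding 1 using partial_linear[OF lin test_functions_partial[OF \<phi>]] by blast
  moreover have "partial i (partial j ?f) x = partial j (partial i ?f) x"
    by (rule mixed_partials_real) (rule test_functionsD(1)[OF test_functions_linear[OF \<phi> lin]])
  ultimately show "partial i (partial j \<phi>) x \<bullet> b = partial j (partial i \<phi>) x \<bullet> b" by simp
qed

text \<open>The three \<open>_part\<close> maps are the coefficients of the j-th partial derivative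
  in the row-wise operators: v (x) e_j for grad, the cross product of e_j with every row for curl,
  the j-th column for div.\<close>

definition grad_part :: "3 \<Rightarrow> vec3 \<Rightarrow> mat3" where
  "grad_part j v = (\<chi> i k. if k = j then v $ i else 0)"

definition curl_part :: "3 \<Rightarrow> mat3 \<Rightarrow> mat3" where
  "curl_part j A = (\<chi> i. cross3 (axis j 1) (A $ i))"

definition div_part :: "3 \<Rightarrow> mat3 \<Rightarrow> vec3" where
  "div_part j A = (\<chi> i. A $ i $ j)"

lemma linear_parts: "linear (grad_part j)" "linear (curl_part j)" "linear (div_part j)"
  unfolding grad_part_def curl_part_def div_part_def
  by (auto intro!: linearI simp: vec_eq_iff cross_add_right cross_mult_right)

lemma axis3: "axis 1 (1::real) = (vector [1, 0, 0] :: vec3)" "axis 2 (1::real) =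
    (vector [0, 1, 0] :: vec3)"
  "axis 3 (1::real) = (vector [0, 0, 1] :: vec3)"
  by (auto simp: vec_eq_iff forall_3 axis_def vector_3)

lemma grad_field_pdo: "grad_field = pdo grad_part"
  by (auto simp: fun_eq_iff grad_field_def pdo_def grad_part_def vec_eq_iff)

lemma div_field_pdo: "div_field = pdo div_part"
  by (auto simp: fun_eq_iff div_field_def pdo_def div_part_def vec_eq_iff)

lemma curl_field_pdo: "curl_field = pdo curl_part"
  by (simp add: fun_eq_iff curl_field_def pdo_def curl_part_def vec_eq_iff forall_3 sum_3
      axis3 cross3_def vector_3)

lemma test_functions_fields:
  "v \<in> test_functions \<Omega> \<Longrightarrow> grad_field v \<in> test_functions \<Omega>"
  "W \<in> test_functions \<Omega> \<Longrightarrow> curl_field W \<in> test_functions \<Omega>"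
  "W \<in> test_functions \<Omega> \<Longrightarrow> div_field W \<in> test_functions \<Omega>"
  unfolding grad_field_pdo curl_field_pdo div_field_pdo
  by (auto intro: test_functions_pdo linear_parts)

text \<open>Second derivatives enter antisymmetrised. The three instances of the symmetry all
  rewrite towards the same order of indices, after which the terms cancel.\<close>

lemma div_curl_field: "W \<in> test_functions \<Omega> \<Longrightarrow> div_field (curl_field W) = (\<lambda>x. 0)"
  using mixed_partials[of W \<Omega> 2 1] mixed_partials[of W \<Omega> 3 1] mixed_partials[of W \<Omega> 3 2]
  by (simp add: curl_field_pdo div_field_pdo pdo_pdo linear_parts fun_eq_iff sum_3 vec_eq_iff
      forall_3 div_part_def curl_part_def axis3 cross3_def vector_3)

lemma curl_grad_field: "v \<in> test_functions \<Omega> \<Longrightarrow> curl_field (grad_field v) = (\<lambda>x. 0)"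
  using mixed_partials[of v \<Omega> 2 1] mixed_partials[of v \<Omega> 3 1] mixed_partials[of v \<Omega> 3 2]
  by (simp add: curl_field_pdo grad_field_pdo pdo_pdo linear_parts fun_eq_iff sum_3 vec_eq_iff
      forall_3 grad_part_def curl_part_def axis3 cross3_def vector_3)

section \<open>Matrix algebra\<close>

text \<open>The Frobenius adjoint of \<open>mskw\<close>, which is twice \<open>vskw\<close>; this
  is the source of the factor 2 in \<open>A2\<close>.\<close>

definition mskw_adj :: "mat3 \<Rightarrow> vec3" where
  "mskw_adj A = vector [A$3$2 - A$2$3, A$1$3 - A$3$1, A$2$1 - A$1$2]"

text \<open>From tr (S u) = tr u - 3 tr u = -2 tr u one recovers u as the transpose of S u minus
  half the trace of S u times the identity.\<close>

definition S_inv :: "mat3 \<Rightarrow> mat3" where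
  "S_inv A = transpose A - (trace A / 2) *\<^sub>R mat 1"

lemma mskw_nth: "mskw v = vector [vector [0, - v$3, v$2], vector [v$3, 0, - v$1], vector [- v$2,
    v$1, 0]]"
  by (simp add: mskw_def matrix_def vec_eq_iff forall_3 cross3_def vector_3 axis_def)

lemma inner_mat3: "A \<bullet> B = (\<Sum>i\<in>UNIV. \<Sum>j\<in>UNIV. A $ i $ j * B $ i $ j)" for A B :: mat3
  by (simp add: inner_vec_def)

lemma trace3: "trace A = A$1$1 + A$2$2 + A$3$3" for A :: mat3
  by (simp add: trace_def sum_3)

lemmas mat3_simps = vec_eq_iff forall_3 sum_3 vector_3 trace3 transpose_def mat_def

lemma linear_maps [simp]: "linear mskw" "linear mskw_adj" "linear S_map" "linear S_inv"
    "linear symm"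
    "linear (transpose :: mat3 \<Rightarrow> mat3)"
  unfolding mskw_nth[abs_def] mskw_adj_def S_map_def S_inv_def symm_def
  by (auto intro!: linearI simp: mat3_simps algebra_simps add_divide_distrib)

lemma vskw_eq: "vskw A = (1/2) *\<^sub>R mskw_adj A"
proof -
  have "inj mskw" by (auto intro!: injI simp: mskw_nth mat3_simps)
  moreover have "skw A = mskw ((1/2) *\<^sub>R mskw_adj A)"
    by (auto simp: skw_def mskw_nth mskw_adj_def mat3_simps field_simps)
  ultimately show ?thesis unfolding vskw_def by (metis inv_f_f)
qed

lemma linear_vskw [simp]: "linear vskw"
  unfolding vskw_eq[abs_def] by (rule linear_compose_scale_right) simp

text \<open>\<open>pointwise\<close> evaluates a map through its adjoint, so these formulas are what
  the later calculations see.\<close>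

lemma adjoints [simp]:
  "adjoint mskw = mskw_adj" "adjoint vskw = (\<lambda>v. (1/2) *\<^sub>R mskw v)" "adjoint S_map = S_map"
  "adjoint S_inv = S_inv" "adjoint symm = symm" "adjoint (transpose :: mat3 \<Rightarrow> mat3) = transpose"
  by (rule adjoint_unique; auto simp: vskw_eq inner_mat3 inner_vec_def mskw_nth mskw_adj_def
      S_map_def S_inv_def symm_def mat3_simps algebra_simps add_divide_distrib diff_divide_distrib)+

lemma S_map_inv [simp]: "S_map (S_inv A) = A" "S_inv (S_map A) = A"
  by (simp_all add: S_map_def S_inv_def mat3_simps field_simps)

text \<open>With \<open>curl_field_mskw\<close>, the two anticommutation relations in the form in
  which test functions see them, one coefficient at a time.\<close>

lemma curl_field_S: "mskw_adj (curl_part j A) = div_part j (S_map A)"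
  using exhaust_3[of j]
  by (auto simp: curl_part_def div_part_def S_map_def mskw_adj_def axis3 cross3_def mat3_simps)

lemma curl_field_mskw: "curl_part j (mskw v) = - S_map (grad_part j v)"
  using exhaust_3[of j]
  by (auto simp: curl_part_def grad_part_def S_map_def mskw_nth axis3 cross3_def mat3_simps)

section \<open>Integration over simplices\<close>

text \<open>Bridge from the gauge integral of the definitions to the Lebesgue integral, for which
  Fubini and image measures are available.\<close>

lemma compact_integral:
  fixes f :: "'a::euclidean_space \<Rightarrow> real"
  assumes "compact S" "continuous_on S f"
  shows compact_integrable: "f integrable_on S"
    and compact_integral_lborel: "integral S f = (\<integral>x. indicator S x * f x \<partial>lborel)"
  using set_borel_integral_eq_integral[of S f] borel_integrable_compact[OF assms]
  by (auto simp: set_integrable_def set_lebesgue_integral_def)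

text \<open>The region is a continuous image of S x [0,1], obtained by rescaling each fibre.\<close>

lemma compact_under_graph:
  fixes b :: "'a::euclidean_space \<Rightarrow> real"
  assumes "compact S" "continuous_on S b" "\<And>p. p \<in> S \<Longrightarrow> 0 \<le> b p"
  shows "compact {(p, t). p \<in> S \<and> 0 \<le> t \<and> t \<le> b p}"
proof -
  have eq: "{(p, t). p \<in> S \<and> 0 \<le> t \<and> t \<le> b p} = (\<lambda>q. (fst q, snd q * b (fst q))) ` (S \<times> {0..1})"
    (is "?A = ?f ` _")
  proof (intro equalityI subsetI)
    fix q assume "q \<in> ?A"
    then obtain p t where q: "q = (p, t)" "p \<in> S" "0 \<le> t" "t \<le> b p" by auto
    show "q \<in> ?f ` (S \<times> {0..1})"
    \<comment> \<open>A degenerate fibre consists of \<open>t = 0\<close> alone, where the rescaling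
      parameter \<open>t / b p\<close> would make no sense.\<close>
    proof (cases "b p = 0")
      case True
      then show ?thesis using q by (intro image_eqI[of _ _ "(p, 0)"]) auto
    next
      case False
      then show ?thesis using q assms(3)[of p] by (intro image_eqI[of _ _ "(p, t / b p)"])
          (auto simp: divide_simps)
    qed
  next
    fix q assume "q \<in> ?f ` (S \<times> {0..1})"
    then obtain p u where q: "q = (p, u * b p)" and p: "p \<in> S" "0 \<le> u" "u \<le> 1" by force
    then show "q \<in> ?A" using assms(3)[OF p(1)] mult_right_mono[of u 1 "b p"] by auto
  qed
  have "continuous_on (S \<times> {0..1}) ?f"
    by (intro continuous_intros continuous_on_compose2[OF assms(2)]) auto
  then show ?thesis
    unfolding eq by (rule compact_continuous_image[OF _ compact_Times[OF assms(1) compact_Icc]])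
qed

lemma fubini_under_graph:
  fixes b :: "'a::euclidean_space \<Rightarrow> real" and g :: "'a \<times> real \<Rightarrow> real"
  assumes S: "compact S" "continuous_on S b" "\<And>p. p \<in> S \<Longrightarrow> 0 \<le> b p"
    and g: "continuous_on {(p, t). p \<in> S \<and> 0 \<le> t \<and> t \<le> b p} g"
  shows "integral {(p, t). p \<in> S \<and> 0 \<le> t \<and> t \<le> b p} g =
      integral S (\<lambda>p. integral {0..b p} (\<lambda>t. g (p, t)))"
proof -
  let ?R = "{(p, t). p \<in> S \<and> 0 \<le> t \<and> t \<le> b p}"
  have R: "compact ?R" by (rule compact_under_graph[OF S])
  have int: "integrable (lborel \<Otimes>\<^sub>M lborel) (\<lambda>q. indicator ?R q * g q)"
    using borel_integrable_compact[OF R g] by (simp add: lborel_prod)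
  have inner: "(\<integral>t. indicator ?R (p, t) * g (p, t) \<partial>lborel) = indicator S p * integral {0..b p}
      (\<lambda>t. g (p, t))" for p
  proof (cases "p \<in> S")
    case True
    have "continuous_on {0..b p} (\<lambda>t. g (p, t))"
      by (rule continuous_on_compose2[OF g]) (use True in \<open>auto intro!: continuous_intros\<close>)
    moreover have "(\<lambda>t. indicator ?R (p, t) * g (p, t)) = (\<lambda>t. indicator {0..b p} t * g (p, t))"
      using True by (auto simp: indicator_def)
    ultimately show ?thesis using True compact_integral_lborel[OF compact_Icc, of 0 "b p"
        "\<lambda>t. g (p, t)"]
      by simp
  qed (simp add: indicator_def)
  have "integral ?R g = (\<integral>q. indicator ?R q * g q \<partial>(lborel \<Otimes>\<^sub>M lborel))"
    using compact_integral_lborel[OF R g] by (simp add: lborel_prod)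
  also have "\<dots> = (\<integral>p. \<integral>t. indicator ?R (p, t) * g (p, t) \<partial>lborel \<partial>lborel)"
    using lborel_pair.integral_fst'[OF int] by simp
  also have "\<dots> = (\<integral>p. indicator S p * integral {0..b p} (\<lambda>t. g (p, t)) \<partial>lborel)"
    by (simp only: inner)
  also have "\<dots> = integral S (\<lambda>p. integral {0..b p} (\<lambda>t. g (p, t)))"
  proof -
    \<comment> \<open>Integrability of the outer integrand is taken from Fubini; its continuity in
      \<open>p\<close> is never established.\<close>
    have "integrable lborel (\<lambda>p. indicator S p * integral {0..b p} (\<lambda>t. g (p, t)))"
      using lborel_pair.integrable_fst'[OF int] by (simp only: inner)
    then show ?thesis
      using set_borel_integral_eq_integral(2)[of S "\<lambda>p. integral {0..b p} (\<lambda>t. g (p, t))"]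
      by (simp add: set_integrable_def set_lebesgue_integral_def)
  qed
  finally show ?thesis .
qed

text \<open>Integrating out the last variable lowers the dimension by one. Over [0,1] this serves
  triangles, over the reference triangle it serves tetrahedra.\<close>

lemma ftc_under_graph:
  fixes b :: "'a::euclidean_space \<Rightarrow> real" and g G :: "'a \<times> real \<Rightarrow> real"
  assumes S: "compact S" "continuous_on S b" "\<And>p. p \<in> S \<Longrightarrow> 0 \<le> b p"
    and g: "continuous_on {(p, t). p \<in> S \<and> 0 \<le> t \<and> t \<le> b p} g"
    and G: "\<And>p t. ((\<lambda>t. G (p, t)) has_real_derivative g (p, t)) (at t)"
  shows "integral {(p, t). p \<in> S \<and> 0 \<le> t \<and> t \<le> b p} g = integral S (\<lambda>p. G (p, b p) - G (p, 0))"
proof -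
  have "integral {0..b p} (\<lambda>t. g (p, t)) = G (p, b p) - G (p, 0)" if "p \<in> S" for p
    by (rule integral_unique, rule fundamental_theorem_of_calculus[OF S(3)[OF that]])
      (use G in \<open>auto simp: has_real_derivative_iff_has_vector_derivative[symmetric] intro:
          has_field_derivative_at_within\<close>)
  then have "integral S (\<lambda>p. integral {0..b p} (\<lambda>t. g (p, t))) =
      integral S (\<lambda>p. G (p, b p) - G (p, 0))"
    by (intro Henstock_Kurzweil_Integration.integral_cong) simp
  moreover have "integral {(p, t). p \<in> S \<and> 0 \<le> t \<and> t \<le> b p} g =
      integral S (\<lambda>p. integral {0..b p} (\<lambda>t. g (p, t)))"
    using S g by (rule fubini_under_graph)
  ultimately show ?thesis by (rule trans[rotated])
qed

section \<open>Reference triangle and reference tetrahedron\<close>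

definition std_triangle :: "(real \<times> real) set" where
  "std_triangle = {(r, s). 0 \<le> r \<and> 0 \<le> s \<and> r + s \<le> 1}"

lemma std_triangle_graph: "std_triangle = {(p, t). p \<in> {0..1} \<and> 0 \<le> t \<and> t \<le> 1 - p}"
  unfolding std_triangle_def by auto

lemma compact_std_triangle: "compact std_triangle"
  unfolding std_triangle_graph by (rule compact_under_graph) (auto intro!: continuous_intros)

lemma integral_reflect_Icc:
  fixes h :: "real \<Rightarrow> real"
  shows "integral {0..c} (\<lambda>s. h (c - s)) = integral {0..c} h"
proof -
  have "integral {0..c} ((\<lambda>x. h (- x)) \<circ> (+) (- c)) = integral {- c..0} (\<lambda>x. h (- x))"
    using integral_shift_Icc_real[of 0 c "\<lambda>x. h (- x)" "- c"] by simp
  also have "\<dots> = integral {0..c} h"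
    using Henstock_Kurzweil_Integration.integral_reflect_real[of c 0 h] by simp
  finally show ?thesis by (simp add: o_def)
qed

text \<open>This affine map exchanges the vertices (0,0) and (0,1). Together with the swap of
  coordinates it generates all permutations of the vertices.\<close>

lemma std_triangle_shear:
  fixes g :: "real \<times> real \<Rightarrow> real"
  assumes g: "continuous_on std_triangle g"
  shows "integral std_triangle (\<lambda>(r, s). g (r, 1 - r - s)) = integral std_triangle g"
proof -
  have S: "compact {0..1::real}" "continuous_on {0..1} (\<lambda>p. 1 - p :: real)" "\<And>p. p \<in> {0..1} \<Longrightarrow>
      0 \<le> (1 - p :: real)"
    by (auto intro!: continuous_intros)
  have "continuous_on std_triangle (\<lambda>(r, s). g (r, 1 - r - s))"
    unfolding case_prod_unfold
    by (rule continuous_on_compose2[OF g]) (auto intro!: continuous_intros simp: std_triangle_def)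
  then show ?thesis
    using fubini_under_graph[OF S, of "\<lambda>(r, s). g (r, 1 - r - s)"] fubini_under_graph[OF S, of g] g
    unfolding std_triangle_graph by (simp add: integral_reflect_Icc[of _ "\<lambda>s. g (_, s)"])
qed

lemma std_triangle_swap:
  fixes g :: "real \<times> real \<Rightarrow> real"
  assumes g: "continuous_on std_triangle g"
  shows "integral std_triangle (\<lambda>(r, s). g (s, r)) = integral std_triangle g"
proof -
  have "continuous_on std_triangle (\<lambda>(r, s). g (s, r))"
    unfolding case_prod_unfold
    by (rule continuous_on_compose2[OF g]) (auto intro!: continuous_intros simp: std_triangle_def)
  then have "integral std_triangle (\<lambda>(r, s). g (s, r)) = (\<integral>q. indicator std_triangle q * (\<lambda>(r, s). g
      (s, r)) q \<partial>lborel)"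
    by (rule compact_integral_lborel[OF compact_std_triangle])
  also have "(\<lambda>q. indicator std_triangle q * (\<lambda>(r, s). g (s, r)) q) =
      (\<lambda>(r, s). (\<lambda>q. indicator std_triangle q * g q) (s, r))"
    by (auto simp: fun_eq_iff indicator_def std_triangle_def add.commute)
  also have "(\<integral>q. (\<lambda>(r, s). (\<lambda>q. indicator std_triangle q * g q) (s, r)) q \<partial>lborel) =
      (\<integral>q. indicator std_triangle q * g q \<partial>lborel)"
    using lborel_pair.integral_product_swap[of "\<lambda>q. indicator std_triangle q * g q"]
      borel_integrable_compact[OF compact_std_triangle g]
          by (simp add: lborel_prod borel_measurable_integrable)
  also have "\<dots> = integral std_triangle g"
    by (rule compact_integral_lborel[OF compact_std_triangle g, symmetric])
  finally show ?thesis .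
qed

definition std_tetrahedron :: "((real \<times> real) \<times> real) set" where
  "std_tetrahedron = {(p, t). p \<in> std_triangle \<and> 0 \<le> t \<and> t \<le> 1 - fst p - snd p}"

text \<open>The last parameter is put first: it is the fibre variable of
  \<open>std_tetrahedron\<close> and shall run along the first edge vector, while the base triangle
  runs along the other two.\<close>

definition coords3 :: "(real \<times> real) \<times> real \<Rightarrow> vec3" where
  "coords3 q = vector [snd q, fst (fst q), snd (fst q)]"

lemma coords3_nth [simp]: "coords3 q $ 1 = snd q" "coords3 q $ 2 = fst (fst q)" "coords3 q $ 3 =
    snd (fst q)"
  by (simp_all add: coords3_def vector_3)

lemma continuous_coords3: "continuous_on S coords3"
proof -
  have "linear coords3"
    by (auto intro!: linearI simp: coords3_def vec_eq_iff forall_3 vector_3)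
  then show ?thesis by (simp add: linear_conv_bounded_linear linear_continuous_on)
qed

lemma prod_UNIV3:
  fixes f :: "3 \<Rightarrow> 'a::comm_monoid_mult"
  shows "(\<Prod>i\<in>UNIV. f i) = f 1 * f 2 * f 3"
  proof -
  have "(1::3) \<noteq> 2" "(1::3) \<noteq> 3" "(2::3) \<noteq> 3" by simp_all
  then show ?thesis unfolding UNIV_3 by (simp add: ac_simps)
qed

text \<open>A permutation of coordinates preserves the volume of boxes, and boxes determine Lebesgue
  measure.\<close>

lemma lborel_coords3: "(lborel :: vec3 measure) = distr lborel borel coords3"
proof (rule lborel_eqI)
  have meas: "coords3 \<in> borel_measurable lborel"
    using borel_measurable_continuous_onI[OF continuous_coords3] by simp
  fix l u :: vec3 assume le: "\<And>b. b \<in> Basis \<Longrightarrow> l \<bullet> b \<le> u \<bullet> b"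
  have le': "l $ i \<le> u $ i" for i
    using le[of "axis i 1"] by (simp add: inner_axis axis_in_Basis_iff)
  have box_Pair: "box (a, b) (c, d) = box a c \<times> box b d"
    for a c :: "'a::euclidean_space" and b d :: "'b::euclidean_space"
    by (auto simp: box_def Basis_prod_def ball_Un)
  have "coords3 -` box l u \<inter> space lborel = box ((l$2, l$3), l$1) ((u$2, u$3), u$1)"
    by (auto simp: mem_box_cart forall_3 box_Pair)
  then have "emeasure (distr lborel borel coords3) (box l u) =
      emeasure lborel (box ((l$2, l$3), l$1) ((u$2, u$3), u$1))"
    using meas by (subst emeasure_distr) auto
  also have "box ((l$2, l$3), l$1) ((u$2, u$3), u$1) = (box (l$2) (u$2) \<times> box (l$3) (u$3)) \<times> box
      (l$1) (u$1)"
    by (simp add: box_Pair)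
  also have "emeasure lborel \<dots> = ennreal (u$2 - l$2) * ennreal (u$3 - l$3) * ennreal (u$1 - l$1)"
    using le' by (simp add: lborel_prod[symmetric] lborel.emeasure_pair_measure_Times)
  also have "\<dots> = (\<Prod>b\<in>Basis. (u - l) \<bullet> b)"
  proof -
    have Basis: "(Basis :: vec3 set) = (\<lambda>i. axis i 1) ` UNIV" by (auto simp: Basis_vec_def)
    have "inj (\<lambda>i::3. axis i (1::real))" by (auto intro!: injI simp: axis_eq_axis)
    then have "(\<Prod>b\<in>Basis. (u - l) \<bullet> b) = (\<Prod>i\<in>UNIV. (u - l) $ i)"
      unfolding Basis by (subst prod.reindex) (simp_all add: inner_axis)
    then show ?thesis using le' by (simp add: prod_UNIV3 ennreal_mult[symmetric] ac_simps)
  qed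
  finally show "emeasure (distr lborel borel coords3) (box l u) = (\<Prod>b\<in>Basis. (u - l) \<bullet> b)" .
qed simp

lemma linear_frame: "linear (\<lambda>x::vec3. x$1 *\<^sub>R p + x$2 *\<^sub>R q + x$3 *\<^sub>R r :: vec3)"
  by (auto intro!: linearI simp: algebra_simps)

lemma det_frame: "det (matrix (\<lambda>x::vec3. x$1 *\<^sub>R p + x$2 *\<^sub>R q + x$3 *\<^sub>R r :: vec3)) =
    p \<bullet> cross3 q r"
  by (simp add: det_3 matrix_def axis_def cross3_def inner_vec_def sum_3 vector_3 algebra_simps)

lemma tetrahedron_image:
  fixes a p q r :: vec3
  shows "convex hull {a, a + p, a + q, a + r} =
    (+) a ` (\<lambda>x. x$1 *\<^sub>R p + x$2 *\<^sub>R q + x$3 *\<^sub>R r) ` coords3 ` std_tetrahedron"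
proof -
  let ?L = "\<lambda>x::vec3. x$1 *\<^sub>R p + x$2 *\<^sub>R q + x$3 *\<^sub>R r"
  have Basis: "(Basis :: vec3 set) = {axis 1 1, axis 2 1, axis 3 1}"
    by (auto simp: Basis_vec_def UNIV_3)
  have ne: "axis 1 (1::real) \<noteq> (axis 2 1 :: vec3)" "axis 1 (1::real) \<noteq> (axis 3 1 :: vec3)"
    "axis 2 (1::real) \<noteq> (axis 3 1 :: vec3)" by (simp_all add: axis_eq_axis)
  have std_eq: "convex hull (insert 0 (Basis :: vec3 set)) =
      {x. 0 \<le> x$1 \<and> 0 \<le> x$2 \<and> 0 \<le> x$3 \<and> x$1 + x$2 + x$3 \<le> 1}"
    unfolding std_simplex unfolding Basis using ne by (auto simp: inner_axis)
  have std: "convex hull (insert 0 (Basis :: vec3 set)) = coords3 ` std_tetrahedron"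
  proof (intro equalityI subsetI)
    fix x :: vec3 assume "x \<in> convex hull (insert 0 Basis)"
    then have "0 \<le> x$1" "0 \<le> x$2" "0 \<le> x$3" "x$1 + x$2 + x$3 \<le> 1"
      unfolding std_eq by auto
    then show "x \<in> coords3 ` std_tetrahedron"
      by (intro image_eqI[of _ _ "((x$2, x$3), x$1)"])
        (auto simp: std_tetrahedron_def std_triangle_def vec_eq_iff forall_3)
  next
    fix x :: vec3 assume "x \<in> coords3 ` std_tetrahedron"
    then show "x \<in> convex hull (insert 0 Basis)"
      unfolding std_eq by (auto simp: std_tetrahedron_def std_triangle_def)
  qed
  have "(+) a ` ?L ` insert 0 Basis = {a, a + p, a + q, a + r}"
    unfolding Basis by (auto simp: axis_def)
  then have "convex hull {a, a + p, a + q, a + r} = (+) a ` ?L ` (convex hull (insert 0 Basis))"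
    using convex_hull_translation[of a "?L ` insert 0 Basis"] convex_hull_linear_image[OF
        linear_frame]
    by simp
  then show ?thesis unfolding std .
qed

lemma compact_std_tetrahedron: "compact std_tetrahedron"
  unfolding std_tetrahedron_def
  by (rule compact_under_graph[OF compact_std_triangle])
    (auto intro!: continuous_intros simp: std_triangle_def)

lemma integral_linear_image:
  fixes f :: "vec3 \<Rightarrow> real"
  assumes L: "linear L" and S: "compact S" and f: "continuous_on UNIV f"
  shows "integral (L ` S) f = \<bar>det (matrix L)\<bar> * integral S (\<lambda>x. f (L x))"
proof -
  \<comment> \<open>\<open>integral_change_of_variables_linear\<close> is used with values in
    \<open>real^1\<close>; the real integral is recovered as the only component.\<close>
  let ?v = "\<lambda>t::real. vec t :: real^1"
  have contL: "continuous_on S L" for S using L linear_continuous_on linear_conv_bounded_linear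
      by blast
  have cv: "continuous_on S (\<lambda>x. ?v (g x))" if "continuous_on S g" for g :: "vec3 \<Rightarrow> real" and S
    using that by (auto simp: vec_def intro!: continuous_on_vec_lambda)
  have cf: "continuous_on S f" for S using f continuous_on_subset by blast
  have cfL: "continuous_on S (\<lambda>x. f (L x))"
    by (rule continuous_on_compose2[OF f contL]) simp
  have comp: "compact (L ` S)" by (rule compact_continuous_image[OF contL S])
  have abs: "g absolutely_integrable_on T" if "compact T" "continuous_on T g"
      for g :: "vec3 \<Rightarrow> real^1" and T
  proof -
    have "set_integrable lborel T g" using borel_integrable_compact[OF that]
        by (simp add: set_integrable_def)
    then show ?thesis unfolding set_integrable_def
        by (rule integrable_completion[THEN iffD2, rotated]) (use that in \<open>auto intro!:
        borel_measurable_continuous_on_indicator compact_imp_closed borel_closed\<close>)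
  qed
  have *: "integral (L ` S) (\<lambda>x. ?v (f x)) = \<bar>det (matrix L)\<bar> *\<^sub>R integral S ((\<lambda>x. ?v (f x)) \<circ> L)"
    by (rule integral_change_of_variables_linear[OF L]) (use abs[OF comp cv[OF cf]] in blast)
  have "integral T (\<lambda>x. ?v (g x)) $ 1 = integral T g" if "compact T" "continuous_on T g"
      for T and g :: "vec3 \<Rightarrow> real"
    using integral_component_eq_cart[of "\<lambda>x. ?v (g x)" T 1] abs[OF that(1) cv[OF that(2)]]
    by (simp add: set_lebesgue_integral_eq_integral(1))
  then show ?thesis
    using arg_cong[OF *, of "\<lambda>x. x $ 1"] comp S cf cfL by (simp add: o_def)
qed

text \<open>Translation, linear map and permutation of coordinates are undone in turn; only the
  linear map contributes a factor, the triple product of the edge vectors.\<close>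

lemma integral_tetrahedron:
  fixes f :: "vec3 \<Rightarrow> real"
  assumes f: "continuous_on UNIV f"
  shows "integral (convex hull {a, a + p, a + q, a + r}) f =
    \<bar>p \<bullet> cross3 q r\<bar> * integral std_tetrahedron (\<lambda>((s, t), u). f (a + u *\<^sub>R p + s *\<^sub>R q + t *\<^sub>R r))"
proof -
  let ?L = "\<lambda>x::vec3. x$1 *\<^sub>R p + x$2 *\<^sub>R q + x$3 *\<^sub>R r"
  let ?T = "coords3 ` std_tetrahedron"
  have T: "compact ?T" by (rule compact_continuous_image[OF continuous_coords3
      compact_std_tetrahedron])
  have cL: "continuous_on S ?L" for S using linear_frame linear_continuous_on
      linear_conv_bounded_linear by blast
  have LT: "compact (?L ` ?T)" by (rule compact_continuous_image[OF cL T])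
  have aLT: "compact ((+) a ` ?L ` ?T)" by (rule compact_translation[OF LT])
  have cf: "continuous_on S f" for S using f continuous_on_subset by blast
  have cfa: "continuous_on S (\<lambda>x. f (a + x))" for S
    by (rule continuous_on_compose2[OF f]) (auto intro!: continuous_intros)
  have cfaL: "continuous_on S (\<lambda>x. f (a + ?L x))" for S
    by (rule continuous_on_compose2[OF cfa[of UNIV] cL]) simp
  have ind: "indicator ((+) a ` X) (a + x) = (indicator X x :: real)" for X x
    by (auto simp: indicator_def)
  have "integral ((+) a ` ?L ` ?T) f = (\<integral>x. indicator ((+) a ` ?L ` ?T) x * f x \<partial>lborel)"
    by (rule compact_integral_lborel[OF aLT cf])
  also have "\<dots> = (\<integral>x. indicator ((+) a ` ?L ` ?T) x * f x \<partial>(distr lborel borel ((+) a)))"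
    by (simp only: lborel_distr_plus)
  also have "\<dots> = (\<integral>x. indicator ((+) a ` ?L ` ?T) (a + x) * f (a + x) \<partial>lborel)"
    using borel_integrable_compact[OF aLT cf] by (subst integral_distr) auto
  also have "\<dots> = (\<integral>x. indicator (?L ` ?T) x * f (a + x) \<partial>lborel)"
    by (simp only: ind)
  also have "\<dots> = integral (?L ` ?T) (\<lambda>x. f (a + x))"
    by (rule compact_integral_lborel[OF LT cfa, symmetric])
  also have "\<dots> = \<bar>p \<bullet> cross3 q r\<bar> * integral ?T (\<lambda>x. f (a + ?L x))"
    by (rule integral_linear_image[OF linear_frame T cfa, unfolded det_frame])
  also have "integral ?T (\<lambda>x. f (a + ?L x)) = (\<integral>x. indicator ?T x * f (a + ?L x) \<partial>lborel)"
    by (rule compact_integral_lborel[OF T cfaL])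
  also have "\<dots> = (\<integral>x. indicator ?T x * f (a + ?L x) \<partial>(distr lborel borel coords3))"
    by (simp only: lborel_coords3[symmetric])
  also have "\<dots> = (\<integral>x. indicator ?T (coords3 x) * f (a + ?L (coords3 x)) \<partial>lborel)"
    using borel_integrable_compact[OF T cfaL] borel_measurable_continuous_onI[OF continuous_coords3]
    by (subst integral_distr) auto
  also have "\<dots> = (\<integral>x. indicator std_tetrahedron x * f (a + ?L (coords3 x)) \<partial>lborel)"
  proof -
    have "inj coords3" by (auto intro!: injI simp: vec_eq_iff forall_3 prod_eq_iff)
    then show ?thesis
      by (intro Bochner_Integration.integral_cong) (auto simp: indicator_def inj_image_mem_iff)
  qed
  also have "\<dots> = integral std_tetrahedron (\<lambda>x. f (a + ?L (coords3 x)))"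
    by (rule compact_integral_lborel[OF compact_std_tetrahedron, symmetric])
      (rule continuous_on_compose2[OF cfaL[of UNIV] continuous_coords3], simp)
  also have "(\<lambda>x. f (a + ?L (coords3 x))) = (\<lambda>((s, t), u). f (a + u *\<^sub>R p + s *\<^sub>R q + t *\<^sub>R r))"
    by (auto simp: fun_eq_iff algebra_simps)
  finally show ?thesis unfolding tetrahedron_image .
qed

section \<open>Frames of edges and faces\<close>

lemma orthonormal3_expand:
  assumes "orthonormal3 a b c"
  shows "(x \<bullet> a) *\<^sub>R a + (x \<bullet> b) *\<^sub>R b + (x \<bullet> c) *\<^sub>R c = x"
proof -
  have n: "norm a = 1" "norm b = 1" "norm c = 1" and o: "a \<bullet> b = 0" "a \<bullet> c = 0" "b \<bullet> c = 0"
    using assms unfolding orthonormal3_def by auto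
  have "a \<bullet> a = 1" "b \<bullet> b = 1" "c \<bullet> c = 1" using n by (auto simp: norm_eq_1)
  then have ne: "a \<noteq> b" "a \<noteq> c" "b \<noteq> c" using o by auto
  have B: "pairwise orthogonal {a, b, c}"
    using o by (auto simp: pairwise_def orthogonal_def inner_commute)
  have "independent {a, b, c}"
    by (rule pairwise_orthogonal_independent[OF B]) (use n in auto)
  then have "x \<in> span {a, b, c}"
    using card_ge_dim_independent[of "{a, b, c}" UNIV] ne by auto
  then have "(\<Sum>i\<in>{a, b, c}. (x \<bullet> i) *\<^sub>R i) = x"
    by (intro orthonormal_basis_expand[OF B]) (use n in auto)
  then show ?thesis using ne by (simp add: add.assoc)
qed

lemma orthonormal3_exists:
  assumes "norm a = 1"
  shows "\<exists>b c. orthonormal3 a b c"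
proof -
  obtain y :: vec3 where y: "y \<noteq> 0" "orthogonal a y"
    using orthogonal_to_vector_exists[of a] by auto
  define b where "b = y /\<^sub>R norm y"
  have b: "norm b = 1" "a \<bullet> b = 0" using y by (auto simp: b_def orthogonal_def)
  have "(norm (cross3 a b))\<^sup>2 = 1" using norm_cross_dot[of a b] b assms by simp
  then have "norm (cross3 a b) = 1" using power2_eq_1_iff[of "norm (cross3 a b)"] norm_ge_zero[of
      "cross3 a b"] by linarith
  then have "orthonormal3 a b (cross3 a b)"
    using assms b dot_cross_self by (simp add: orthonormal3_def)
  then show ?thesis by blast
qed

lemma triangle_vertices:
  assumes "2 simplex f"
  obtains a b c where "\<not> collinear {a, b, c}" "f = convex hull {a, b, c}"
proof -
  obtain C where C: "\<not> affine_dependent C" "card C = 3" "f = convex hull C"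
    using assms unfolding simplex_def by auto
  then obtain a b c where abc: "C = {a, b, c}" "a \<noteq> b" "a \<noteq> c" "b \<noteq> c" by (auto simp: card_3_iff)
  then have "\<not> collinear {a, b, c}" using C by (simp add: collinear_3_eq_affine_dependent)
  then show ?thesis using that C abc by blast
qed

lemma segment_vertices:
  assumes "1 simplex e"
  obtains a b where "a \<noteq> b" "e = convex hull {a, b}"
proof -
  obtain C where C: "card C = 2" "e = convex hull C"
    using assms unfolding simplex_def by auto
  then obtain a b where "C = {a, b}" "a \<noteq> b" by (auto simp: card_2_iff)
  then show ?thesis using that C by blast
qed

lemma cross_eq_0_collinear: "cross3 (b - a) (c - a) = 0 \<longleftrightarrow> collinear {a, b, c}"
proof -
  have "collinear {a, b, c} \<longleftrightarrow> collinear {b, a, c}" by (simp add: insert_commute)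
  also have "\<dots> \<longleftrightarrow> collinear {0, b - a, c - a}"
    by (auto simp: collinear_def)
  finally show ?thesis by (simp add: cross_eq_0)
qed

text \<open>Justifies the choice in the definition: the normalised cross product of two sides
  extends to an orthonormal frame.\<close>

lemma face_frame:
  assumes "2 simplex f"
  shows "orthonormal3 (face_normal f) (face_tangent1 f) (face_tangent2 f)" "normal_to (face_normal
      f) f"
proof -
  obtain a b c where abc: "\<not> collinear {a, b, c}" "f = convex hull {a, b, c}"
    using triangle_vertices[OF assms] .
  define m where "m = cross3 (b - a) (c - a)"
  have m: "m \<noteq> 0" using abc cross_eq_0_collinear m_def by simp
  have m_orth: "m \<bullet> (b - a) = 0" "m \<bullet> (c - a) = 0" unfolding m_def by (simp_all add: dot_cross_self)
  define n where "n = m /\<^sub>R norm m"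
  have "norm n = 1" using m by (simp add: n_def)
  then obtain t1 t2 where t: "orthonormal3 n t1 t2" using orthonormal3_exists by blast
  have n: "n \<bullet> (b - a) = 0" "n \<bullet> (c - a) = 0" using m_orth by (simp_all add: n_def)
  have pt: "\<exists>r s. x = a + r *\<^sub>R (b - a) + s *\<^sub>R (c - a)" if "x \<in> f" for x
    using that unfolding abc convex_hull_3_alt by blast
  have "n \<bullet> x = n \<bullet> a" if x: "x \<in> f" for x
  proof -
    obtain r s where "x = a + r *\<^sub>R (b - a) + s *\<^sub>R (c - a)" using pt[OF x] by blast
    then show ?thesis using n by (simp only: inner_add_right inner_scaleR_right)
  qed
  then have "normal_to n f" by (simp add: normal_to_def inner_diff_right)
  then have "case (n, t1, t2) of (n, t1, t2) \<Rightarrow> orthonormal3 n t1 t2 \<and> normal_to n f" using t by simp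
  then have "case face_frame f of (n, t1, t2) \<Rightarrow> orthonormal3 n t1 t2 \<and> normal_to n f"
    unfolding face_frame_def by (rule someI)
  then show "orthonormal3 (face_normal f) (face_tangent1 f) (face_tangent2 f)" "normal_to
      (face_normal f) f"
    unfolding face_normal_def face_tangent1_def face_tangent2_def by (auto simp: case_prod_unfold)
qed

lemma edge_frame:
  assumes "1 simplex e"
  shows "orthonormal3 (edge_tangent e) (edge_normal1 e) (edge_normal2 e)"
    "normal_to (edge_normal1 e) e" "normal_to (edge_normal2 e) e"
proof -
  obtain a b where ab: "a \<noteq> b" "e = convex hull {a, b}" using segment_vertices[OF assms] .
  define t where "t = (b - a) /\<^sub>R norm (b - a)"
  have "norm t = 1" using ab by (simp add: t_def)
  then obtain n1 n2 where n: "orthonormal3 t n1 n2" using orthonormal3_exists by blast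
  \<comment> \<open>Anything orthogonal to the direction of the edge qualifies, so an arbitrary
    completion of \<open>t\<close> to a frame works.\<close>
  have "normal_to m e" if "t \<bullet> m = 0" for m
  proof -
    have "m \<bullet> (b - a) = 0" using that ab by (simp add: t_def inner_commute)
    moreover have "\<exists>r. x = a + r *\<^sub>R (b - a)" if "x \<in> e" for x
      using that unfolding ab convex_hull_2_alt by blast
    ultimately have "m \<bullet> x = m \<bullet> a" if "x \<in> e" for x
      using that by (metis add.right_neutral inner_add_right inner_scaleR_right mult_zero_right)
    then show ?thesis by (simp add: normal_to_def inner_diff_right)
  qed
  then have "case (t, n1, n2) of (t, n1, n2) \<Rightarrow> orthonormal3 t n1 n2 \<and> normal_to n1 e \<and>
      normal_to n2 e"
    using n by (auto simp: orthonormal3_def)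
  then have "case edge_frame e of (t, n1, n2) \<Rightarrow> orthonormal3 t n1 n2 \<and> normal_to n1 e \<and>
      normal_to n2 e"
    unfolding edge_frame_def by (rule someI)
  then show "orthonormal3 (edge_tangent e) (edge_normal1 e) (edge_normal2 e)"
    "normal_to (edge_normal1 e) e" "normal_to (edge_normal2 e) e"
    unfolding edge_tangent_def edge_normal1_def edge_normal2_def by (auto simp: case_prod_unfold)
qed

lemma edge_tangent_parallel:
  assumes "1 simplex e" "x \<in> e" "y \<in> e"
  shows "y - x = ((y - x) \<bullet> edge_tangent e) *\<^sub>R edge_tangent e"
proof -
  have "(y - x) \<bullet> edge_normal1 e = 0" "(y - x) \<bullet> edge_normal2 e = 0"
    using edge_frame(2,3)[OF assms(1)] assms(2,3) by (auto simp: normal_to_def inner_commute)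
  then show ?thesis using orthonormal3_expand[OF edge_frame(1)[OF assms(1)], of "y - x"] by simp
qed

text \<open>The chosen normal is known up to sign only; the scalar product as coefficient carries
  that sign without deciding it. It holds because the cross product of the normal with the left side
  vanishes.\<close>

lemma cross_face_normal:
  assumes f: "2 simplex f" and "x \<in> f" "y \<in> f" "z \<in> f"
  shows "cross3 (y - x) (z - x) = (cross3 (y - x) (z - x) \<bullet> face_normal f) *\<^sub>R face_normal f"
proof -
  let ?m = "cross3 (y - x) (z - x)" and ?n = "face_normal f"
  have n: "?n \<bullet> ?n = 1" "?n \<bullet> (y - x) = 0" "?n \<bullet> (z - x) = 0"
    using face_frame[OF f] assms(2-) by (auto simp: orthonormal3_def norm_eq_1 normal_to_def)
  have "cross3 ?n ?m = 0"
    using n(2,3) Lagrange[of ?n "y - x" "z - x"] by simp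
  then have "cross3 ?n (cross3 ?n ?m) = 0" by simp
  then show ?thesis using n(1) Lagrange[of ?n ?n ?m] by (simp add: inner_commute)
qed

section \<open>Integrals over edges and faces\<close>

text \<open>The vertices are the extreme points. Hence the vertices selected inside the edge and
  face integrals are a reordering of any given ones.\<close>

lemma vertices_unique:
  fixes S T :: "'a::euclidean_space set"
  assumes "\<not> affine_dependent S" "\<not> affine_dependent T" "convex hull S = convex hull T"
  shows "S = T"
proof -
  have "x \<in> S \<longleftrightarrow> x \<in> T" for x
    using extreme_point_of_convex_hull_affine_independent[OF assms(1), of x]
      extreme_point_of_convex_hull_affine_independent[OF assms(2), of x] assms(3) by simp
  then show ?thesis by blast
qed

lemma edge_integral_eq:
  fixes a b :: vec3
  assumes "a \<noteq> b"
  shows "edge_integral (convex hull {a, b}) g = norm (b - a) * integral {0..1} (\<lambda>r. g (a + r *\<^sub>R (b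
      - a)))"
proof -
  define ab' where "ab' = (SOME (a', b'). a' \<noteq> b' \<and> convex hull {a, b} = convex hull {a', b'})"
  obtain a' b' where ab': "ab' = (a', b')" by force
  have "case (a, b) of (a', b') \<Rightarrow> a' \<noteq> b' \<and> convex hull {a, b} = convex hull {a', b'}" using assms
      by simp
  then have "case ab' of (a', b') \<Rightarrow> a' \<noteq> b' \<and> convex hull {a, b} = convex hull {a', b'}"
    unfolding ab'_def by (rule someI)
  then have "{a, b} = {a', b'}"
    using vertices_unique[of "{a, b}" "{a', b'}"] by (simp add: ab' affine_independent_2)
  then consider "a' = a" "b' = b" | "a' = b" "b' = a" by (auto simp: doubleton_eq_iff)
  moreover have "edge_integral (convex hull {a, b}) g =
      norm (b' - a') * integral {0..1} (\<lambda>r. g (a' + r *\<^sub>R (b' - a')))"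
    unfolding edge_integral_def ab'_def[symmetric] ab' by simp
  moreover have "integral {0..1} (\<lambda>r. g (b + r *\<^sub>R (a - b))) =
      integral {0..1} (\<lambda>r. g (a + r *\<^sub>R (b - a)))"
  proof -
    have "a + (1 - r) *\<^sub>R (b - a) = b + r *\<^sub>R (a - b)" for r by (simp add: algebra_simps)
    then show ?thesis
      using integral_reflect_Icc[of 1 "\<lambda>r. g (a + r *\<^sub>R (b - a))"] by simp
  qed
  ultimately show ?thesis by cases (simp_all add: norm_minus_commute)
qed

text \<open>Integral over the reference triangle without the area factor, for a fixed labelling of
  the vertices.\<close>

definition triangle_integral :: "vec3 \<Rightarrow> vec3 \<Rightarrow> vec3 \<Rightarrow> (vec3 \<Rightarrow> real) \<Rightarrow> real" where
  "triangle_integral a b c g = integral std_triangle (\<lambda>(r, s). g (a + r *\<^sub>R (b - a) + s *\<^sub>R (c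
      - a)))"

lemma continuous_on_triangle_param:
  fixes g :: "vec3 \<Rightarrow> real"
  assumes "continuous_on UNIV g"
  shows "continuous_on S (\<lambda>(r, s). g (a + r *\<^sub>R p + s *\<^sub>R q))"
  unfolding case_prod_unfold
  by (rule continuous_on_compose2[OF assms]) (auto intro!: continuous_intros)

lemma triangle_integral_swap:
  assumes g: "continuous_on UNIV g"
  shows "triangle_integral a c b g = triangle_integral a b c g"
  using std_triangle_swap[OF continuous_on_triangle_param[OF g, of _ a "b - a" "c - a"]]
  unfolding triangle_integral_def by (simp add: add.commute add.left_commute)

lemma triangle_integral_reverse:
  assumes g: "continuous_on UNIV g"
  shows "triangle_integral c b a g = triangle_integral a b c g"
proof -
  have "a + r *\<^sub>R (b - a) + (1 - r - s) *\<^sub>R (c - a) = c + r *\<^sub>R (b - c) + s *\<^sub>R (a - c)" for r s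
    by (simp add: algebra_simps)
  then show ?thesis
    using std_triangle_shear[OF continuous_on_triangle_param[OF g, of _ a "b - a" "c - a"]]
    unfolding triangle_integral_def by simp
qed

text \<open>Two transpositions generate the six relabellings; under each of them the cross product
  changes at most its sign.\<close>

lemma triangle_integral_perm:
  assumes g: "continuous_on UNIV g" and eq: "{a, b, c} = {a', b', c'}" and "card {a, b, c} = 3"
  shows "triangle_integral a' b' c' g = triangle_integral a b c g"
    and "norm (cross3 (b' - a') (c' - a')) = norm (cross3 (b - a) (c - a))"
proof -
  note sw = triangle_integral_swap[OF g] and rv = triangle_integral_reverse[OF g]
  have ne: "a \<noteq> b" "a \<noteq> c" "b \<noteq> c" using assms(3) by (auto simp: card_insert_if split: if_splits)
  have d: "(a', b', c') = (a, b, c) \<or> (a', b', c') = (a, c, b) \<or> (a', b', c') = (b, a, c) \<or>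
    (a', b', c') = (b, c, a) \<or> (a', b', c') = (c, a, b) \<or> (a', b', c') = (c, b, a)"
    using eq ne by (simp add: set_eq_iff) metis
  have x: "triangle_integral b c a g = triangle_integral a b c g"
    by (subst rv) (rule sw)
  have y: "triangle_integral b a c g = triangle_integral a b c g" by (subst sw) (rule x)
  have z: "triangle_integral c a b g = triangle_integral a b c g" by (subst sw) (rule rv)
  from d show "triangle_integral a' b' c' g = triangle_integral a b c g"
    using sw rv x y z by auto
  have "cross3 (c - a) (b - a) = - cross3 (b - a) (c - a)" "cross3 (a - b) (c - b) =
      - cross3 (b - a) (c - a)"
    "cross3 (c - b) (a - b) = cross3 (b - a) (c - a)" "cross3 (a - c) (b - c) =
        cross3 (b - a) (c - a)"
    "cross3 (b - c) (a - c) = - cross3 (b - a) (c - a)"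
    by (simp_all add: cross3_simps)
  with d show "norm (cross3 (b' - a') (c' - a')) = norm (cross3 (b - a) (c - a))" by auto
qed

lemma noncollinear_card: "\<not> collinear {a, b, c} \<Longrightarrow> card {a, b, c} = 3 \<and> \<not> affine_dependent {a, b, c}"
  by (auto simp: collinear_3_eq_affine_dependent)

lemma face_integral_eq:
  assumes abc: "\<not> collinear {a, b, c}" and g: "continuous_on UNIV g"
  shows "face_integral (convex hull {a, b, c}) g = norm (cross3 (b - a) (c - a)) * triangle_integral
      a b c g"
proof -
  define t where "t = (SOME (a', b', c'). \<not> collinear {a', b', c'} \<and> convex hull {a, b, c} =
      convex hull {a', b', c'})"
  obtain a' b' c' where t: "t = (a', b', c')" using prod_cases3 by blast
  have "case (a, b, c) of (a', b', c') \<Rightarrow> \<not> collinear {a', b', c'} \<and> convex hull {a, b, c} =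
      convex hull {a', b', c'}"
    using abc by simp
  then have "case t of (a', b', c') \<Rightarrow> \<not> collinear {a', b', c'} \<and> convex hull {a, b, c} =
      convex hull {a', b', c'}"
    unfolding t_def by (rule someI)
  then have "{a, b, c} = {a', b', c'}"
    using vertices_unique[of "{a, b, c}" "{a', b', c'}"] noncollinear_card[OF abc]
        noncollinear_card[of a' b' c'] by (simp add: t)
  moreover have "face_integral (convex hull {a, b, c}) g = norm (cross3 (b' - a') (c' - a')) *
      triangle_integral a' b' c' g"
    unfolding face_integral_def t_def[symmetric] t triangle_integral_def std_triangle_def by simp
  ultimately show ?thesis
    using triangle_integral_perm[OF g] noncollinear_card[OF abc] by metis
qed

section \<open>Integration by parts on simplices\<close>

definition dir_deriv :: "vec3 \<Rightarrow> (vec3 \<Rightarrow> real) \<Rightarrow> vec3 \<Rightarrow> real" where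
  "dir_deriv p F x = (\<Sum>k\<in>UNIV. p $ k * partial k F x)"

lemma continuous_on_partial: "C_k (Suc 0) F \<Longrightarrow> continuous_on S (partial k F)"
  using C_k_Suc_partial C_k_continuous by blast

lemma continuous_on_dir_deriv: "C_k (Suc 0) F \<Longrightarrow> continuous_on S (dir_deriv p F)"
  unfolding dir_deriv_def[abs_def] by (intro continuous_intros continuous_on_partial)

text \<open>The offset \<open>y\<close> collects the terms of a parametrisation that do not depend
  on \<open>t\<close>, so the rule matches whatever their position.\<close>

lemma dir_deriv_line:
  assumes "C_k (Suc 0) F"
  shows "((\<lambda>t. F (x + t *\<^sub>R p + y)) has_real_derivative dir_deriv p F (x + t *\<^sub>R p + y)) (at t)"
proof -
  have "((\<lambda>t. F (x + t *\<^sub>R p + y)) has_derivative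
      (\<lambda>h. \<Sum>j\<in>UNIV. (h *\<^sub>R p) $ j *\<^sub>R partial j F (x + t *\<^sub>R p + y))) (at t)"
    by (rule has_derivative_compose[OF _ has_derivative_partials[OF C_k_Suc_differentiable[OF
        assms]]])
      (auto intro!: derivative_eq_intros)
  then show ?thesis
    unfolding has_field_derivative_def
    by (rule has_derivative_eq_rhs) (auto simp: dir_deriv_def sum_distrib_left sum_distrib_right
        algebra_simps)
qed

lemma integral_segment_dir_deriv:
  assumes "C_k (Suc 0) F"
  shows "integral {0..1} (\<lambda>r. dir_deriv p F (a + r *\<^sub>R p)) = F (a + p) - F a"
proof -
  have "((\<lambda>r. dir_deriv p F (a + r *\<^sub>R p)) has_integral F (a + 1 *\<^sub>R p + 0) - F (a + 0 *\<^sub>R p + 0))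
      {0..1}"
    using dir_deriv_line[OF assms, of a p 0]
    by (intro fundamental_theorem_of_calculus)
      (auto simp: has_real_derivative_iff_has_vector_derivative[symmetric] intro:
          has_field_derivative_at_within)
  then show ?thesis by (simp add: integral_unique)
qed

text \<open>Segments parallel to \<open>p\<close> start on the edge from a to a + q and end on the
  edge from a + p to a + q.\<close>

lemma integral_triangle_dir_deriv:
  assumes F: "C_k (Suc 0) F"
  shows "integral std_triangle (\<lambda>(s, t). dir_deriv p F (a + t *\<^sub>R p + s *\<^sub>R q)) =
    integral {0..1} (\<lambda>s. F (a + p + s *\<^sub>R (q - p))) - integral {0..1} (\<lambda>s. F (a + s *\<^sub>R q))"
proof -
  have cF: "continuous_on S F" for S using C_k_continuous[OF F] .
  have cont: "continuous_on {0..1} (\<lambda>s::real. F (u + s *\<^sub>R v))" for u v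
    by (rule continuous_on_compose2[OF cF[of UNIV]]) (auto intro!: continuous_intros)
  have "continuous_on std_triangle (\<lambda>(s, t). dir_deriv p F (a + t *\<^sub>R p + s *\<^sub>R q))"
    using continuous_on_triangle_param[OF continuous_on_dir_deriv[OF F], of std_triangle p a q p]
    unfolding case_prod_unfold
    by (intro continuous_on_compose2[OF continuous_on_dir_deriv[OF F, of UNIV]])
        (auto intro!: continuous_intros)
  then have "integral std_triangle (\<lambda>(s, t). dir_deriv p F (a + t *\<^sub>R p + s *\<^sub>R q)) =
      integral {0..1} (\<lambda>s. F (a + (1 - s) *\<^sub>R p + s *\<^sub>R q) - F (a + 0 *\<^sub>R p + s *\<^sub>R q))"
    using ftc_under_graph[of "{0..1::real}" "\<lambda>s. 1 - s" "\<lambda>(s, t). dir_deriv p F (a + t *\<^sub>R p + s *\<^sub>R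
        q)"
        "\<lambda>(s, t). F (a + t *\<^sub>R p + s *\<^sub>R q)"] dir_deriv_line[OF F, of a p]
    by (simp add: std_triangle_graph continuous_intros)
  also have "\<dots> = integral {0..1} (\<lambda>s. F (a + p + s *\<^sub>R (q - p)) - F (a + s *\<^sub>R q))"
    by (simp add: algebra_simps)
  also have "\<dots> = integral {0..1} (\<lambda>s. F (a + p + s *\<^sub>R (q - p))) - integral {0..1} (\<lambda>s. F (a + s *\<^sub>R
      q))"
    by (intro Henstock_Kurzweil_Integration.integral_diff integrable_continuous_interval cont)
  finally show ?thesis .
qed

text \<open>Segments parallel to \<open>b - a\<close> start on the face acd and end on the face bcd,
  so integrating the derivative along them leaves the difference of two face integrals.\<close>

lemma integral_tetrahedron_dir_deriv:
  assumes F: "C_k (Suc 0) F"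
  shows "integral (convex hull {a, b, c, d}) (dir_deriv (b - a) F) =
    \<bar>(b - a) \<bullet> cross3 (c - a) (d - a)\<bar> * (triangle_integral b c d F - triangle_integral a c d F)"
proof -
  define p q r where "p = b - a" and "q = c - a" and "r = d - a"
  have cF: "continuous_on S F" for S using C_k_continuous[OF F] .
  have hull: "convex hull {a, b, c, d} = convex hull {a, a + p, a + q, a + r}"
    by (simp add: p_def q_def r_def)
  let ?g = "\<lambda>((s, t), u). dir_deriv p F (a + u *\<^sub>R p + s *\<^sub>R q + t *\<^sub>R r)"
  let ?G = "\<lambda>((s, t), u). F (a + u *\<^sub>R p + s *\<^sub>R q + t *\<^sub>R r)"
  have g: "continuous_on S ?g" for S
    unfolding case_prod_unfold
    by (intro continuous_on_compose2[OF continuous_on_dir_deriv[OF F, of UNIV]])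
        (auto intro!: continuous_intros)
  have "integral std_tetrahedron ?g = integral std_triangle (\<lambda>x. ?G (x, 1 - fst x - snd x) - ?G
      (x, 0))"
    unfolding std_tetrahedron_def
  proof (rule ftc_under_graph[OF compact_std_triangle _ _ g])
    show "continuous_on std_triangle (\<lambda>x. 1 - fst x - snd x)" by (intro continuous_intros)
    show "0 \<le> 1 - fst x - snd x" if "x \<in> std_triangle" for x
      using that by (auto simp: std_triangle_def)
    show "((\<lambda>u. ?G (x, u)) has_real_derivative ?g (x, u)) (at u)" for x u
      using dir_deriv_line[OF F, of a p "fst x *\<^sub>R q + snd x *\<^sub>R r" u]
      by (simp add: case_prod_unfold add.assoc)
  qed
  also have "\<dots> = integral std_triangle (\<lambda>x. (\<lambda>(s, t). F (b + s *\<^sub>R (c - b) + t *\<^sub>R (d - b))) x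
      - (\<lambda>(s, t). F (a + s *\<^sub>R (c - a) + t *\<^sub>R (d - a))) x)"
    by (rule arg_cong[where f="integral std_triangle"])
      (auto simp: fun_eq_iff p_def q_def r_def algebra_simps intro!: arg_cong[where f=F])
  also have "\<dots> = triangle_integral b c d F - triangle_integral a c d F"
    unfolding triangle_integral_def
    by (intro Henstock_Kurzweil_Integration.integral_diff compact_integrable compact_std_triangle
        continuous_on_triangle_param cF)
  finally show ?thesis
    unfolding hull integral_tetrahedron[OF continuous_on_dir_deriv[OF F]]
    by (simp add: p_def q_def r_def)
qed

text \<open>The cross products of pairs of edge vectors form the dual basis up to the triple
  product. This resolves a coordinate direction along the three edges.\<close>

lemma cross_dual_basis:
  "(p \<bullet> cross3 q r) * (axis j 1 :: vec3) $ k =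
    cross3 q r $ j * p $ k + cross3 r p $ j * q $ k + cross3 p q $ j * r $ k"
  using exhaust_3[of j] exhaust_3[of k] by (elim disjE) (simp_all add: cross3_simps axis_def)

lemma tetrahedron_triple_product:
  fixes a b c d :: vec3
  assumes "\<not> affine_dependent {a, b, c, d}" "card {a, b, c, d} = 4"
  shows "(b - a) \<bullet> cross3 (c - a) (d - a) \<noteq> 0"
proof
  assume 0: "(b - a) \<bullet> cross3 (c - a) (d - a) = 0"
  let ?L = "\<lambda>x::vec3. x$1 *\<^sub>R (b - a) + x$2 *\<^sub>R (c - a) + x$3 *\<^sub>R (d - a)"
  have "\<not> inj ?L" using 0 det_nz_iff_inj[OF linear_frame, of "b - a" "c - a" "d - a"]
    by (simp add: det_frame)
  then obtain x where x: "?L x = 0" "x \<noteq> 0"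
    unfolding linear_injective_0[OF linear_frame] by blast
  have ne: "a \<noteq> b" "a \<noteq> c" "a \<noteq> d" "b \<noteq> c" "b \<noteq> d" "c \<noteq> d"
    using assms(2) by (auto simp: card_insert_if split: if_splits)
  \<comment> \<open>A kernel vector of the frame gives weights at b, c, d; the vertex a gets minus
    their sum, which makes the total 0.\<close>
  define U where "U v = (if v = b then x$1 else if v = c then x$2 else if v =
      d then x$3 else - (x$1 + x$2 + x$3))" for v
  have "sum U {a, b, c, d} = 0" "(\<Sum>v\<in>{a, b, c, d}. U v *\<^sub>R v) = ?L x"
    using ne by (simp_all add: U_def algebra_simps)
  moreover have "\<exists>v\<in>{a, b, c, d}. U v \<noteq> 0"
  proof (rule ccontr)
    assume "\<not> (\<exists>v\<in>{a, b, c, d}. U v \<noteq> 0)"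
    then have "U b = 0" "U c = 0" "U d = 0" by blast+
    then have "x$1 = 0" "x$2 = 0" "x$3 = 0" using ne by (simp_all add: U_def)
    then show False using x(2) by (simp add: vec_eq_iff forall_3)
  qed
  ultimately have "affine_dependent {a, b, c, d}"
    unfolding x(1) by (subst affine_dependent_explicit_finite) (simp, blast)
  then show False using assms(1) by simp
qed

lemma simplex_face:
  assumes "\<not> affine_dependent C" "finite C" "D \<subseteq> C" "card D = n + 1"
  shows "(convex hull D) face_of (convex hull C)" "int n simplex (convex hull D)"
proof -
  have "\<not> affine_dependent D" using assms(1,3) affine_dependent_subset by blast
  then show "int n simplex (convex hull D)" using assms(4) by (auto simp: simplex_def)
  show "(convex hull D) face_of (convex hull C)"
    using assms(3) face_of_convex_hull_affine_independent[OF assms(1)] by blast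
qed

text \<open>The coefficient is 1 or -1, depending on whether \<open>m\<close> agrees with the chosen
  normal; only its independence of \<open>F\<close> and \<open>j\<close> matters.\<close>

lemma face_flux:
  fixes x y z :: vec3
  assumes "\<not> collinear {x, y, z}" "m = cross3 (y - x) (z - x)"
  obtains \<kappa> where "\<And>(F :: vec3 \<Rightarrow> real) j. C_k (Suc 0) F \<Longrightarrow> m $ j * triangle_integral x y z F =
    \<kappa> * (face_normal (convex hull {x, y, z}) $ j * face_integral (convex hull {x, y, z}) F)"
proof
  fix F :: "vec3 \<Rightarrow> real" and j assume F: "C_k (Suc 0) F"
  let ?f = "convex hull {x, y, z}"
  have f: "2 simplex ?f"
    using noncollinear_card[OF assms(1)] by (auto simp: simplex_def)
  have "m \<noteq> 0" using assms cross_eq_0_collinear by simp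
  have "x \<in> ?f" "y \<in> ?f" "z \<in> ?f" by (simp_all add: hull_inc)
  from cross_face_normal[OF f this] have m: "m $ j = (m \<bullet> face_normal ?f) * face_normal ?f $ j"
    unfolding assms(2) by (metis vector_scaleR_component real_scaleR_def)
  show "m $ j * triangle_integral x y z F =
    ((m \<bullet> face_normal ?f) / norm m) * (face_normal ?f $ j * face_integral ?f F)"
    unfolding face_integral_eq[OF assms(1) C_k_continuous[OF F]] assms(2)[symmetric]
    using m \<open>m \<noteq> 0\<close> by simp
qed

text \<open>A coordinate derivative is a combination of derivatives along the three edges at a. Each
  of these gives the face opposite a minus one face through a.\<close>

lemma gauss_tetrahedron:
  assumes "3 simplex K"
  obtains f :: "nat \<Rightarrow> vec3 set" and \<kappa> :: "nat \<Rightarrow> real"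
  where "\<And>i. i < 4 \<Longrightarrow> f i face_of K" "\<And>i. i < 4 \<Longrightarrow> 2 simplex f i"
    "\<And>F j. C_k (Suc 0) F \<Longrightarrow> integral K (partial j F) =
      (\<Sum>i<4. \<kappa> i * (face_normal (f i) $ j * face_integral (f i) F))"
proof -
  obtain C where C: "\<not> affine_dependent C" "card C = 4" "K = convex hull C"
    using assms unfolding simplex_def by auto
  have "finite C" using C(2) card.infinite by fastforce
  obtain a b c d where abcd: "C = {a, b, c, d}" "card {a, b, c, d} = 4"
  proof -
    obtain a A where "C = insert a A" "a \<notin> A" "card A = 3"
      using C(2) card_Suc_eq[of C 3] by auto
    moreover from this obtain b c d where "A = {b, c, d}" by (auto simp: card_3_iff)
    ultimately show ?thesis using that C(2) by blast
  qed
  have ne: "a \<noteq> b" "a \<noteq> c" "a \<noteq> d" "b \<noteq> c" "b \<noteq> d" "c \<noteq> d"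
    using abcd(2) by (auto simp: card_insert_if split: if_splits)
  define p q r where "p = b - a" and "q = c - a" and "r = d - a"
  define \<Delta> where "\<Delta> = p \<bullet> cross3 q r"
  have \<Delta>: "\<Delta> \<noteq> 0"
    using tetrahedron_triple_product[of a b c d] C abcd unfolding \<Delta>_def p_def q_def r_def by simp
  have sub: "\<not> collinear {x, y, z}" if "{x, y, z} \<subseteq> C" "x \<noteq> y" "x \<noteq> z" "y \<noteq> z" for x y z
    using that affine_dependent_subset C(1) by (auto simp: collinear_3_eq_affine_dependent)
  have nc: "\<not> collinear {b, c, d}" "\<not> collinear {a, c, d}" "\<not> collinear {a, d, b}" "\<not> collinear {a,
      b, c}"
    using sub[of b c d] sub[of a c d] sub[of a d b] sub[of a b c] ne by (simp_all add: abcd)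
  \<comment> \<open>The face opposite a collects three contributions, which add up to its own cross
    product.\<close>
  have m0: "cross3 q r + cross3 r p + cross3 p q = cross3 (c - b) (d - b)"
    unfolding p_def q_def r_def by (simp add: cross3_simps)
  obtain k0 where k0: "\<And>F j. C_k (Suc 0) F \<Longrightarrow> cross3 (c - b) (d - b) $ j * triangle_integral b c d
      F =
    k0 * (face_normal (convex hull {b, c, d}) $ j * face_integral (convex hull {b, c, d}) F)"
    using face_flux[OF nc(1) refl] by blast
  obtain k1 where k1: "\<And>F j. C_k (Suc 0) F \<Longrightarrow> cross3 q r $ j * triangle_integral a c d F =
    k1 * (face_normal (convex hull {a, c, d}) $ j * face_integral (convex hull {a, c, d}) F)"
    using face_flux[OF nc(2) refl] unfolding q_def r_def by blast
  obtain k2 where k2: "\<And>F j. C_k (Suc 0) F \<Longrightarrow> cross3 r p $ j * triangle_integral a d b F =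
    k2 * (face_normal (convex hull {a, d, b}) $ j * face_integral (convex hull {a, d, b}) F)"
    using face_flux[OF nc(3) refl] unfolding p_def r_def by blast
  obtain k3 where k3: "\<And>F j. C_k (Suc 0) F \<Longrightarrow> cross3 p q $ j * triangle_integral a b c F =
    k3 * (face_normal (convex hull {a, b, c}) $ j * face_integral (convex hull {a, b, c}) F)"
    using face_flux[OF nc(4) refl] unfolding p_def q_def by blast
  \<comment> \<open>The order of the vertices matches the cross products: a, d, b belongs to r x p,
    so that all signs appear in \<open>\<kappa>\<close> alone.\<close>
  define f where "f = (\<lambda>i::nat. convex hull (if i = 0 then {b, c, d} else if i = 1 then {a, c, d}
    else if i = 2 then {a, d, b} else {a, b, c}))"
  \<comment> \<open>The factor \<open>sgn \<Delta>\<close> is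
    \<open>\<bar>\<Delta>\<bar> / \<Delta>\<close>: absolute value from the change of variables,
    denominator from \<open>cross_dual_basis\<close>.\<close>
  define \<kappa> where "\<kappa> = (\<lambda>i::nat. if i = 0 then sgn \<Delta> * k0 else if i = 1 then - sgn \<Delta> * k1
    else if i = 2 then - sgn \<Delta> * k2 else - sgn \<Delta> * k3)"
  have "f i face_of K" "2 simplex f i" for i
    using simplex_face[OF C(1) \<open>finite C\<close>, of _ 2] ne
    unfolding f_def C(3) by (auto simp: abcd)
  moreover have "integral K (partial j F) = (\<Sum>i<4. \<kappa> i * (face_normal (f i) $ j * face_integral
      (f i) F))"
    if F: "C_k (Suc 0) F" for F j
  proof -
    have cF: "continuous_on UNIV F" using C_k_continuous[OF F] .
    note perm = triangle_integral_perm(1)[OF cF]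
    have int: "dir_deriv v F integrable_on K" for v
    proof (rule compact_integrable)
      show "compact K" using C \<open>finite C\<close> by (simp add: finite_imp_compact_convex_hull)
    qed (rule continuous_on_dir_deriv[OF F])
    have P: "integral K (dir_deriv p F) = \<bar>\<Delta>\<bar> * (triangle_integral b c d F - triangle_integral a c d
        F)"
      using integral_tetrahedron_dir_deriv[OF F, of a b c d] C abcd
          unfolding p_def q_def r_def \<Delta>_def by simp
    \<comment> \<open>The derivatives along q and r are the first case after cyclic relabelling of
      b, c, d, which keeps the triple product.\<close>
    have Q: "integral K (dir_deriv q F) = \<bar>\<Delta>\<bar> * (triangle_integral b c d F - triangle_integral a d b
        F)"
    proof -
      have "convex hull {a, c, d, b} = K" using C abcd by (simp add: insert_commute)
      moreover have "q \<bullet> cross3 r p = \<Delta>" unfolding \<Delta>_def by (simp add: cross3_simps)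
      moreover have "triangle_integral c d b F = triangle_integral b c d F"
        by (rule perm) (use ne in auto)
      ultimately show ?thesis using integral_tetrahedron_dir_deriv[OF F, of a c d b]
        unfolding p_def q_def r_def by simp
    qed
    have R: "integral K (dir_deriv r F) = \<bar>\<Delta>\<bar> * (triangle_integral b c d F - triangle_integral a b c
        F)"
    proof -
      have "convex hull {a, d, b, c} = K" using C abcd by (simp add: insert_commute)
      moreover have "r \<bullet> cross3 p q = \<Delta>" unfolding \<Delta>_def by (simp add: cross3_simps)
      moreover have "triangle_integral d b c F = triangle_integral b c d F"
        by (rule perm) (use ne in auto)
      ultimately show ?thesis using integral_tetrahedron_dir_deriv[OF F, of a d b c]
        unfolding p_def q_def r_def by simp
    qed
    have "\<Delta> * partial j F x = cross3 q r $ j * dir_deriv p F x + cross3 r p $ j * dir_deriv q F x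
        + cross3 p q $ j * dir_deriv r F x" for x
    proof -
      have "\<Delta> * partial j F x = (\<Sum>k\<in>UNIV. (\<Delta> * (axis j 1 :: vec3) $ k) * partial k F x)"
        by (simp add: axis_def if_distrib[of "\<lambda>c. c * _"] if_distrib[of "\<lambda>c. _ * c"] sum.delta cong:
            if_cong)
      also have "\<dots> = (\<Sum>k\<in>UNIV. cross3 q r $ j * (p $ k * partial k F x) + cross3 r p $ j * (q $ k *
          partial k F x)
          + cross3 p q $ j * (r $ k * partial k F x))"
        unfolding \<Delta>_def cross_dual_basis by (simp add: algebra_simps)
      finally show ?thesis by (simp add: dir_deriv_def sum.distrib sum_distrib_left)
    qed
    then have "integral K (\<lambda>x. \<Delta> * partial j F x) = integral K (\<lambda>x. cross3 q r $ j * dir_deriv p F x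
        + cross3 r p $ j * dir_deriv q F x + cross3 p q $ j * dir_deriv r F x)" by simp
    also have "\<dots> = cross3 q r $ j * integral K (dir_deriv p F) + cross3 r p $ j * integral K
        (dir_deriv q F)
        + cross3 p q $ j * integral K (dir_deriv r F)"
      using int by (simp add: Henstock_Kurzweil_Integration.integral_add integrable_on_mult_right
          integrable_add)
    also have "\<dots> = \<bar>\<Delta>\<bar> * ((cross3 q r + cross3 r p + cross3 p q) $ j * triangle_integral b c d F
        - cross3 q r $ j * triangle_integral a c d F - cross3 r p $ j * triangle_integral a d b F
        - cross3 p q $ j * triangle_integral a b c F)"
      unfolding P Q R by (simp add: algebra_simps)
    finally have "\<Delta> * integral K (partial j F) = \<bar>\<Delta>\<bar> * (cross3 (c - b) (d - b) $ j *
        triangle_integral b c d F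
        - cross3 q r $ j * triangle_integral a c d F - cross3 r p $ j * triangle_integral a d b F
        - cross3 p q $ j * triangle_integral a b c F)" unfolding m0 by simp
    then have "integral K (partial j F) = sgn \<Delta> * (cross3 (c - b) (d - b) $ j * triangle_integral b
        c d F
        - cross3 q r $ j * triangle_integral a c d F - cross3 r p $ j * triangle_integral a d b F
        - cross3 p q $ j * triangle_integral a b c F)"
      using \<Delta> unfolding abs_sgn mult.assoc by simp
    then show ?thesis
      unfolding k0[OF F] k1[OF F] k2[OF F] k3[OF F]
      by (simp add: f_def \<kappa>_def eval_nat_numeral algebra_simps)
  qed
  ultimately show ?thesis using that by blast
qed

text \<open>As for faces, the coefficient is the unknown sign of the chosen tangent.\<close>

lemma edge_flux:
  fixes x y :: vec3
  assumes "x \<noteq> y"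
  obtains \<kappa> where "\<And>F :: vec3 \<Rightarrow> vec3. integral {0..1} (\<lambda>s. F (x + s *\<^sub>R (y - x)) \<bullet> (y - x)) =
    \<kappa> * edge_integral (convex hull {x, y}) (\<lambda>z. edge_tangent (convex hull {x, y}) \<bullet> F z)"
proof
  fix F :: "vec3 \<Rightarrow> vec3"
  let ?e = "convex hull {x, y}"
  have e: "1 simplex ?e" using assms by (auto simp: simplex_def affine_independent_2 intro!: exI[of
      _ "{x, y}"])
  have "x \<in> ?e" "y \<in> ?e" by (simp_all add: hull_inc)
  from edge_tangent_parallel[OF e this] obtain k where k: "y - x = k *\<^sub>R edge_tangent ?e"
    and k_def: "k = (y - x) \<bullet> edge_tangent ?e" by blast
  have "F z \<bullet> (y - x) = k * (edge_tangent ?e \<bullet> F z)" for z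
    by (simp add: k inner_commute)
  then show "integral {0..1} (\<lambda>s. F (x + s *\<^sub>R (y - x)) \<bullet> (y - x)) =
    ((y - x) \<bullet> edge_tangent ?e) / norm (y - x) * edge_integral ?e (\<lambda>z. edge_tangent ?e \<bullet> F z)"
    unfolding edge_integral_eq[OF assms] k_def[symmetric] using assms by simp
qed

definition curl_vec :: "(vec3 \<Rightarrow> vec3) \<Rightarrow> vec3 \<Rightarrow> vec3" where
  "curl_vec F x = (\<Sum>j\<in>UNIV. cross3 (axis j 1) (partial j F x))"

lemma partial_inner:
  assumes "C_k (Suc 0) F"
  shows "partial k (\<lambda>x. F x \<bullet> u) x = partial k F x \<bullet> u"
  using partial_bounded_linear[OF bounded_linear_inner_left C_k_Suc_differentiable[OF assms]] .

text \<open>The normal component of the curl only involves derivatives along the two sides, and each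
  of them can be integrated over the triangle.\<close>

lemma cross_inner_curl_vec:
  assumes F: "C_k (Suc 0) F"
  shows "cross3 p q \<bullet> curl_vec F x = dir_deriv p (\<lambda>x. F x \<bullet> q) x - dir_deriv q (\<lambda>x. F x \<bullet> p) x"
proof -
  have "cross3 p q \<bullet> cross3 (axis j 1) w = p $ j * (w \<bullet> q) - q $ j * (w \<bullet> p)" for j w
    using exhaust_3[of j] by (elim disjE) (simp_all add: cross3_simps axis_def)
  then show ?thesis
    by (simp add: curl_vec_def inner_sum_right dir_deriv_def partial_inner[OF F] sum_subtractf)
qed

lemma C_k_inner: "C_k k F \<Longrightarrow> C_k k (\<lambda>x. F x \<bullet> u)"
  by (rule C_k_bounded_linear[OF bounded_linear_inner_left])

text \<open>Both directional derivatives leave a term on the edge bc, one with F . q and one with F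
  . p; their difference is the circulation along c - b.\<close>

lemma stokes_triangle:
  assumes "2 simplex f"
  obtains e :: "nat \<Rightarrow> vec3 set" and \<kappa> :: "nat \<Rightarrow> real"
  where "\<And>i. i < 3 \<Longrightarrow> e i face_of f" "\<And>i. i < 3 \<Longrightarrow> 1 simplex e i"
    "\<And>F. C_k (Suc 0) F \<Longrightarrow> face_integral f (\<lambda>x. face_normal f \<bullet> curl_vec F x) =
      (\<Sum>i<3. \<kappa> i * edge_integral (e i) (\<lambda>x. edge_tangent (e i) \<bullet> F x))"
proof -
  obtain a b c where abc: "\<not> collinear {a, b, c}" "f = convex hull {a, b, c}"
    using triangle_vertices[OF assms] .
  have ind: "\<not> affine_dependent {a, b, c}" and ne: "a \<noteq> b" "a \<noteq> c" "b \<noteq> c"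
    using abc(1) by (auto simp: collinear_3_eq_affine_dependent)
  define p q where "p = b - a" and "q = c - a"
  define m where "m = cross3 p q"
  have m: "m \<noteq> 0" using abc(1) cross_eq_0_collinear unfolding m_def p_def q_def by simp
  have "a \<in> f" "b \<in> f" "c \<in> f" unfolding abc(2) by (simp_all add: hull_inc)
  from cross_face_normal[OF assms this]
  have mn: "m = (m \<bullet> face_normal f) *\<^sub>R face_normal f" unfolding m_def p_def q_def .
  define k where "k = m \<bullet> face_normal f"
  have k: "k \<noteq> 0" using mn m unfolding k_def by auto
  have n: "face_normal f = (1 / k) *\<^sub>R m" using mn k unfolding k_def[symmetric] by simp
  obtain k0 where k0: "\<And>F :: vec3 \<Rightarrow> vec3. integral {0..1} (\<lambda>s. F (b + s *\<^sub>R (c - b)) \<bullet> (c - b)) =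
    k0 * edge_integral (convex hull {b, c}) (\<lambda>z. edge_tangent (convex hull {b, c}) \<bullet> F z)"
    using edge_flux[OF ne(3)] by blast
  obtain k1 where k1: "\<And>F :: vec3 \<Rightarrow> vec3. integral {0..1} (\<lambda>s. F (a + s *\<^sub>R (c - a)) \<bullet> (c - a)) =
    k1 * edge_integral (convex hull {a, c}) (\<lambda>z. edge_tangent (convex hull {a, c}) \<bullet> F z)"
    using edge_flux[OF ne(2)] by blast
  obtain k2 where k2: "\<And>F :: vec3 \<Rightarrow> vec3. integral {0..1} (\<lambda>s. F (a + s *\<^sub>R (b - a)) \<bullet> (b - a)) =
    k2 * edge_integral (convex hull {a, b}) (\<lambda>z. edge_tangent (convex hull {a, b}) \<bullet> F z)"
    using edge_flux[OF ne(1)] by blast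
  define e where "e = (\<lambda>i::nat. convex hull (if i = 0 then {b, c} else if i =
      1 then {a, c} else {a, b}))"
  \<comment> \<open>The quotient \<open>norm m / k\<close> is 1 or -1: the orientation of a, b, c
    relative to the chosen face normal.\<close>
  define \<kappa> where "\<kappa> = (\<lambda>i::nat. (norm m / k) * (if i = 0 then k0 else if i = 1 then - k1 else k2))"
  have "e i face_of f" "1 simplex e i" for i
    using simplex_face[OF ind, of _ 1] ne unfolding e_def abc(2) by auto
  moreover have "face_integral f (\<lambda>x. face_normal f \<bullet> curl_vec F x) =
      (\<Sum>i<3. \<kappa> i * edge_integral (e i) (\<lambda>x. edge_tangent (e i) \<bullet> F x))"
    if F: "C_k (Suc 0) F" for F
  proof -
    have cF: "continuous_on S F" for S using C_k_continuous[OF F] .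
    have cont: "continuous_on {0..1} (\<lambda>s::real. F (u + s *\<^sub>R v) \<bullet> w)" for u v w
      by (intro continuous_intros continuous_on_compose2[OF cF[of UNIV]]) auto
    have "continuous_on UNIV (\<lambda>x. cross3 p q \<bullet> curl_vec F x)"
      unfolding cross_inner_curl_vec[OF F]
      by (intro continuous_intros continuous_on_dir_deriv C_k_inner F)
    then have cc: "continuous_on UNIV (\<lambda>x. face_normal f \<bullet> curl_vec F x)"
      unfolding n m_def using k by (auto intro!: continuous_intros)
    let ?X = "\<lambda>r s. a + r *\<^sub>R p + s *\<^sub>R q"
    have int: "(\<lambda>(r, s). dir_deriv v (\<lambda>x. F x \<bullet> w) (?X r s)) integrable_on std_triangle" for v w
      by (intro compact_integrable compact_std_triangle continuous_on_triangle_param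
          continuous_on_dir_deriv C_k_inner F)
    have "face_integral f (\<lambda>x. face_normal f \<bullet> curl_vec F x) =
      norm m * integral std_triangle (\<lambda>(r, s). (1 / k) * (cross3 p q \<bullet> curl_vec F (?X r s)))"
      using face_integral_eq[OF abc(1) cc] unfolding triangle_integral_def n abc(2)
      by (simp add: m_def p_def q_def n[unfolded abc(2)])
    also have "\<dots> = norm m * integral std_triangle (\<lambda>x. (1 / k) * ((\<lambda>(r, s). dir_deriv p (\<lambda>x. F x \<bullet>
        q) (?X r s)) x
        - (\<lambda>(r, s). dir_deriv q (\<lambda>x. F x \<bullet> p) (?X r s)) x))"
      unfolding cross_inner_curl_vec[OF F] by (simp add: case_prod_unfold)
    also have "\<dots> = (norm m / k) * (integral std_triangle (\<lambda>(r, s). dir_deriv p (\<lambda>x. F x \<bullet> q) (?X r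
        s))
        - integral std_triangle (\<lambda>(r, s). dir_deriv q (\<lambda>x. F x \<bullet> p) (?X r s)))"
      by (simp only: integral_mult_right Henstock_Kurzweil_Integration.integral_diff[OF int int])
          simp
    also have "integral std_triangle (\<lambda>(r, s). dir_deriv q (\<lambda>x. F x \<bullet> p) (?X r s)) =
        integral {0..1} (\<lambda>s. F (c + s *\<^sub>R (b - c)) \<bullet> p) - integral {0..1} (\<lambda>s. F (a + s *\<^sub>R p) \<bullet> p)"
      using integral_triangle_dir_deriv[OF C_k_inner[OF F], of q p a p]
      by (simp add: p_def q_def algebra_simps)
    also have "integral {0..1} (\<lambda>s. F (c + s *\<^sub>R (b - c)) \<bullet> p) =
        integral {0..1} (\<lambda>s. F (b + s *\<^sub>R (c - b)) \<bullet> p)"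
    proof -
      have "b + (1 - s) *\<^sub>R (c - b) = c + s *\<^sub>R (b - c)" for s by (simp add: algebra_simps)
      then show ?thesis using integral_reflect_Icc[of 1 "\<lambda>s. F (b + s *\<^sub>R (c - b)) \<bullet> p"] by simp
    qed
    \<comment> \<open>Here the first parameter has to be integrated out, so the coordinates of the
      reference triangle are swapped beforehand.\<close>
    also have "integral std_triangle (\<lambda>(r, s). dir_deriv p (\<lambda>x. F x \<bullet> q) (?X r s)) =
        integral {0..1} (\<lambda>s. F (b + s *\<^sub>R (c - b)) \<bullet> q) - integral {0..1} (\<lambda>s. F (a + s *\<^sub>R q) \<bullet> q)"
    proof -
      have c: "continuous_on std_triangle (\<lambda>(r, s). dir_deriv p (\<lambda>x. F x \<bullet> q) (?X r s))"
        by (intro continuous_on_triangle_param continuous_on_dir_deriv C_k_inner F)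
      have "integral std_triangle (\<lambda>(r, s). dir_deriv p (\<lambda>x. F x \<bullet> q) (?X s r)) =
          integral std_triangle (\<lambda>(r, s). dir_deriv p (\<lambda>x. F x \<bullet> q) (?X r s))"
        using std_triangle_swap[OF c] by simp
      then show ?thesis
        using integral_triangle_dir_deriv[OF C_k_inner[OF F], of p q a q]
        by (simp add: p_def q_def)
    qed
    finally have "face_integral f (\<lambda>x. face_normal f \<bullet> curl_vec F x) = (norm m / k) *
        ((integral {0..1} (\<lambda>s. F (b + s *\<^sub>R (c - b)) \<bullet> q) - integral {0..1} (\<lambda>s. F (b + s *\<^sub>R
            (c - b)) \<bullet> p))
         - integral {0..1} (\<lambda>s. F (a + s *\<^sub>R (c - a)) \<bullet> (c - a)) + integral {0..1} (\<lambda>s. F (a + s *\<^sub>R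
             (b - a)) \<bullet> (b - a)))"
      by (simp add: p_def q_def)
    also have "integral {0..1} (\<lambda>s. F (b + s *\<^sub>R (c - b)) \<bullet> q) - integral {0..1} (\<lambda>s. F (b + s *\<^sub>R
        (c - b)) \<bullet> p)
        = integral {0..1} (\<lambda>s. F (b + s *\<^sub>R (c - b)) \<bullet> (c - b))"
    proof -
      have "c - b = q - p" by (simp add: p_def q_def)
      then show ?thesis
        by (simp only: inner_diff_right
          Henstock_Kurzweil_Integration.integral_diff[OF integrable_continuous_interval[OF cont]
              integrable_continuous_interval[OF cont]])
    qed
    finally show ?thesis
      unfolding k0 k1 k2 by (simp add: e_def \<kappa>_def eval_nat_numeral algebra_simps)
  qed
  ultimately show ?thesis using that by blast
qed

lemma ftc_edge:
  assumes "1 simplex e"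
  obtains a b :: vec3 and \<kappa> :: real where "{a} face_of e" "{b} face_of e"
    "\<And>F. C_k (Suc 0) F \<Longrightarrow> edge_integral e (dir_deriv (edge_tangent e) F) = \<kappa> * (F b - F a)"
proof -
  obtain a b where ab: "a \<noteq> b" "e = convex hull {a, b}" using segment_vertices[OF assms] .
  define k where "k = (b - a) \<bullet> edge_tangent e"
  have "a \<in> e" "b \<in> e" unfolding ab(2) by (simp_all add: hull_inc)
  from edge_tangent_parallel[OF assms this]
  have t: "b - a = k *\<^sub>R edge_tangent e" unfolding k_def .
  then have k: "k \<noteq> 0" using ab(1) by auto
  have dd: "dir_deriv (edge_tangent e) F x = (1 / k) * dir_deriv (b - a) F x" for F x
    unfolding t dir_deriv_def using k by (simp add: sum_distrib_left)
  have "{a} face_of e" "{b} face_of e"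
    using simplex_face(1)[OF affine_independent_2[of a b], of "{a}" 0] simplex_face(1)[OF
        affine_independent_2[of a b], of "{b}" 0]
    by (simp_all add: ab(2))
  moreover have "edge_integral e (dir_deriv (edge_tangent e) F) = (norm (b - a) / k) * (F b - F a)"
    if "C_k (Suc 0) F" for F
    unfolding ab(2) edge_integral_eq[OF ab(1)]
    unfolding ab(2)[symmetric] dd integral_mult_right integral_segment_dir_deriv[OF that] by simp
  ultimately show ?thesis using that by blast
qed

section \<open>Distributions\<close>

text \<open>Linear functionals on the test functions, extended by 0. Linearity yields
  \<open>T (\<lambda>x. 0) = 0\<close> and lets scalars pass through; the value 0 elsewhere turns
  agreement on tests into equality.\<close>

definition distrs :: "vec3 set \<Rightarrow> 'b::euclidean_space distr set" where
  "distrs \<Omega> = {T. (\<forall>\<phi>. \<phi> \<notin> test_functions \<Omega> \<longrightarrow> T \<phi> = 0) \<and>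
    (\<forall>\<phi>\<in>test_functions \<Omega>. \<forall>\<psi>\<in>test_functions \<Omega>. T (\<lambda>x. \<phi> x + \<psi> x) = T \<phi> + T \<psi>) \<and>
    (\<forall>\<phi>\<in>test_functions \<Omega>. \<forall>c. T (\<lambda>x. c *\<^sub>R \<phi> x) = c * T \<phi>)}"

lemma distrsD:
  assumes "T \<in> distrs \<Omega>"
  shows distrs_off: "\<phi> \<notin> test_functions \<Omega> \<Longrightarrow> T \<phi> = 0"
    and distrs_add: "\<phi> \<in> test_functions \<Omega> \<Longrightarrow> \<psi> \<in> test_functions \<Omega> \<Longrightarrow> T (\<lambda>x. \<phi> x + \<psi> x) = T \<phi> + T \<psi>"
    and distrs_scale: "\<phi> \<in> test_functions \<Omega> \<Longrightarrow> T (\<lambda>x. c *\<^sub>R \<phi> x) = c * T \<phi>"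
  using assms unfolding distrs_def by blast+

lemma distrs_zero:
  assumes "T \<in> distrs \<Omega>"
  shows "T (\<lambda>x. 0) = 0"
  using distrs_scale[OF assms test_functions_zero, of 0] by simp

lemma on_tests_distrs:
  assumes "\<And>\<phi> \<psi>. \<phi> \<in> test_functions \<Omega> \<Longrightarrow> \<psi> \<in> test_functions \<Omega> \<Longrightarrow> l (\<lambda>x. \<phi> x + \<psi> x) = l \<phi> + l \<psi>"
    and "\<And>\<phi> c. \<phi> \<in> test_functions \<Omega> \<Longrightarrow> l (\<lambda>x. c *\<^sub>R \<phi> x) = c * l \<phi>"
  shows "on_tests \<Omega> l \<in> distrs \<Omega>"
  unfolding distrs_def on_tests_def
  using assms by (simp add: test_functions_add test_functions_scaleR)

lemma subspace_distrs: "subspace (distrs \<Omega>)"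
  unfolding subspace_def distrs_def
  by (simp add: plus_fun_def zero_fun_def scaleR_fun_def algebra_simps)

lemma adjoint_linear_tests:
  fixes L :: "'a::euclidean_space \<Rightarrow> 'b::euclidean_space"
  shows "linear L \<Longrightarrow> \<phi> \<in> test_functions \<Omega> \<Longrightarrow> (\<lambda>x. adjoint L (\<phi> x)) \<in> test_functions \<Omega>"
  by (rule test_functions_linear) (auto intro: adjoint_linear)

lemma distrs_ops:
  shows "linear L \<Longrightarrow> T \<in> distrs \<Omega> \<Longrightarrow> pointwise \<Omega> L T \<in> distrs \<Omega>"
    and "v \<in> distrs \<Omega> \<Longrightarrow> grad_distr \<Omega> v \<in> distrs \<Omega>"
    and "W \<in> distrs \<Omega> \<Longrightarrow> curl_distr \<Omega> W \<in> distrs \<Omega>"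
    and "W \<in> distrs \<Omega> \<Longrightarrow> div_distr \<Omega> W \<in> distrs \<Omega>"
proof -
  have pdo_lin: "pdo M (\<lambda>x. \<phi> x + \<psi> x) = (\<lambda>x. pdo M \<phi> x + pdo M \<psi> x)"
    "pdo M (\<lambda>x. c *\<^sub>R \<phi> x) = (\<lambda>x. c *\<^sub>R pdo M \<phi> x)"
    if M: "\<And>j. linear (M j)" and t: "\<phi> \<in> test_functions \<Omega>" "\<psi> \<in> test_functions \<Omega>"
    for M :: "3 \<Rightarrow> 'x::euclidean_space \<Rightarrow> 'y::euclidean_space" and \<phi> \<psi> c
  proof -
    have "partial j (\<lambda>x. \<phi> x + \<psi> x) x = partial j \<phi> x + partial j \<psi> x" for j x
      by (rule partial_add) (use t test_functionsD(4) in blast)+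
    then show "pdo M (\<lambda>x. \<phi> x + \<psi> x) = (\<lambda>x. pdo M \<phi> x + pdo M \<psi> x)"
      by (simp add: fun_eq_iff pdo_def linear_add[OF M] sum.distrib)
    have "partial j (\<lambda>x. c *\<^sub>R \<phi> x) x = c *\<^sub>R partial j \<phi> x" for j x
      by (rule partial_linear[OF _ t(1)]) (auto intro!: linearI simp: algebra_simps)
    then show "pdo M (\<lambda>x. c *\<^sub>R \<phi> x) = (\<lambda>x. c *\<^sub>R pdo M \<phi> x)"
      by (simp add: fun_eq_iff pdo_def linear_scale[OF M] scaleR_right.sum)
  qed
  show "pointwise \<Omega> L T \<in> distrs \<Omega>" if L: "linear L" and T: "T \<in> distrs \<Omega>"
    unfolding pointwise_def
    by (rule on_tests_distrs)
      (simp_all add: linear_add[OF adjoint_linear[OF L]] linear_scale[OF adjoint_linear[OF L]]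
        distrs_add[OF T] distrs_scale[OF T] adjoint_linear_tests[OF L])
  show "grad_distr \<Omega> v \<in> distrs \<Omega>" if T: "v \<in> distrs \<Omega>"
    unfolding grad_distr_def div_field_pdo
    by (rule on_tests_distrs)
      (simp_all add: pdo_lin linear_parts distrs_add[OF T] distrs_scale[OF T] test_functions_pdo)
  show "curl_distr \<Omega> W \<in> distrs \<Omega>" if T: "W \<in> distrs \<Omega>"
    unfolding curl_distr_def curl_field_pdo
    by (rule on_tests_distrs)
      (simp_all add: pdo_lin linear_parts distrs_add[OF T] distrs_scale[OF T] test_functions_pdo)
  show "div_distr \<Omega> W \<in> distrs \<Omega>" if T: "W \<in> distrs \<Omega>"
    unfolding div_distr_def grad_field_pdo
    by (rule on_tests_distrs)
      (simp_all add: pdo_lin linear_parts distrs_add[OF T] distrs_scale[OF T] test_functions_pdo)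
qed

text \<open>Linearity in the functional holds on the whole type, since each operator merely
  precomposes with a map of test functions. \<open>is_complex\<close> asks for linearity in this
  strong sense.\<close>

lemma linear_ops [simp]:
  "linear (pointwise \<Omega> L)" "linear (grad_distr \<Omega>)" "linear (curl_distr \<Omega>)" "linear (div_distr \<Omega>)"
  unfolding pointwise_def grad_distr_def curl_distr_def div_distr_def on_tests_def
  by (auto intro!: linearI simp: fun_eq_iff plus_fun_def scaleR_fun_def)

lemma linear_def_inc [simp]: "linear (def_distr \<Omega>)" "linear (inc_distr \<Omega>)"
  unfolding def_distr_def[abs_def] inc_distr_def[abs_def]
  by (auto intro!: linearI simp: linear_add linear_scale)

lemma curl_grad_distr: "T \<in> distrs \<Omega> \<Longrightarrow> curl_distr \<Omega> (grad_distr \<Omega> T) = 0"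
  by (auto simp: fun_eq_iff curl_distr_def grad_distr_def on_tests_def test_functions_fields
      div_curl_field distrs_zero)

lemma div_curl_distr: "T \<in> distrs \<Omega> \<Longrightarrow> div_distr \<Omega> (curl_distr \<Omega> T) = 0"
  by (auto simp: fun_eq_iff curl_distr_def div_distr_def on_tests_def test_functions_fields
      curl_grad_field distrs_zero)

lemma pdo_linear:
  fixes L :: "'a::euclidean_space \<Rightarrow> 'b::euclidean_space"
  assumes "linear L" "\<phi> \<in> test_functions \<Omega>"
  shows "pdo M (\<lambda>x. L (\<phi> x)) x = (\<Sum>j\<in>UNIV. M j (L (partial j \<phi> x)))"
  unfolding pdo_def partial_linear[OF assms] ..

text \<open>Dual to \<open>mskw_adj\<close> after curl being div after \<open>S_map\<close>, which
  is \<open>curl_field_S\<close> summed over the directions.\<close>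

lemma curl_mskw_distr:
  "curl_distr \<Omega> (pointwise \<Omega> mskw w) = - pointwise \<Omega> S_map (grad_distr \<Omega> w)"
proof -
  have "(\<lambda>x. mskw_adj (curl_field W x)) = div_field (\<lambda>x. S_map (W x))" if "W \<in> test_functions \<Omega>"
      for W
  proof
    fix x
    have "div_field (\<lambda>x. S_map (W x)) x = (\<Sum>j\<in>UNIV. div_part j (S_map (partial j W x)))"
      unfolding div_field_pdo by (rule pdo_linear[OF _ that]) simp
    then show "mskw_adj (curl_field W x) = div_field (\<lambda>x. S_map (W x)) x"
      by (simp add: curl_field_pdo pdo_def linear_sum curl_field_S)
  qed
  then show ?thesis
    by (auto simp: fun_eq_iff curl_distr_def grad_distr_def pointwise_def on_tests_def
        test_functions_fields test_functions_linear)
qed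

text \<open>The adjoint of \<open>vskw\<close> is half of \<open>mskw\<close>; the assumption on
  \<open>w\<close> serves to pull the resulting factor -1/2 out of the functional.\<close>

lemma div_S_distr:
  assumes "w \<in> distrs \<Omega>"
  shows "div_distr \<Omega> (pointwise \<Omega> S_map w) = 2 *\<^sub>R pointwise \<Omega> vskw (curl_distr \<Omega> w)"
proof -
  have eq: "curl_field (\<lambda>x. (1/2) *\<^sub>R mskw (v x)) = (\<lambda>x. (- (1/2)) *\<^sub>R S_map (grad_field v x))"
    if v: "v \<in> test_functions \<Omega>" for v
  proof -
    have "curl_field (\<lambda>x. (1/2) *\<^sub>R mskw (v x)) x = (\<Sum>j\<in>UNIV. curl_part j ((1/2) *\<^sub>R mskw (partial j
        v x)))" for x
      unfolding curl_field_pdo by (rule pdo_linear[OF _ v]) (rule linear_compose_scale_right, simp)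
    then show ?thesis
      by (simp add: fun_eq_iff grad_field_pdo pdo_def linear_sum
          linear_scale linear_parts curl_field_mskw sum_negf scaleR_right.sum)
  qed
  have lin: "linear (\<lambda>a. (1/2) *\<^sub>R mskw a)" by (rule linear_compose_scale_right) simp
  have "w (\<lambda>x. (- (1/2)) *\<^sub>R S_map (grad_field v x)) = (- (1/2)) * w (\<lambda>x. S_map (grad_field v x))"
    if v: "v \<in> test_functions \<Omega>" for v
    by (rule distrs_scale[OF assms]) (simp add: test_functions_linear test_functions_fields v)
  then show ?thesis
    by (auto simp: fun_eq_iff scaleR_fun_def div_distr_def curl_distr_def pointwise_def on_tests_def
        test_functions_fields test_functions_linear test_functions_linear[OF _ lin] eq)
qed

lemma pointwise_pointwise:
  fixes M :: "'a::euclidean_space \<Rightarrow> 'b::euclidean_space" and L :: "'b \<Rightarrow> 'c::euclidean_space"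
  assumes "linear L" "linear M" "T \<in> distrs \<Omega>"
  shows "pointwise \<Omega> L (pointwise \<Omega> M T) \<phi> = (if \<phi> \<in> test_functions \<Omega> then T (\<lambda>x. adjoint M (adjoint
      L (\<phi> x))) else 0)"
  using adjoint_linear_tests[OF assms(1), of \<phi> \<Omega>] by (simp add: pointwise_def on_tests_def)

lemma S_inv_S_distr: "w \<in> distrs \<Omega> \<Longrightarrow> pointwise \<Omega> S_inv (pointwise \<Omega> S_map w) = w"
  by (auto simp: fun_eq_iff pointwise_pointwise distrs_off)

lemma mskw_adj_mskw: "mskw_adj (mskw v) = 2 *\<^sub>R v"
  by (simp add: mskw_adj_def mskw_nth mat3_simps)

lemma mskw_distr_inj:
  assumes "w \<in> distrs \<Omega>" "pointwise \<Omega> mskw w = 0"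
  shows "w = 0"
proof -
  \<comment> \<open>Pointwise \<open>mskw_adj\<close> acts through its own adjoint and inverts
    \<open>mskw\<close> up to the factor 2.\<close>
  have "adjoint mskw_adj = mskw" by (metis adjoint_adjoint adjoints(1) linear_maps(1))
  then have "2 *\<^sub>R w = pointwise \<Omega> mskw_adj (pointwise \<Omega> mskw w)"
    using assms(1) by (auto simp: fun_eq_iff scaleR_fun_def pointwise_pointwise distrs_off
        mskw_adj_mskw distrs_scale)
  then show ?thesis using assms(2) by (simp add: linear_0)
qed

lemma symm_mskw_distr: "w \<in> distrs \<Omega> \<Longrightarrow> pointwise \<Omega> symm (pointwise \<Omega> mskw w) = 0"
proof -
  assume w: "w \<in> distrs \<Omega>"
  have "mskw_adj (symm A) = 0" for A
    by (simp add: mskw_adj_def symm_def mat3_simps)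
  then show ?thesis by (auto simp: fun_eq_iff pointwise_pointwise w distrs_zero[OF w])
qed

text \<open>On test fields, \<open>S_inv\<close> and transposition differ by a scalar multiple of
  the identity. The curl of such a field is skew, and a symmetric distribution does not see skew
  fields.\<close>

lemma S_inv_curl_symmetric:
  assumes \<sigma>: "pointwise \<Omega> symm \<sigma> = \<sigma>"
  shows "pointwise \<Omega> S_inv (curl_distr \<Omega> \<sigma>) = pointwise \<Omega> transpose (curl_distr \<Omega> \<sigma>)"
proof -
  have part: "symm (curl_part j (S_inv A)) = symm (curl_part j (transpose A))" for j A
    using exhaust_3[of j]
    by (auto simp: curl_part_def symm_def S_inv_def axis3 cross3_def mat3_simps field_simps)
  have "(\<lambda>x. symm (curl_field (\<lambda>x. S_inv (W x)) x)) = (\<lambda>x. symm (curl_field (\<lambda>x. transpose (W x))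
      x))"
    if "W \<in> test_functions \<Omega>" for W
  proof
    fix x
    have "curl_field (\<lambda>x. S_inv (W x)) x = (\<Sum>j\<in>UNIV. curl_part j (S_inv (partial j W x)))"
      unfolding curl_field_pdo by (rule pdo_linear[OF _ that]) simp
    moreover have "curl_field (\<lambda>x. transpose (W x)) x =
        (\<Sum>j\<in>UNIV. curl_part j (transpose (partial j W x)))"
      unfolding curl_field_pdo by (rule pdo_linear[OF _ that]) simp
    ultimately show "symm (curl_field (\<lambda>x. S_inv (W x)) x) = symm (curl_field (\<lambda>x. transpose (W x))
        x)"
      by (simp add: linear_sum part)
  qed
  moreover have "\<sigma> \<phi> = \<sigma> (\<lambda>x. symm (\<phi> x))" if "\<phi> \<in> test_functions \<Omega>" for \<phi>
    using that by (subst (1) \<sigma>[symmetric]) (simp add: pointwise_def on_tests_def)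
  ultimately have "\<sigma> (curl_field (\<lambda>x. S_inv (W x))) = \<sigma> (curl_field (\<lambda>x. transpose (W x)))"
    if "W \<in> test_functions \<Omega>" for W
    using that by (metis test_functions_fields(2) test_functions_linear linear_maps(4,6))
  then show ?thesis
    by (auto simp: fun_eq_iff pointwise_def curl_distr_def on_tests_def test_functions_linear)
qed

lemma pointwise_regular:
  "linear L \<Longrightarrow> pointwise \<Omega> L (regular \<Omega> u) = regular \<Omega> (\<lambda>x. L (u x))"
  for L :: "'a::euclidean_space \<Rightarrow> 'b::euclidean_space"
  by (auto simp: fun_eq_iff pointwise_def regular_def on_tests_def adjoint_linear_tests
      adjoint_works)

lemma pointwise_delta:
  fixes L :: "'a::euclidean_space \<Rightarrow> 'b::euclidean_space"
  assumes "linear L"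
  shows "pointwise \<Omega> L (delta_edge \<Omega> e a) = delta_edge \<Omega> e (L a)"
    "pointwise \<Omega> L (delta_face \<Omega> f a) = delta_face \<Omega> f (L a)"
  using assms by (auto simp: fun_eq_iff pointwise_def delta_edge_def delta_face_def on_tests_def
      adjoint_linear_tests adjoint_works)

section \<open>Linearity, locality and positivity of edge and face integrals\<close>

lemma edge_integral_linear:
  fixes g h :: "vec3 \<Rightarrow> real"
  assumes e: "1 simplex e"
  shows "continuous_on UNIV g \<Longrightarrow> continuous_on UNIV h \<Longrightarrow>
      edge_integral e (\<lambda>x. g x + h x) = edge_integral e g + edge_integral e h"
    and "edge_integral e (\<lambda>x. c * g x) = c * edge_integral e g"
    and "(\<And>x. x \<in> e \<Longrightarrow> g x = h x) \<Longrightarrow> edge_integral e g = edge_integral e h"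
proof -
  obtain a b where ab: "a \<noteq> b" "e = convex hull {a, b}" using segment_vertices[OF e] .
  have int: "(\<lambda>r. g (a + r *\<^sub>R (b - a))) integrable_on {0..1}" if "continuous_on UNIV g"
      for g :: "vec3 \<Rightarrow> real"
    by (intro integrable_continuous_interval continuous_on_compose2[OF that])
        (auto intro!: continuous_intros)
  show "edge_integral e (\<lambda>x. g x + h x) = edge_integral e g + edge_integral e h"
    if "continuous_on UNIV g" "continuous_on UNIV h"
    unfolding ab(2) edge_integral_eq[OF ab(1)] Henstock_Kurzweil_Integration.integral_add[OF int[OF
        that(1)] int[OF that(2)]]
    by (simp add: algebra_simps)
  show "edge_integral e (\<lambda>x. c * g x) = c * edge_integral e g"
    unfolding ab(2) edge_integral_eq[OF ab(1)] by simp
  have mem: "a + r *\<^sub>R (b - a) \<in> e" if "0 \<le> r" "r \<le> 1" for r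
    unfolding ab(2) convex_hull_2_alt using that by blast
  show "edge_integral e g = edge_integral e h" if "\<And>x. x \<in> e \<Longrightarrow> g x = h x"
  proof -
    have "integral {0..1} (\<lambda>r. g (a + r *\<^sub>R (b - a))) = integral {0..1} (\<lambda>r. h (a + r *\<^sub>R (b - a)))"
      by (rule Henstock_Kurzweil_Integration.integral_cong) (simp add: that mem)
    then show ?thesis unfolding ab(2) edge_integral_eq[OF ab(1)] by simp
  qed
qed

lemma edge_integral_pos:
  assumes e: "1 simplex e" and g: "continuous_on UNIV g" "\<And>x. 0 \<le> g x" "x \<in> e" "0 < g x"
  shows "0 < edge_integral e g"
proof -
  obtain a b where ab: "a \<noteq> b" "e = convex hull {a, b}" using segment_vertices[OF e] .
  let ?h = "\<lambda>r. g (a + r *\<^sub>R (b - a))"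
  have h: "continuous_on {0..1} ?h"
    by (intro continuous_on_compose2[OF g(1)]) (auto intro!: continuous_intros)
  obtain r where "0 \<le> r" "r \<le> 1" "x = a + r *\<^sub>R (b - a)"
    using g(3) unfolding ab(2) convex_hull_2_alt by blast
  then have r: "r \<in> {0..1}" "?h r \<noteq> 0" using g(4) by auto
  have "integral {0..1} ?h \<noteq> 0"
    using integral_eq_0_iff[OF h] g(2) r by (metis zero_less_one)
  moreover have "0 \<le> integral {0..1} ?h"
    using Henstock_Kurzweil_Integration.integral_nonneg[OF integrable_continuous_interval[OF h]]
        g(2) by blast
  ultimately show ?thesis unfolding ab(2) edge_integral_eq[OF ab(1)] using ab(1) by simp
qed

lemma triangle_point: "0 \<le> r \<Longrightarrow> 0 \<le> s \<Longrightarrow> r + s \<le> 1 \<Longrightarrow> a + r *\<^sub>R (b - a) + s *\<^sub>R (c - a) \<in> convex hull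
    {a, b, c}"
  unfolding convex_hull_3_alt by blast

lemma face_integral_linear:
  fixes g h :: "vec3 \<Rightarrow> real"
  assumes f: "2 simplex f"
  shows "continuous_on UNIV g \<Longrightarrow> continuous_on UNIV h \<Longrightarrow>
      face_integral f (\<lambda>x. g x + h x) = face_integral f g + face_integral f h"
    and "continuous_on UNIV g \<Longrightarrow> face_integral f (\<lambda>x. c * g x) = c * face_integral f g"
    and "(\<And>x. x \<in> f \<Longrightarrow> g x = h x) \<Longrightarrow> face_integral f g = face_integral f h"
proof -
  obtain a b c where abc: "\<not> collinear {a, b, c}" "f = convex hull {a, b, c}"
    using triangle_vertices[OF f] .
  have int: "(\<lambda>(r, s). g (a + r *\<^sub>R (b - a) + s *\<^sub>R (c - a))) integrable_on std_triangle"
      if "continuous_on UNIV g" for g :: "vec3 \<Rightarrow> real"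
    by (intro compact_integrable compact_std_triangle continuous_on_triangle_param that)
  show "face_integral f (\<lambda>x. g x + h x) = face_integral f g + face_integral f h"
    if "continuous_on UNIV g" "continuous_on UNIV h"
  proof -
    have "triangle_integral a b c (\<lambda>x. g x + h x) = triangle_integral a b c g + triangle_integral a
        b c h"
      using Henstock_Kurzweil_Integration.integral_add[OF int[OF that(1)] int[OF that(2)]]
      unfolding triangle_integral_def by (simp add: case_prod_unfold)
    then show ?thesis
      unfolding abc(2) face_integral_eq[OF abc(1) that(1)] face_integral_eq[OF abc(1) that(2)]
        face_integral_eq[OF abc(1) continuous_on_add[OF that]]
      by (simp add: algebra_simps)
  qed
  show "face_integral f (\<lambda>x. c * g x) = c * face_integral f g" if "continuous_on UNIV g" for c
  proof -
    have "triangle_integral a b c' (\<lambda>x. c * g x) = c * triangle_integral a b c' g" for c'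
      unfolding triangle_integral_def by (simp add: case_prod_unfold)
    then show ?thesis
      unfolding abc(2) face_integral_eq[OF abc(1) that] face_integral_eq[OF abc(1)
          continuous_on_mult_left[OF that]]
      by simp
  qed
  show "face_integral f g = face_integral f h" if eq: "\<And>x. x \<in> f \<Longrightarrow> g x = h x"
  proof -
    \<comment> \<open>Locality is claimed without continuity, so \<open>face_integral_eq\<close> is
      not applicable and the vertices selected in the definition are used directly.\<close>
    define t where "t = (SOME (a', b', c'). \<not> collinear {a', b', c'} \<and> f =
        convex hull {a', b', c'})"
    obtain a' b' c' where t: "t = (a', b', c')" using prod_cases3 by blast
    have "case (a, b, c) of (a', b', c') \<Rightarrow> \<not> collinear {a', b', c'} \<and> f = convex hull {a', b', c'}"
      using abc by simp
    then have "case t of (a', b', c') \<Rightarrow> \<not> collinear {a', b', c'} \<and> f = convex hull {a', b', c'}"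
      unfolding t_def by (rule someI)
    then have f': "f = convex hull {a', b', c'}" by (simp add: t)
    have "integral std_triangle (\<lambda>(r, s). g (a' + r *\<^sub>R (b' - a') + s *\<^sub>R (c' - a'))) =
        integral std_triangle (\<lambda>(r, s). h (a' + r *\<^sub>R (b' - a') + s *\<^sub>R (c' - a')))"
      by (rule Henstock_Kurzweil_Integration.integral_cong)
        (auto simp: std_triangle_def f' intro!: eq triangle_point)
    then show ?thesis
      unfolding face_integral_def t_def[symmetric] t std_triangle_def[symmetric] by simp
  qed
qed

text \<open>The point \<open>w\<close> may lie on the boundary of the triangle. Moving it slightly
  towards the barycentre keeps the function positive and makes room for a box.\<close>

lemma std_triangle_integral_pos:
  assumes h: "continuous_on UNIV h" "\<And>q. 0 \<le> h q" "w \<in> std_triangle" "0 < h w"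
  shows "0 < integral std_triangle (h :: real \<times> real \<Rightarrow> real)"
proof -
  define q where "q \<eta> = (1 - \<eta>) *\<^sub>R w + \<eta> *\<^sub>R (1/3, 1/3)" for \<eta> :: real
  let ?U = "{q. 0 < fst q \<and> 0 < snd q \<and> fst q + snd q < 1} :: (real \<times> real) set"
  have "isCont q 0" unfolding q_def by (intro continuous_intros)
  moreover have "isCont h (q 0)" using h(1) continuous_on_eq_continuous_at[OF open_UNIV] by blast
  ultimately have "isCont (\<lambda>\<eta>. h (q \<eta>)) 0" by (rule isCont_o2)
  moreover have "q 0 = w" by (simp add: q_def prod_eq_iff)
  ultimately have "((\<lambda>\<eta>. h (q \<eta>)) \<longlongrightarrow> h w) (at 0)" unfolding isCont_def by metis
  then have "\<forall>\<^sub>F \<eta> in at 0. 0 < h (q \<eta>)" using h(4) order_tendstoD(1) by blast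
  then obtain \<delta> where \<delta>: "\<delta> > 0" "\<And>\<eta>. \<eta> \<noteq> 0 \<Longrightarrow> \<bar>\<eta>\<bar> < \<delta> \<Longrightarrow> 0 < h (q \<eta>)"
    unfolding eventually_at by (auto simp: dist_real_def)
  define \<eta> where "\<eta> = min (\<delta> / 2) (1 / 2)"
  have \<eta>: "0 < \<eta>" "\<eta> < 1" "0 < h (q \<eta>)" using \<delta> by (auto simp: \<eta>_def)
  have "0 \<le> (1 - \<eta>) * fst w" "0 \<le> (1 - \<eta>) * snd w" "(1 - \<eta>) * (fst w + snd w) \<le> (1 - \<eta>) * 1"
    using h(3) \<eta> by (auto simp: std_triangle_def intro!: mult_nonneg_nonneg mult_left_mono)
  then have qU: "q \<eta> \<in> ?U" using \<eta> by (auto simp: q_def algebra_simps)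
  let ?V = "?U \<inter> {x. h (q \<eta>) / 2 < h x}"
  have "open ?U" by (intro open_Collect_conj open_Collect_less continuous_intros)
  moreover have "open {x. h (q \<eta>) / 2 < h x}"
    by (intro open_Collect_less continuous_intros h(1))
  ultimately have "open ?V" by (rule open_Int)
  moreover have "q \<eta> \<in> ?V" using qU \<eta> by auto
  ultimately obtain a b where ab: "cbox a b \<subseteq> ?V" "q \<eta> \<in> box a b" "\<forall>i\<in>Basis. a \<bullet> i < b \<bullet> i"
    by (rule open_contains_cbox)
  have sub: "cbox a b \<subseteq> std_triangle" using ab(1) by (auto simp: std_triangle_def)
  have cont: "continuous_on S h" for S using h(1) continuous_on_subset by blast
  have "0 < measure lborel (cbox a b)" using ab(3) by (intro content_pos_lt) blast
  then have "0 < integral (cbox a b) (\<lambda>x. h (q \<eta>) / 2)" using \<eta> by simp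
  also have "\<dots> \<le> integral (cbox a b) h"
    by (rule integral_le) (use ab(1) in \<open>auto intro: less_imp_le integrable_continuous cont\<close>)
  also have "\<dots> \<le> integral std_triangle h"
    by (rule integral_subset_le[OF sub]) (use h(2) in \<open>auto intro: integrable_continuous
        compact_integrable compact_std_triangle cont\<close>)
  finally show ?thesis .
qed

lemma face_integral_pos:
  assumes f: "2 simplex f" and g: "continuous_on UNIV g" "\<And>x. 0 \<le> g x" "x \<in> f" "0 < g x"
  shows "0 < face_integral f g"
proof -
  obtain a b c where abc: "\<not> collinear {a, b, c}" "f = convex hull {a, b, c}"
    using triangle_vertices[OF f] .
  let ?h = "\<lambda>(r, s). g (a + r *\<^sub>R (b - a) + s *\<^sub>R (c - a))"
  obtain r s where rs: "0 \<le> r" "0 \<le> s" "r + s \<le> 1" "x = a + r *\<^sub>R (b - a) + s *\<^sub>R (c - a)"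
    using g(3) unfolding abc(2) convex_hull_3_alt by blast
  have "0 < integral std_triangle ?h"
    by (rule std_triangle_integral_pos[OF continuous_on_triangle_param[OF g(1)], where w="(r, s)"])
      (use g rs in \<open>auto simp: std_triangle_def\<close>)
  then show ?thesis
    unfolding abc(2) face_integral_eq[OF abc(1) g(1)] triangle_integral_def
    using abc(1) cross_eq_0_collinear[of b a c] by simp
qed

section \<open>Meshes\<close>

text \<open>The support is enclosed in one large tetrahedron with three edges along the axes, and
  the tetrahedron formula is applied: both faces that bound the fibres avoid the support.\<close>

lemma integral_partial_compact_support:
  fixes F :: "vec3 \<Rightarrow> real"
  assumes F: "C_k (Suc 0) F" and bd: "bounded {x. F x \<noteq> 0}"
  shows "(partial j F has_integral 0) UNIV"
proof -
  obtain B where B: "\<And>x. F x \<noteq> 0 \<Longrightarrow> norm x \<le> B" using bd by (auto simp: bounded_iff)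
  define R where "R = \<bar>B\<bar> + 1"
  have R: "R > 0" by (simp add: R_def)
  have zero: "F x = 0" if "\<bar>x $ i\<bar> \<ge> R" for x i
    using B[of x] component_le_norm_cart[of x i] that unfolding R_def by fastforce
  obtain k l where kl: "k \<noteq> j" "l \<noteq> j" "k \<noteq> l" and U: "UNIV = {j, k, l}"
  proof -
    have "\<exists>k l. k \<noteq> j \<and> l \<noteq> j \<and> k \<noteq> l \<and> (UNIV :: 3 set) = {j, k, l}"
      using exhaust_3[of j] UNIV_3
      by (elim disjE) (rule exI[of _ 2], rule exI[of _ 3], simp, rule exI[of _ 1], rule exI[of _ 3],
          force, rule exI[of _ 1], rule exI[of _ 2], force)
    then show ?thesis using that by blast
  qed
  \<comment> \<open>On the slanted face the coordinates sum to -3R + 6R = 3R, so one of them is at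
    least R; and the cube of half-width R fits inside because its coordinates sum to at most
    3R.\<close>
  define a :: vec3 where "a = (\<chi> i. - R)"
  define p q r :: vec3 where "p = (6 * R) *\<^sub>R axis j 1" and "q = (6 * R) *\<^sub>R axis k 1" and "r =
      (6 * R) *\<^sub>R axis l 1"
  let ?K = "convex hull {a, a + p, a + q, a + r}"
  have coord: "(a + t *\<^sub>R p + u *\<^sub>R q + v *\<^sub>R r) $ j = - R + t * (6 * R)"
    "(a + t *\<^sub>R p + u *\<^sub>R q + v *\<^sub>R r) $ k = - R + u * (6 * R)"
    "(a + t *\<^sub>R p + u *\<^sub>R q + v *\<^sub>R r) $ l = - R + v * (6 * R)" for t u v
    using kl by (auto simp: a_def p_def q_def r_def axis_def)
  have "triangle_integral (a + p) (a + q) (a + r) F = integral std_triangle (\<lambda>x. 0)"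
    unfolding triangle_integral_def
  proof (rule Henstock_Kurzweil_Integration.integral_cong, clarify)
    fix s t :: real assume st: "(s, t) \<in> std_triangle"
    let ?x = "a + (1 - s - t) *\<^sub>R p + s *\<^sub>R q + t *\<^sub>R r"
    have "?x = a + p + s *\<^sub>R (a + q - (a + p)) + t *\<^sub>R (a + r - (a + p))"
        by (simp add: algebra_simps)
    moreover have "F ?x = 0"
    proof -
      have "?x $ j + ?x $ k + ?x $ l = 3 * R" unfolding coord by (simp add: algebra_simps)
      then have "R \<le> ?x $ j \<or> R \<le> ?x $ k \<or> R \<le> ?x $ l" by linarith
      then show ?thesis using zero[of ?x j] zero[of ?x k] zero[of ?x l] by auto
    qed
    ultimately show "F (a + p + s *\<^sub>R (a + q - (a + p)) + t *\<^sub>R (a + r - (a + p))) = 0" by metis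
  qed
  moreover have "triangle_integral a (a + q) (a + r) F = integral std_triangle (\<lambda>x. 0)"
    unfolding triangle_integral_def
  proof (rule Henstock_Kurzweil_Integration.integral_cong, clarify)
    fix s t :: real
    have "(a + 0 *\<^sub>R p + s *\<^sub>R q + t *\<^sub>R r) $ j = - R" unfolding coord by simp
    then show "F (a + s *\<^sub>R (a + q - a) + t *\<^sub>R (a + r - a)) = 0"
      using zero[of "a + s *\<^sub>R q + t *\<^sub>R r" j] R by simp
  qed
  ultimately have 0: "integral ?K (dir_deriv p F) = 0"
    using integral_tetrahedron_dir_deriv[OF F, of a "a + p" "a + q" "a + r"] by simp
  have dd: "dir_deriv p F x = (6 * R) * partial j F x" for x
    by (simp add: dir_deriv_def p_def axis_def if_distrib[of "\<lambda>c. c * _"] if_distrib[of "\<lambda>c. _ * c"]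
        sum.delta cong: if_cong)
  have "compact ?K" by (simp add: finite_imp_compact_convex_hull)
  then have "(dir_deriv p F has_integral 0) ?K"
    using compact_integrable[OF _ continuous_on_dir_deriv[OF F]] 0 by (metis integrable_integral)
  then have "((\<lambda>x. (1 / (6 * R)) * dir_deriv p F x) has_integral (1 / (6 * R)) * 0) ?K"
    by (rule has_integral_mult_right)
  then have int: "(partial j F has_integral 0) ?K" using R by (simp add: dd)
  show ?thesis
  proof (rule has_integral_on_superset[OF int])
    fix x assume x: "x \<notin> ?K"
    have "\<exists>i. \<bar>x $ i\<bar> \<ge> R"
    proof (rule ccontr)
      assume "\<nexists>i. \<bar>x $ i\<bar> \<ge> R"
      then have lt: "\<bar>x $ i\<bar> < R" for i by (meson not_le)
      define c where "c i = (x $ i + R) / (6 * R)" for i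
      have c: "0 \<le> c i" for i using lt[of i] R by (simp add: c_def)
      have "c j + c k + c l = (x $ j + x $ k + x $ l + 3 * R) / (6 * R)"
        by (simp add: c_def add_divide_distrib)
      also have "\<dots> \<le> 1" using lt[of j] lt[of k] lt[of l] R by (simp add: divide_simps)
      finally have c1: "c j + c k + c l \<le> 1" .
      let ?y = "a + c j *\<^sub>R p + c k *\<^sub>R q + c l *\<^sub>R r"
      have y: "?y $ j = x $ j" "?y $ k = x $ k" "?y $ l = x $ l" unfolding coord using R
          by (simp_all add: c_def)
      have "?y $ i = x $ i" for i
      proof -
        have "i \<in> {j, k, l}" unfolding U[symmetric] by simp
        then show ?thesis using y by (elim insertE emptyE) simp_all
      qed
      then have "x = ?y" unfolding vec_eq_iff by simp
      also have "?y \<in> ?K"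
      proof -
        have "((c k, c l), c j) \<in> std_tetrahedron"
          using c[of j] c[of k] c[of l] c1 by (simp add: std_tetrahedron_def std_triangle_def)
        then show ?thesis
          unfolding tetrahedron_image
          by (rule image_eqI[OF _ imageI[OF imageI], rotated]) (simp add: add.assoc)
      qed
      finally show False using x by blast
    qed
    then obtain i where i: "\<bar>x $ i\<bar> \<ge> R" ..
    have "{y. F y \<noteq> 0} \<subseteq> {y. norm y \<le> B}" using B by blast
    then have "closure {y. F y \<noteq> 0} \<subseteq> {y. norm y \<le> B}"
      by (rule closure_minimal) (intro closed_Collect_le continuous_intros)
    moreover have "\<not> norm x \<le> B" using i component_le_norm_cart[of x i] unfolding R_def by linarith
    ultimately show "partial j F x = 0" using partial_eq_0[of x F j] by blast
  qed simp
qed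

locale mesh =
  fixes \<Omega> :: "vec3 set" and \<Delta> :: "vec3 set set"
  assumes dom: "polyhedral_domain \<Omega>" and tri: "triangulation_of \<Delta> \<Omega>"
begin

section \<open>Cells, skeleton and cellwise integration\<close>

lemma open_dom: "open \<Omega>" and interior_closure_dom: "interior (closure \<Omega>) = \<Omega>"
  using dom unfolding polyhedral_domain_def by auto

lemma frontier_dom: "frontier \<Omega> = closure \<Omega> - \<Omega>"
  using open_dom by (simp add: frontier_def interior_open)

lemma finite_mesh: "finite \<Delta>"
  and mesh_simplex: "S \<in> \<Delta> \<Longrightarrow> \<exists>n. n simplex S"
  and mesh_face: "S \<in> \<Delta> \<Longrightarrow> F face_of S \<Longrightarrow> F \<in> \<Delta>"
  and mesh_Int: "S \<in> \<Delta> \<Longrightarrow> S' \<in> \<Delta> \<Longrightarrow> (S \<inter> S') face_of S"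
  and mesh_Union: "\<Union>\<Delta> = closure \<Omega>"
  using tri unfolding triangulation_of_def simplicial_complex_def by blast+

lemma finite_cells: "finite (cells \<Delta>)"
  unfolding cells_def using finite_mesh by simp

lemma cellsD:
  assumes "K \<in> cells \<Delta>"
  shows "K \<in> \<Delta>" "3 simplex K" "compact K" "convex K" "interior K \<subseteq> \<Omega>"
proof -
  show K: "K \<in> \<Delta>" "3 simplex K" using assms unfolding cells_def by auto
  then show "compact K" "convex K" using compact_simplex convex_simplex by blast+
  have "K \<subseteq> closure \<Omega>" using K(1) mesh_Union by blast
  then show "interior K \<subseteq> \<Omega>" using interior_mono interior_closure_dom by blast
qed

lemma cells_disjoint:
  assumes "K \<in> cells \<Delta>" "K' \<in> cells \<Delta>" "x \<in> interior K" "x \<in> interior K'"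
  shows "K = K'"
proof -
  have sub: "L \<subseteq> L'" if "L \<in> cells \<Delta>" "L' \<in> cells \<Delta>" "x \<in> interior L" "x \<in> interior L'" for L L'
  proof (rule ccontr)
    assume "\<not> L \<subseteq> L'"
    then have "(L \<inter> L') \<inter> interior L = {}"
      using mesh_Int[OF cellsD(1)[OF that(1)] cellsD(1)[OF that(2)]]
      by (intro face_of_disjoint_interior) auto
    then show False using that(3,4) interior_subset by blast
  qed
  show ?thesis using sub[OF assms] sub[OF assms(2,1,4,3)] by blast
qed

text \<open>A point outside the open cells lies in some simplex but not in its interior: a simplex
  of lower dimension has empty interior. What remains is part of finitely many frontiers of convex
  sets.\<close>

lemma negligible_skeleton: "negligible (\<Omega> - (\<Union>K\<in>cells \<Delta>. interior K))"
proof (rule negligible_subset)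
  show "negligible (\<Union>S\<in>\<Delta>. S - interior S)"
  proof (rule negligible_Union, use finite_mesh in simp, clarify)
    fix S assume "S \<in> \<Delta>"
    then obtain n where "n simplex S" using mesh_simplex by blast
    then have "convex S" "closed S" using convex_simplex closed_simplex by blast+
    then show "negligible (S - interior S)"
      using negligible_convex_frontier[of S] by (simp add: frontier_def)
  qed
  show "\<Omega> - (\<Union>K\<in>cells \<Delta>. interior K) \<subseteq> (\<Union>S\<in>\<Delta>. S - interior S)"
  proof
    fix x assume x: "x \<in> \<Omega> - (\<Union>K\<in>cells \<Delta>. interior K)"
    then obtain S where S: "S \<in> \<Delta>" "x \<in> S" using closure_subset mesh_Union by blast
    have "x \<notin> interior S"
    proof (cases "3 simplex S")
      case True
      then show ?thesis using x S by (auto simp: cells_def)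
    next
      case False
      obtain n where n: "n simplex S" using mesh_simplex S by blast
      then have "aff_dim S \<noteq> 3" using aff_dim_simplex[OF n] False n by auto
      then have "interior S = {}" by (intro low_dim_interior) simp
      then show ?thesis by simp
    qed
    then show "x \<in> (\<Union>S\<in>\<Delta>. S - interior S)" using S by blast
  qed
qed

lemma cellwise_has_integral:
  fixes g :: "vec3 \<Rightarrow> real"
  assumes h: "\<And>K. K \<in> cells \<Delta> \<Longrightarrow> continuous_on UNIV (h K)"
    and g: "\<And>K x. K \<in> cells \<Delta> \<Longrightarrow> x \<in> interior K \<Longrightarrow> g x = h K x"
  shows "(g has_integral (\<Sum>K\<in>cells \<Delta>. integral K (h K))) \<Omega>"
proof -
  have "(g has_integral integral K (h K)) (interior K)" if K: "K \<in> cells \<Delta>" for K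
  proof -
    have "(h K has_integral integral K (h K)) K"
      using compact_integrable[OF cellsD(3)[OF K]] continuous_on_subset[OF h[OF K]]
      by (intro integrable_integral) blast
    moreover have "negligible (K - interior K)"
      using negligible_convex_frontier[OF cellsD(4)[OF K]] compact_imp_closed[OF cellsD(3)[OF K]]
      by (simp add: frontier_def)
    ultimately have "(h K has_integral integral K (h K)) (interior K)"
      by (subst has_integral_spike_set_eq[of _ K])
        (auto intro: negligible_subset dest: interior_subset[THEN subsetD])
    then show ?thesis by (rule has_integral_eq[rotated]) (simp add: g[OF K])
  qed
  then have "(g has_integral (\<Sum>K\<in>cells \<Delta>. integral K (h K))) (\<Union>K\<in>cells \<Delta>. interior K)"
  proof (rule has_integral_UN[OF finite_cells])
    show "pairwise (\<lambda>K K'. negligible (interior K \<inter> interior K')) (cells \<Delta>)"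
    proof (rule pairwiseI)
      fix K K' assume "K \<in> cells \<Delta>" "K' \<in> cells \<Delta>" "K \<noteq> K'"
      then have "interior K \<inter> interior K' = {}" using cells_disjoint by blast
      then show "negligible (interior K \<inter> interior K')" by simp
    qed
  qed
  then show ?thesis
  proof (rule has_integral_spike_set_eq[THEN iffD1, rotated 2])
    have "(\<Union>K\<in>cells \<Delta>. interior K) - \<Omega> = {}" using cellsD(5) by blast
    then have "{x \<in> (\<Union>K\<in>cells \<Delta>. interior K) - \<Omega>. g x \<noteq> 0} = {}" by blast
    then show "negligible {x \<in> (\<Union>K\<in>cells \<Delta>. interior K) - \<Omega>. g x \<noteq> 0}"
        by (simp only: negligible_empty)
    show "negligible {x \<in> \<Omega> - (\<Union>K\<in>cells \<Delta>. interior K). g x \<noteq> 0}"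
      by (rule negligible_subset[OF negligible_skeleton]) blast
  qed
qed

text \<open>\<open>h K\<close> represents \<open>u\<close> inside the cell \<open>K\<close> by a
  function continuous on the whole space, so integrals can be taken over the compact cell. It covers
  piecewise constant and piecewise affine fields alike.\<close>

definition cellwise :: "(vec3 \<Rightarrow> 'b::euclidean_space) \<Rightarrow> (vec3 set \<Rightarrow> vec3 \<Rightarrow> 'b) \<Rightarrow> bool" where
  "cellwise u h \<longleftrightarrow> (\<forall>K\<in>cells \<Delta>. continuous_on UNIV (h K) \<and> (\<forall>x\<in>interior K. u x = h K x))"

lemma cellwise_regular:
  assumes "cellwise u h" and \<phi>: "\<phi> \<in> test_functions \<Omega>"
  shows "((\<lambda>x. u x \<bullet> \<phi> x) has_integral regular \<Omega> u \<phi>) \<Omega>"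
    and "regular \<Omega> u \<phi> = (\<Sum>K\<in>cells \<Delta>. integral K (\<lambda>x. h K x \<bullet> \<phi> x))"
proof -
  have "((\<lambda>x. u x \<bullet> \<phi> x) has_integral (\<Sum>K\<in>cells \<Delta>. integral K (\<lambda>x. h K x \<bullet> \<phi> x))) \<Omega>"
    by (rule cellwise_has_integral)
      (use assms in \<open>auto simp: cellwise_def intro!: continuous_intros test_functionsD(5)[OF \<phi>]\<close>)
  then show "((\<lambda>x. u x \<bullet> \<phi> x) has_integral regular \<Omega> u \<phi>) \<Omega>"
    and "regular \<Omega> u \<phi> = (\<Sum>K\<in>cells \<Delta>. integral K (\<lambda>x. h K x \<bullet> \<phi> x))"
    using \<phi> by (simp_all add: regular_def on_tests_def integral_unique)
qed

lemma regular_linear: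
  fixes u v :: "vec3 \<Rightarrow> 'b::euclidean_space"
  assumes u: "cellwise u h" and v: "cellwise v k"
  shows "regular \<Omega> (\<lambda>x. u x + v x) = regular \<Omega> u + regular \<Omega> v"
    and "regular \<Omega> (\<lambda>x. c *\<^sub>R u x) = c *\<^sub>R regular \<Omega> u"
    and "regular \<Omega> u \<in> distrs \<Omega>"
proof -
  note U = cellwise_regular(1)[OF u] and V = cellwise_regular(1)[OF v]
  have "regular \<Omega> (\<lambda>x. u x + v x) \<phi> = regular \<Omega> u \<phi> + regular \<Omega> v \<phi>" for \<phi>
  proof (cases "\<phi> \<in> test_functions \<Omega>")
    case True
    from has_integral_add[OF U[OF True] V[OF True]] have "((\<lambda>x. (u x + v x) \<bullet> \<phi> x) has_integral
        regular \<Omega> u \<phi> + regular \<Omega> v \<phi>) \<Omega>" by (simp add: inner_add_left)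
    then show ?thesis using True by (simp add: regular_def[of _ "\<lambda>x. u x + v x"] on_tests_def
        integral_unique)
  qed (simp add: regular_def on_tests_def)
  then show "regular \<Omega> (\<lambda>x. u x + v x) = regular \<Omega> u + regular \<Omega> v" by (simp add: fun_eq_iff)
  have "regular \<Omega> (\<lambda>x. c *\<^sub>R u x) \<phi> = c * regular \<Omega> u \<phi>" for \<phi>
    by (simp add: regular_def on_tests_def)
  then show "regular \<Omega> (\<lambda>x. c *\<^sub>R u x) = c *\<^sub>R regular \<Omega> u" by (simp add: fun_eq_iff scaleR_fun_def)
  show "regular \<Omega> u \<in> distrs \<Omega>"
    unfolding regular_def
  proof (rule on_tests_distrs)
    fix \<phi> \<psi> :: "vec3 \<Rightarrow> 'b" assume t: "\<phi> \<in> test_functions \<Omega>" "\<psi> \<in> test_functions \<Omega>"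
    show "integral \<Omega> (\<lambda>x. u x \<bullet> (\<phi> x + \<psi> x)) = integral \<Omega> (\<lambda>x. u x \<bullet> \<phi> x) + integral \<Omega> (\<lambda>x. u x \<bullet> \<psi>
        x)"
      unfolding inner_add_right
      by (rule Henstock_Kurzweil_Integration.integral_add) (use U t in blast)+
  qed simp
qed

lemma piecewise_constant_cellwise:
  assumes "piecewise_constant \<Delta> u"
  obtains s where "cellwise u (\<lambda>K x. s K)"
proof -
  have "\<forall>K\<in>cells \<Delta>. \<exists>s. \<forall>x\<in>interior K. u x = s"
    using assms unfolding piecewise_constant_def constant_on_def by blast
  then obtain s where "\<forall>K\<in>cells \<Delta>. \<forall>x\<in>interior K. u x = s K" by metis
  then have "cellwise u (\<lambda>K x. s K)" by (simp add: cellwise_def)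
  then show ?thesis using that by blast
qed

lemma piecewise_affine_cellwise:
  assumes "piecewise_affine \<Delta> \<Omega> u"
  obtains A b where "\<And>K x. K \<in> cells \<Delta> \<Longrightarrow> x \<in> K \<Longrightarrow> x \<in> \<Omega> \<Longrightarrow> u x = A K *v x + b K"
    "cellwise u (\<lambda>K x. A K *v x + b K)"
proof -
  obtain A b where Ab: "\<And>K x. K \<in> cells \<Delta> \<Longrightarrow> x \<in> K \<Longrightarrow> x \<in> \<Omega> \<Longrightarrow> u x = A K *v x + b K"
    using assms unfolding piecewise_affine_def by (metis IntI)
  have "continuous_on UNIV (\<lambda>x. A K *v x + b K)" for K
    by (intro continuous_intros matrix_vector_mult_linear_continuous_on)
  then have "cellwise u (\<lambda>K x. A K *v x + b K)"
    unfolding cellwise_def using Ab cellsD(5) interior_subset by blast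
  then show ?thesis using that Ab by blast
qed

text \<open>A relative interior point of \<open>s\<close> lying in another n-simplex would make
  \<open>s\<close> a proper face of it, against equality of dimensions. So such a point inside the
  domain has positive distance from all other n-simplices.\<close>

lemma simplex_bump:
  assumes s: "s \<in> \<Delta>" "n simplex s" "\<not> s \<subseteq> frontier \<Omega>"
  obtains \<phi> :: "vec3 \<Rightarrow> real" and x where "\<phi> \<in> test_functions \<Omega>" "\<And>y. 0 \<le> \<phi> y" "x \<in> s" "0 < \<phi> x"
    "\<And>s' y. s' \<in> \<Delta> \<Longrightarrow> n simplex s' \<Longrightarrow> s' \<noteq> s \<Longrightarrow> y \<in> s' \<Longrightarrow> \<phi> y = 0"
proof -
  have "convex s" using convex_simplex[OF s(2)] .
  have "s \<subseteq> closure \<Omega>" using s(1) mesh_Union by blast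
  then obtain x0 where "x0 \<in> s" "x0 \<in> \<Omega>" using s(3) frontier_dom by blast
  \<comment> \<open>The domain is open and meets \<open>s\<close>, hence it also meets the dense
    relative interior of \<open>s\<close>.\<close>
  then have "\<Omega> \<inter> closure (rel_interior s) \<noteq> {}"
    using convex_closure_rel_interior[OF \<open>convex s\<close>] closure_subset by blast
  then obtain x where x: "x \<in> \<Omega>" "x \<in> rel_interior s"
    using open_Int_closure_eq_empty[OF open_dom] by blast
  define T where "T = \<Union>{s' \<in> \<Delta>. n simplex s' \<and> s' \<noteq> s}"
  have "closed T" unfolding T_def using finite_mesh closed_simplex by (intro closed_Union) auto
  have "x \<notin> T"
  proof
    assume "x \<in> T"
    then obtain s' where s': "s' \<in> \<Delta>" "n simplex s'" "s' \<noteq> s" "x \<in> s'" unfolding T_def by blast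
    have "x \<in> (s \<inter> s') \<inter> rel_interior s" using x(2) s'(4) rel_interior_subset by blast
    then have eq: "s \<inter> s' = s" using face_of_disjoint_rel_interior[OF mesh_Int[OF s(1) s'(1)]]
        by blast
    have "s face_of s'" using mesh_Int[OF s'(1) s(1)] eq by (simp add: Int_commute)
    then have "aff_dim s < aff_dim s'"
      using face_of_aff_dim_lt[OF convex_simplex[OF s'(2)]] s'(3) by blast
    then show False using aff_dim_simplex[OF s(2)] aff_dim_simplex[OF s'(2)] by simp
  qed
  then have "open (\<Omega> - T)" "x \<in> \<Omega> - T" using open_dom \<open>closed T\<close> x by auto
  then obtain r where r: "r > 0" "cball x r \<subseteq> \<Omega> - T" using open_contains_cball by blast
  obtain \<phi> :: "vec3 \<Rightarrow> real" where \<phi>: "\<And>k. C_k k \<phi>" "\<And>x. 0 \<le> \<phi> x" "\<phi> x > 0" "\<And>y. \<phi> y \<noteq> 0 \<Longrightarrow>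
      y \<in> ball x r"
    using bump_exists[OF r(1), of x] by blast
  have "{y. \<phi> y \<noteq> 0} \<subseteq> cball x r" using \<phi>(4) by force
  then have sub: "closure {y. \<phi> y \<noteq> 0} \<subseteq> cball x r" by (rule closure_minimal) simp
  have "compact (closure {y. \<phi> y \<noteq> 0})"
    using bounded_subset[OF bounded_cball sub] by (simp add: compact_eq_bounded_closed)
  then have "\<phi> \<in> test_functions \<Omega>" using \<phi>(1) sub r(2) unfolding test_functions_def by blast
  moreover have "\<phi> y = 0" if "s' \<in> \<Delta>" "n simplex s'" "s' \<noteq> s" "y \<in> s'" for s' y
  proof (rule ccontr)
    assume "\<phi> y \<noteq> 0"
    then have "y \<in> cball x r" using \<phi>(4) by force
    moreover have "y \<in> T" using that unfolding T_def by blast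
    ultimately show False using r(2) by blast
  qed
  ultimately show ?thesis using that[of \<phi> x] \<phi>(2,3) x(2) rel_interior_subset by blast
qed

section \<open>Incidence coefficients of faces and cells\<close>

definition faces :: "vec3 set set" where
  "faces = {f \<in> \<Delta>. 2 simplex f}"

lemma finite_faces: "finite faces"
  unfolding faces_def using finite_mesh by simp

text \<open>The four coefficients of a cell become a function on all faces that vanishes off the
  cell, so that contributions of different cells can be added over one index set.\<close>

lemma gauss_mesh:
  "\<exists>eps. \<forall>K\<in>cells \<Delta>. (\<forall>f. eps K f \<noteq> 0 \<longrightarrow> f face_of K) \<and>
    (\<forall>F j. C_k (Suc 0) F \<longrightarrow>
      integral K (partial j F) = (\<Sum>f\<in>faces. eps K f * (face_normal f $ j * face_integral f F)))"
proof -
  have "\<exists>e. (\<forall>f. e f \<noteq> 0 \<longrightarrow> f face_of K) \<and> (\<forall>F j. C_k (Suc 0) F \<longrightarrow>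
      integral K (partial j F) = (\<Sum>f\<in>faces. e f * (face_normal f $ j * face_integral f F)))"
    if K: "K \<in> cells \<Delta>" for K
  proof -
    obtain f :: "nat \<Rightarrow> vec3 set" and \<kappa> :: "nat \<Rightarrow> real"
      where f: "\<And>i. i < 4 \<Longrightarrow> f i face_of K" "\<And>i. i < 4 \<Longrightarrow> 2 simplex f i"
      and int: "\<And>F j. C_k (Suc 0) F \<Longrightarrow> integral K (partial j F) =
        (\<Sum>i<4. \<kappa> i * (face_normal (f i) $ j * face_integral (f i) F))"
      using gauss_tetrahedron[OF cellsD(2)[OF K]] by blast
    have mem: "f i \<in> faces" if "i < 4" for i
      using f[OF that] mesh_face[OF cellsD(1)[OF K]] by (simp add: faces_def)
    \<comment> \<open>Summing over the indices with \<open>f i = g\<close> avoids a proof that the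
      four faces are distinct.\<close>
    define e where "e g = (\<Sum>i<4. if f i = g then \<kappa> i else 0)" for g
    have "g face_of K" if "e g \<noteq> 0" for g
    proof -
      from that obtain i where "i \<in> {..<4}" "(if f i = g then \<kappa> i else 0) \<noteq> 0"
        unfolding e_def using sum.not_neutral_contains_not_neutral by blast
      then show ?thesis using f(1)[of i] by (auto split: if_splits)
    qed
    moreover have "(\<Sum>g\<in>faces. e g * X g) = (\<Sum>i<4. \<kappa> i * X (f i))" for X
    proof -
      have "(\<Sum>g\<in>faces. e g * X g) = (\<Sum>g\<in>faces. \<Sum>i<4. if g = f i then \<kappa> i * X g else 0)"
        unfolding e_def sum_distrib_right by (intro sum.cong refl) auto
      also have "\<dots> = (\<Sum>i<4. \<Sum>g\<in>faces. if g = f i then \<kappa> i * X g else 0)"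
        by (rule sum.swap)
      also have "\<dots> = (\<Sum>i<4. \<kappa> i * X (f i))"
        by (intro sum.cong refl) (simp add: sum.delta' finite_faces mem)
      finally show ?thesis .
    qed
    ultimately show ?thesis using int by (intro exI[of _ e]) simp
  qed
  then show ?thesis by (intro bchoice ballI)
qed

text \<open>Up to the sign of \<open>face_normal f\<close>, \<open>eps K f\<close> is the incidence number of \<open>f\<close> and \<open>K\<close>.\<close>

definition eps :: "vec3 set \<Rightarrow> vec3 set \<Rightarrow> real" where
  "eps = (SOME eps. \<forall>K\<in>cells \<Delta>. (\<forall>f. eps K f \<noteq> 0 \<longrightarrow> f face_of K) \<and>
    (\<forall>F j. C_k (Suc 0) F \<longrightarrow>
      integral K (partial j F) = (\<Sum>f\<in>faces. eps K f * (face_normal f $ j * face_integral f F))))"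

lemma eps_face: "K \<in> cells \<Delta> \<Longrightarrow> eps K f \<noteq> 0 \<Longrightarrow> f face_of K"
  and gauss_cell: "K \<in> cells \<Delta> \<Longrightarrow> C_k (Suc 0) F \<Longrightarrow>
    integral K (partial j F) = (\<Sum>f\<in>faces. eps K f * (face_normal f $ j * face_integral f F))"
  using someI_ex[OF gauss_mesh, folded eps_def] by blast+

lemma interior_facesD: "f \<in> interior_faces \<Delta> \<Omega> \<Longrightarrow> f \<in> \<Delta> \<and> 2 simplex f \<and> \<not> f \<subseteq> frontier \<Omega>"
  and interior_edgesD: "e \<in> interior_edges \<Delta> \<Omega> \<Longrightarrow> e \<in> \<Delta> \<and> 1 simplex e \<and> \<not> e \<subseteq> frontier \<Omega>"
  unfolding interior_faces_def interior_edges_def by auto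

lemma finite_interior: "finite (interior_faces \<Delta> \<Omega>)" "finite (interior_edges \<Delta> \<Omega>)"
  unfolding interior_faces_def interior_edges_def using finite_mesh by simp_all

lemma face_integral_boundary:
  assumes "f \<in> faces" "f \<notin> interior_faces \<Delta> \<Omega>" "\<And>x. x \<notin> \<Omega> \<Longrightarrow> g x = 0"
  shows "face_integral f g = 0"
proof -
  have f: "2 simplex f" "f \<subseteq> frontier \<Omega>" using assms(1,2) unfolding faces_def interior_faces_def
      by auto
  have "face_integral f g = face_integral f (\<lambda>x. 0 * g x)"
    by (rule face_integral_linear(3)[OF f(1)]) (use f(2) assms(3) frontier_dom in auto)
  also have "\<dots> = 0" using face_integral_linear(2)[OF f(1), of "\<lambda>x. 0" 0] by simp
  finally show ?thesis .
qed

lemma edge_integral_boundary: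
  assumes "e \<in> \<Delta>" "1 simplex e" "e \<notin> interior_edges \<Delta> \<Omega>" "\<And>x. x \<notin> \<Omega> \<Longrightarrow> g x = 0"
  shows "edge_integral e g = 0"
proof -
  have e: "e \<subseteq> frontier \<Omega>" using assms(1-3) unfolding interior_edges_def by auto
  have "edge_integral e g = edge_integral e (\<lambda>x. 0 * g x)"
    by (rule edge_integral_linear(3)[OF assms(2)]) (use e assms(4) frontier_dom in auto)
  also have "\<dots> = 0" using edge_integral_linear(2)[OF assms(2), of 0 g] by simp
  finally show ?thesis .
qed

text \<open>Test the divergence theorem on the whole domain with a bump function around the face.\<close>

lemma eps_sum:
  assumes f: "f \<in> interior_faces \<Delta> \<Omega>"
  shows "(\<Sum>K\<in>cells \<Delta>. eps K f) = 0"
proof -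
  have f': "f \<in> \<Delta>" "2 simplex f" "\<not> f \<subseteq> frontier \<Omega>" "f \<in> faces"
    using interior_facesD[OF f] by (auto simp: faces_def)
  obtain \<phi> :: "vec3 \<Rightarrow> real" and x where \<phi>: "\<phi> \<in> test_functions \<Omega>" "\<And>y. 0 \<le> \<phi> y" "x \<in> f" "0 < \<phi> x"
    "\<And>s' y. s' \<in> \<Delta> \<Longrightarrow> 2 simplex s' \<Longrightarrow> s' \<noteq> f \<Longrightarrow> y \<in> s' \<Longrightarrow> \<phi> y = 0"
    using simplex_bump[OF f'(1-3)] by blast
  have pos: "0 < face_integral f \<phi>"
    by (rule face_integral_pos[OF f'(2) test_functionsD(5)[OF \<phi>(1)] \<phi>(2,3,4)])
  have other: "face_integral g \<phi> = 0" if "g \<in> faces" "g \<noteq> f" for g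
  proof -
    have g: "g \<in> \<Delta>" "2 simplex g" using that by (auto simp: faces_def)
    have "face_integral g \<phi> = face_integral g (\<lambda>x. 0 * \<phi> x)"
      by (rule face_integral_linear(3)[OF g(2)]) (simp add: \<phi>(5)[OF g that(2)])
    also have "\<dots> = 0" using face_integral_linear(2)[OF g(2), of "\<lambda>x. 0" 0] by simp
    finally show ?thesis .
  qed
  have C1: "C_k (Suc 0) \<phi>" using test_functionsD(1)[OF \<phi>(1)] .
  have "(\<Sum>K\<in>cells \<Delta>. eps K f) * (face_normal f $ j * face_integral f \<phi>) = 0" for j
  proof -
    have "(partial j \<phi> has_integral (\<Sum>K\<in>cells \<Delta>. integral K (partial j \<phi>))) \<Omega>"
      by (rule cellwise_has_integral) (simp_all add: continuous_on_partial[OF C1])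
    then have "(partial j \<phi> has_integral (\<Sum>K\<in>cells \<Delta>. integral K (partial j \<phi>))) UNIV"
      by (rule has_integral_on_superset)
        (use test_functionsD(6)[OF test_functions_partial[OF \<phi>(1)]] in auto)
    moreover have "bounded {x. \<phi> x \<noteq> 0}"
      using test_functionsD(2)[OF \<phi>(1)] bounded_subset[OF compact_imp_bounded closure_subset]
          by blast
    then have "(partial j \<phi> has_integral 0) UNIV"
      by (rule integral_partial_compact_support[OF C1])
    ultimately have "0 = (\<Sum>K\<in>cells \<Delta>. integral K (partial j \<phi>))"
      using has_integral_unique by blast
    also have "\<dots> = (\<Sum>K\<in>cells \<Delta>. \<Sum>g\<in>faces. if g = f then eps K f * (face_normal f $ j * face_integral
        f \<phi>) else 0)"
      by (intro sum.cong refl) (auto simp: gauss_cell[OF _ C1] other intro!: sum.cong)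
    also have "\<dots> = (\<Sum>K\<in>cells \<Delta>. eps K f * (face_normal f $ j * face_integral f \<phi>))"
      by (simp add: sum.delta finite_faces f'(4))
    finally show ?thesis by (simp add: sum_distrib_right)
  qed
  note zero = this
  have "norm (face_normal f) = 1" using face_frame(1)[OF f'(2)] by (simp add: orthonormal3_def)
  then have "face_normal f \<noteq> 0" by auto
  then obtain j where "face_normal f $ j \<noteq> 0" by (auto simp: vec_eq_iff)
  then show ?thesis using zero[of j] pos by simp
qed

end

section \<open>The discrete spaces\<close>

lemma sum_fun_apply: "(\<Sum>i\<in>A. f i) x = (\<Sum>i\<in>A. f i x)" for f :: "'i \<Rightarrow> 'a \<Rightarrow> 'b::comm_monoid_add"
  by (induction A rule: infinite_finite_induct) auto

lemma span_map:
  assumes "linear f" "\<And>s. s \<in> S \<Longrightarrow> f s \<in> span T" "x \<in> span S"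
  shows "f x \<in> span T"
proof -
  have "f x \<in> span (f ` S)" using linear_span_image[OF assms(1), of S] assms(3) by blast
  also have "span (f ` S) \<subseteq> span T" by (rule span_minimal) (use assms(2) in auto)
  finally show ?thesis .
qed

lemma outer_mult: "outer a b *v v = (b \<bullet> v) *\<^sub>R a"
  by (simp add: inner_vec_def outer_def matrix_vector_mult_def vec_eq_iff sum_3 algebra_simps)

lemma mskw_mult: "mskw n *v v = cross3 n v"
  by (simp add: mskw_nth matrix_vector_mult_def vec_eq_iff forall_3 sum_3 vector_3 cross3_def)

lemma outer_linear: "outer (a + a') b = outer a b + outer a' b" "outer (c *\<^sub>R a) b =
    c *\<^sub>R outer a b"
  "outer a (b + b') = outer a b + outer a b'" "outer a (c *\<^sub>R b) = c *\<^sub>R outer a b"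
  by (simp_all add: outer_def vec_eq_iff algebra_simps)

lemma face_integral_zero: "2 simplex f \<Longrightarrow> face_integral f (\<lambda>x. 0) = 0"
  using face_integral_linear(2)[of f "\<lambda>x. 0" 0] by simp

lemma face_integral_sum:
  assumes f: "2 simplex f" and g: "\<And>i. i \<in> A \<Longrightarrow> continuous_on UNIV (g i)"
  shows "face_integral f (\<lambda>x. \<Sum>i\<in>A. c i * g i x) = (\<Sum>i\<in>A. c i * face_integral f (g i))"
  using g
proof (induction A rule: infinite_finite_induct)
  case (insert i A)
  have "face_integral f (\<lambda>x. c i * g i x + (\<Sum>i\<in>A. c i * g i x)) =
      face_integral f (\<lambda>x. c i * g i x) + face_integral f (\<lambda>x. \<Sum>i\<in>A. c i * g i x)"
    by (intro face_integral_linear(1)[OF f] continuous_intros) (use insert.prems in auto)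
  then show ?case using insert by (simp add: face_integral_linear(2)[OF f])
qed (simp_all add: face_integral_zero f)

lemma continuous_on_symb:
  assumes "\<phi> \<in> test_functions \<Omega>"
  shows "continuous_on S (\<lambda>x. a \<bullet> \<phi> x)"
  by (intro continuous_intros test_functionsD(5)[OF assms])

lemma delta_distrs:
  shows "1 simplex e \<Longrightarrow> delta_edge \<Omega> e a \<in> distrs \<Omega>"
    and "2 simplex f \<Longrightarrow> delta_face \<Omega> f a \<in> distrs \<Omega>"
    and "delta_vertex \<Omega> x a \<in> distrs \<Omega>"
  unfolding delta_edge_def delta_face_def delta_vertex_def
  by (rule on_tests_distrs; simp add: inner_add_right edge_integral_linear(1,2)
      face_integral_linear(1,2)
      continuous_on_symb)+

lemma C_k_inner_fun:
  fixes u v :: "vec3 \<Rightarrow> 'b::euclidean_space"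
  assumes "C_k k u" "C_k k v"
  shows "C_k k (\<lambda>x. u x \<bullet> v x)"
proof -
  have "C_k k (\<lambda>x. \<Sum>b\<in>Basis. (u x \<bullet> b) * (v x \<bullet> b))"
    by (intro C_k_sum C_k_mult C_k_inner assms finite_Basis)
  then show ?thesis by (simp add: euclidean_inner[symmetric])
qed

lemma partial_inner_fun:
  fixes u v :: "vec3 \<Rightarrow> 'b::real_inner"
  assumes "u differentiable (at x)" "v differentiable (at x)"
  shows "partial j (\<lambda>x. u x \<bullet> v x) x = u x \<bullet> partial j v x + partial j u x \<bullet> v x"
  unfolding partial_def[of _ u] partial_def[of _ v]
  using partial_eqI[OF has_derivative_inner[OF assms[THEN frechet_derivative_works[THEN iffD1]]]] .

text \<open>The principal symbol: integration by parts turns the operator with coefficients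
  \<open>L\<close> into boundary terms with this matrix-valued function of the normal.\<close>

definition symb :: "(3 \<Rightarrow> 'b \<Rightarrow> 'c) \<Rightarrow> vec3 \<Rightarrow> 'b::euclidean_space \<Rightarrow> 'c::euclidean_space" where
  "symb L n a = (\<Sum>j\<in>UNIV. n $ j *\<^sub>R L j a)"

lemma symb_div: "s \<bullet> symb div_part n B = outer s n \<bullet> B"
  by (simp add: symb_def div_part_def outer_def matrix_vector_mult_def inner_vec_def sum_3
      algebra_simps)

text \<open>The boundary term of the curl is the row-wise cross product of \<open>s\<close> with
  \<open>n\<close> from the right, written as a matrix product.\<close>

lemma symb_curl: "s \<bullet> symb curl_part n B = (s ** mskw n) \<bullet> B"
  by (simp add: symb_def curl_part_def matrix_matrix_mult_def mskw_nth inner_vec_def sum_3 vector_3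
      axis3 cross3_def algebra_simps)

text \<open>The first condition makes every column parallel to \<open>n\<close>, so the matrix is n
  (x) y; the second makes y tangential.\<close>

lemma conormal_decomposition:
  assumes o: "orthonormal3 n t1 t2" and X: "mskw n ** X = 0" "X *v n = 0"
  shows "\<exists>a b. X = a *\<^sub>R outer n t1 + b *\<^sub>R outer n t2"
proof -
  define y where "y = transpose X *v n"
  have nn: "n \<bullet> n = 1" using o by (simp add: orthonormal3_def norm_eq_1)
  have yv: "y \<bullet> v = n \<bullet> (X *v v)" for v
    unfolding y_def by (simp add: dot_lmul_matrix[symmetric] vector_transpose_matrix)
  have "X *v v = outer n y *v v" for v
  proof -
    have "cross3 n (X *v v) = 0" using X(1) by (metis matrix_vector_mul_assoc matrix_vector_mult_0
        mskw_mult)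
    then have "cross3 n (cross3 n (X *v v)) = 0" by simp
    then have "X *v v = (n \<bullet> (X *v v)) *\<^sub>R n" using nn Lagrange[of n n "X *v v"] by simp
    then show ?thesis by (simp add: outer_mult yv)
  qed
  then have "X = outer n y" by (simp add: matrix_eq)
  moreover have "y = (y \<bullet> t1) *\<^sub>R t1 + (y \<bullet> t2) *\<^sub>R t2"
    using orthonormal3_expand[OF o, of y] yv[of n] X(2) by simp
  ultimately have "X = outer n ((y \<bullet> t1) *\<^sub>R t1 + (y \<bullet> t2) *\<^sub>R t2)" by metis
  then show ?thesis by (metis outer_linear(3,4))
qed

context mesh
begin

text \<open>\<open>tt_continuous\<close> speaks about values at interior points; a witness is needed
  to transfer it to the constants attached to the cells.\<close>

lemma cell_interior_nonempty:
  assumes "K \<in> cells \<Delta>"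
  shows "interior K \<noteq> {}"
proof -
  have "aff_dim K = int DIM(vec3)" using aff_dim_simplex[OF cellsD(2)[OF assms]] by simp
  then have "affine hull K = UNIV" by (rule aff_dim_eq_full[THEN iffD1])
  then have "interior K = rel_interior K" using rel_interior_interior by metis
  moreover have "K \<noteq> {}" using \<open>aff_dim K = int DIM(vec3)\<close> by auto
  ultimately show ?thesis using rel_interior_eq_empty[OF cellsD(4)[OF assms]] by simp
qed

lemma gauss_cell_sum:
  assumes K: "K \<in> cells \<Delta>" and F: "\<And>j. C_k (Suc 0) (F j)"
  shows "integral K (\<lambda>x. \<Sum>j\<in>UNIV. partial j (F j) x) =
    (\<Sum>f\<in>faces. eps K f * face_integral f (\<lambda>x. \<Sum>j\<in>UNIV. face_normal f $ j * F j x))"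
proof -
  have "integral K (\<lambda>x. \<Sum>j\<in>UNIV. partial j (F j) x) = (\<Sum>j\<in>UNIV. integral K (partial j (F j)))"
    by (intro integral_sum finite compact_integrable cellsD(3)[OF K] continuous_on_partial F)
  also have "\<dots> = (\<Sum>j\<in>UNIV. \<Sum>f\<in>faces. eps K f * (face_normal f $ j * face_integral f (F j)))"
    by (simp add: gauss_cell[OF K F])
  also have "\<dots> = (\<Sum>f\<in>faces. \<Sum>j\<in>UNIV. eps K f * (face_normal f $ j * face_integral f (F j)))"
    by (rule sum.swap)
  also have "\<dots> = (\<Sum>f\<in>faces. eps K f * face_integral f (\<lambda>x. \<Sum>j\<in>UNIV. face_normal f $ j * F j x))"
  proof (rule sum.cong[OF refl])
    fix f assume "f \<in> faces"
    then have f: "2 simplex f" by (simp add: faces_def)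
    have "face_integral f (\<lambda>x. \<Sum>j\<in>UNIV. face_normal f $ j * F j x) =
        (\<Sum>j\<in>UNIV. face_normal f $ j * face_integral f (F j))"
      by (rule face_integral_sum[OF f]) (rule C_k_continuous[OF F])
    then show "(\<Sum>j\<in>UNIV. eps K f * (face_normal f $ j * face_integral f (F j))) =
        eps K f * face_integral f (\<lambda>x. \<Sum>j\<in>UNIV. face_normal f $ j * F j x)"
      by (simp add: sum_distrib_left)
  qed
  finally show ?thesis .
qed

lemma sum_faces_interior:
  assumes "\<And>f x. x \<notin> \<Omega> \<Longrightarrow> g f x = 0"
  shows "(\<Sum>f\<in>faces. c f * face_integral f (g f)) = (\<Sum>f\<in>interior_faces \<Delta> \<Omega>. c f * face_integral f
      (g f))"
  by (rule sum.mono_neutral_right[OF finite_faces])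
    (use interior_facesD face_integral_boundary[OF _ _ assms] in \<open>auto simp: faces_def\<close>)

text \<open>A piecewise constant field has no derivative inside the cells, so only the face terms of
  the divergence theorem survive; boundary faces are invisible to tests.\<close>

lemma regular_pdo:
  fixes L :: "3 \<Rightarrow> 'b::euclidean_space \<Rightarrow> 'c::euclidean_space"
  assumes L: "\<And>j. linear (L j)" and u: "cellwise u (\<lambda>K x. s K)" and \<phi>: "\<phi> \<in> test_functions \<Omega>"
  shows "regular \<Omega> u (pdo L \<phi>) = (\<Sum>K\<in>cells \<Delta>. \<Sum>f\<in>interior_faces \<Delta> \<Omega>.
    eps K f * face_integral f (\<lambda>x. s K \<bullet> symb L (face_normal f) (\<phi> x)))"
proof -
  have "regular \<Omega> u (pdo L \<phi>) = (\<Sum>K\<in>cells \<Delta>. integral K (\<lambda>x. s K \<bullet> pdo L \<phi> x))"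
    by (rule cellwise_regular(2)[OF u test_functions_pdo[OF \<phi> L]])
  also have "\<dots> = (\<Sum>K\<in>cells \<Delta>. \<Sum>f\<in>interior_faces \<Delta> \<Omega>.
    eps K f * face_integral f (\<lambda>x. s K \<bullet> symb L (face_normal f) (\<phi> x)))"
  proof (rule sum.cong[OF refl])
    fix K assume K: "K \<in> cells \<Delta>"
    have lin: "linear (\<lambda>a. s K \<bullet> L j a)" for j
      by (auto intro!: linearI simp: linear_add[OF L] linear_scale[OF L] inner_add_right)
    have F: "C_k (Suc 0) (\<lambda>x. s K \<bullet> L j (\<phi> x))" for j
      by (rule test_functionsD(1)[OF test_functions_linear[OF \<phi> lin]])
    have "integral K (\<lambda>x. s K \<bullet> pdo L \<phi> x) = integral K (\<lambda>x. \<Sum>j\<in>UNIV. partial j (\<lambda>x. s K \<bullet> L j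
        (\<phi> x)) x)"
      by (simp add: pdo_def inner_sum_right partial_linear[OF lin \<phi>])
    also have "\<dots> = (\<Sum>f\<in>faces. eps K f * face_integral f (\<lambda>x. s K \<bullet> symb L (face_normal f) (\<phi> x)))"
      unfolding gauss_cell_sum[OF K F] by (simp add: symb_def inner_sum_right)
    also have "\<dots> = (\<Sum>f\<in>interior_faces \<Delta> \<Omega>. eps K f * face_integral f (\<lambda>x. s K \<bullet> symb L (face_normal
        f) (\<phi> x)))"
      by (rule sum_faces_interior) (simp add: test_functionsD(6)[OF \<phi>] symb_def linear_0[OF L])
    finally show "integral K (\<lambda>x. s K \<bullet> pdo L \<phi> x) = \<dots>" .
  qed
  finally show ?thesis .
qed

text \<open>No jump has to be formed: each pair of a cell and a face already contributes a multiple
  of a generator.\<close>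

lemma grad_Wh0:
  assumes "w \<in> Wh0 \<Delta> \<Omega>"
  shows "grad_distr \<Omega> w \<in> Wh1 \<Delta> \<Omega>"
proof -
  obtain c where c: "w = regular \<Omega> c" "piecewise_constant \<Delta> c" using assms unfolding Wh0_def
      by blast
  obtain s where s: "cellwise c (\<lambda>K x. s K)" using piecewise_constant_cellwise[OF c(2)] .
  have "grad_distr \<Omega> w = (\<Sum>K\<in>cells \<Delta>. \<Sum>f\<in>interior_faces \<Delta> \<Omega>.
      (- eps K f) *\<^sub>R delta_face \<Omega> f (outer (s K) (face_normal f)))"
  proof
    fix W :: "vec3 \<Rightarrow> mat3"
    show "grad_distr \<Omega> w W = (\<Sum>K\<in>cells \<Delta>. \<Sum>f\<in>interior_faces \<Delta> \<Omega>.
      (- eps K f) *\<^sub>R delta_face \<Omega> f (outer (s K) (face_normal f))) W"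
    proof (cases "W \<in> test_functions \<Omega>")
      case True
      then show ?thesis
        using regular_pdo[where L=div_part, OF linear_parts(3) s True]
        by (simp add: sum_fun_apply scaleR_fun_def grad_distr_def on_tests_def c(1) div_field_pdo
            delta_face_def symb_div sum_negf)
    qed (simp add: sum_fun_apply scaleR_fun_def grad_distr_def on_tests_def delta_face_def)
  qed
  also have "\<dots> \<in> Wh1 \<Delta> \<Omega>"
    unfolding Wh1_def by (intro span_sum span_scale span_base) blast
  finally show ?thesis .
qed

text \<open>\<open>X f\<close> is the jump of the row-wise trace s x n. It kills n, and crossing it
  with n from the left gives the jump of the tangential-tangential part, which is 0.\<close>

lemma curl_Reg:
  assumes "v \<in> Reg \<Delta> \<Omega>"
  shows "curl_distr \<Omega> v \<in> Vh2 \<Delta> \<Omega>"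
proof -
  obtain \<sigma> where \<sigma>: "v = regular \<Omega> \<sigma>" "piecewise_constant \<Delta> \<sigma>" "tt_continuous \<Delta> \<Omega> \<sigma>"
    using assms unfolding Reg_def by blast
  obtain s where s: "cellwise \<sigma> (\<lambda>K x. s K)" using piecewise_constant_cellwise[OF \<sigma>(2)] .
  define X where "X f = (\<Sum>K\<in>cells \<Delta>. eps K f *\<^sub>R (s K ** mskw (face_normal f)))" for f
  have "curl_distr \<Omega> v = (\<Sum>f\<in>interior_faces \<Delta> \<Omega>. delta_face \<Omega> f (X f))"
  proof
    fix W :: "vec3 \<Rightarrow> mat3"
    show "curl_distr \<Omega> v W = (\<Sum>f\<in>interior_faces \<Delta> \<Omega>. delta_face \<Omega> f (X f)) W"
    proof (cases "W \<in> test_functions \<Omega>")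
      case True
      have "face_integral f (\<lambda>x. X f \<bullet> W x) =
          (\<Sum>K\<in>cells \<Delta>. eps K f * face_integral f (\<lambda>x. (s K ** mskw (face_normal f)) \<bullet> W x))"
        if "f \<in> interior_faces \<Delta> \<Omega>" for f
        unfolding X_def inner_sum_left inner_scaleR_left
        by (rule face_integral_sum) (use interior_facesD[OF that] continuous_on_symb[OF True] in
            auto)
      then show ?thesis
        using True regular_pdo[where L=curl_part, OF linear_parts(2) s True]
        by (subst (asm) sum.swap) (simp add: sum_fun_apply curl_distr_def on_tests_def \<sigma>(1)
            curl_field_pdo
            delta_face_def symb_curl)
    qed (simp add: sum_fun_apply curl_distr_def on_tests_def delta_face_def)
  qed
  also have "\<dots> \<in> Vh2 \<Delta> \<Omega>"
    unfolding Vh2_def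
  proof (rule span_sum)
    fix f assume f: "f \<in> interior_faces \<Delta> \<Omega>"
    let ?n = "face_normal f"
    have f2: "2 simplex f" using interior_facesD[OF f] by blast
    have lin: "linear (\<lambda>A. mskw ?n ** A)"
      by (auto intro!: linearI simp: matrix_matrix_mult_def vec_eq_iff sum_3 algebra_simps)
    have "mskw ?n ** X f = (\<Sum>K\<in>cells \<Delta>. eps K f *\<^sub>R (mskw ?n ** s K ** mskw ?n))"
      unfolding X_def by (simp add: linear_sum[OF lin] linear_scale[OF lin] matrix_mul_assoc)
    also have "\<dots> = 0"
    \<comment> \<open>Only cells with nonzero coefficient are known to have \<open>f\<close> as a
      face. They share one tangential-tangential value, and the coefficients sum to 0.\<close>
    proof (cases "\<exists>K\<in>cells \<Delta>. eps K f \<noteq> 0")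
      case True
      then obtain K0 where K0: "K0 \<in> cells \<Delta>" "eps K0 f \<noteq> 0" by blast
      have "mskw ?n ** s K ** mskw ?n = mskw ?n ** s K0 ** mskw ?n"
          if K: "K \<in> cells \<Delta>" "eps K f \<noteq> 0" for K
      proof -
        obtain x y where xy: "x \<in> interior K" "y \<in> interior K0"
          using cell_interior_nonempty K K0 by blast
        then have "\<sigma> x = s K" "\<sigma> y = s K0" using s K K0 unfolding cellwise_def by auto
        then show ?thesis
          using \<sigma>(3) f K K0 xy eps_face unfolding tt_continuous_def by metis
      qed
      then have "(\<Sum>K\<in>cells \<Delta>. eps K f *\<^sub>R (mskw ?n ** s K ** mskw ?n)) =
          (\<Sum>K\<in>cells \<Delta>. eps K f *\<^sub>R (mskw ?n ** s K0 ** mskw ?n))"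
        by (intro sum.cong refl) (metis scaleR_zero_left)
      then show ?thesis using eps_sum[OF f] by (simp add: scaleR_sum_left[symmetric])
    qed simp
    finally have 1: "mskw ?n ** X f = 0" .
    have "(s K ** mskw ?n) *v ?n = 0" for K
      by (simp add: matrix_vector_mul_assoc[symmetric] mskw_mult)
    moreover have lin2: "linear (\<lambda>A :: mat3. A *v ?n)"
      by (auto intro!: linearI simp: matrix_vector_mult_def vec_eq_iff sum_3 algebra_simps)
    ultimately have 2: "X f *v ?n = 0"
      unfolding X_def by (simp add: linear_sum[OF lin2] linear_scale[OF lin2])
    obtain a b where ab: "X f = a *\<^sub>R outer ?n (face_tangent1 f) + b *\<^sub>R outer ?n (face_tangent2 f)"
      using conormal_decomposition[OF face_frame(1)[OF f2] 1 2] by blast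
    have "delta_face \<Omega> f (X f) = a *\<^sub>R delta_face \<Omega> f (outer ?n (face_tangent1 f)) + b *\<^sub>R
        delta_face \<Omega> f (outer ?n (face_tangent2 f))"
      unfolding ab by (auto simp: fun_eq_iff delta_face_def on_tests_def scaleR_fun_def
          inner_add_left
          face_integral_linear(1,2)[OF f2] continuous_on_symb continuous_on_mult_left)
    also have "\<dots> \<in> span (\<Union>f \<in> interior_faces \<Delta> \<Omega>.
     {delta_face \<Omega> f (outer (face_normal f) (face_tangent1 f)),
      delta_face \<Omega> f (outer (face_normal f) (face_tangent2 f)),
      delta_face \<Omega> f (outer (face_tangent1 f) (face_tangent1 f) +
                      outer (face_tangent2 f) (face_tangent2 f))})"
      by (intro span_add span_scale span_base) (use f in blast)+
    finally show "delta_face \<Omega> f (X f) \<in> \<dots>" .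
  qed
  finally show ?thesis .
qed

end

lemma mskw_symm_mskw:
  assumes "D ** mskw n = 0"
  shows "mskw n ** symm D ** mskw n = 0"
proof -
  have "transpose (D ** mskw n) = 0" by (simp add: assms transpose_def vec_eq_iff)
  then have "transpose (mskw n) ** transpose D = 0" by (simp add: matrix_transpose_mul)
  moreover have "transpose (mskw n) = - mskw n" by (simp add: mskw_nth mat3_simps)
  ultimately have "mskw n ** transpose D = 0"
    by (simp add: matrix_matrix_mult_def vec_eq_iff sum_negf)
  then have "mskw n ** transpose D ** mskw n = 0" by (simp add: matrix_matrix_mult_def vec_eq_iff)
  moreover have "mskw n ** D ** mskw n = 0"
    unfolding matrix_mul_assoc[symmetric] assms by (simp add: matrix_matrix_mult_def vec_eq_iff)
  moreover have "mskw n ** symm D ** mskw n = (1/2) *\<^sub>R (mskw n ** D ** mskw n + mskw n ** transpose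
      D ** mskw n)"
    by (simp add: symm_def matrix_matrix_mult_def vec_eq_iff sum_3 algebra_simps)
  ultimately show ?thesis by simp
qed

text \<open>Reduces the row-wise curl of W, tested with c (x) n, to the curl of the vector field
  obtained by applying the transpose of W to c; this is the form Stokes' theorem needs.\<close>

lemma outer_curl_part: "outer c n \<bullet> curl_part j B = n \<bullet> cross3 (axis j 1) (transpose B *v c)"
  using exhaust_3[of j]
  by (elim disjE) (simp_all add: outer_def curl_part_def axis3 cross3_def inner_vec_def sum_3
      vector_3
      matrix_vector_mult_def transpose_def algebra_simps)

context mesh
begin

lemma cellwise_exists: "\<exists>G. cellwise G (\<lambda>K x. s K)"
proof -
  define G where "G x = s (SOME K. K \<in> cells \<Delta> \<and> x \<in> interior K)" for x
  have "G x = s K" if "K \<in> cells \<Delta>" "x \<in> interior K" for K x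
  proof -
    let ?K = "SOME K. K \<in> cells \<Delta> \<and> x \<in> interior K"
    have "?K \<in> cells \<Delta> \<and> x \<in> interior ?K" by (rule someI[of _ K]) (use that in blast)
    then show ?thesis unfolding G_def using cells_disjoint that by metis
  qed
  then have "cellwise G (\<lambda>K x. s K)" by (simp add: cellwise_def)
  then show ?thesis by (intro exI[of _ G])
qed

lemma cellwise_piecewise_constant: "cellwise G (\<lambda>K x. s K) \<Longrightarrow> piecewise_constant \<Delta> G"
  unfolding cellwise_def piecewise_constant_def constant_on_def by blast

text \<open>The face may partly lie in the boundary, where agreement is not assumed. Near a point of
  the domain it suffices: the difference of the linear parts kills all small tangent vectors, hence
  all, and thus every cross product with the normal.\<close>

lemma affine_agree:
  assumes f: "f \<in> interior_faces \<Delta> \<Omega>"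
    and eq: "\<And>x. x \<in> f \<Longrightarrow> x \<in> \<Omega> \<Longrightarrow> A *v x + b = A' *v x + (b' :: vec3)"
  shows "(A - A') ** mskw (face_normal f) = 0"
proof -
  let ?D = "A - A'" and ?n = "face_normal f"
  have f': "f \<in> \<Delta>" "2 simplex f" "\<not> f \<subseteq> frontier \<Omega>" using interior_facesD[OF f] by auto
  have "f \<subseteq> closure \<Omega>" using f'(1) mesh_Union by blast
  then obtain x where x: "x \<in> f" "x \<in> \<Omega>" using f'(3) frontier_dom by blast
  obtain r where r: "r > 0" "ball x r \<subseteq> \<Omega>" using open_dom x(2) open_contains_ball by blast
  have D: "?D *v (y - x) = 0" if y: "y \<in> f" for y
  proof -
    define N where "N = norm (y - x)"
    \<comment> \<open>The denominator r + N gives both a convex weight and a displacement shorter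
      than r, also when y = x.\<close>
    define \<eta> where "\<eta> = r / (r + N)"
    have N: "0 \<le> N" by (simp add: N_def)
    have \<eta>: "0 < \<eta>" "\<eta> \<le> 1" "\<eta> * N < r"
      using r(1) N by (simp_all add: \<eta>_def divide_simps)
    define z where "z = (1 - \<eta>) *\<^sub>R x + \<eta> *\<^sub>R y"
    have "z \<in> f" unfolding z_def
      using convexD[OF convex_simplex[OF f'(2)] x(1) y, of "1 - \<eta>" \<eta>] \<eta> by simp
    moreover have zx: "z - x = \<eta> *\<^sub>R (y - x)" by (simp add: z_def algebra_simps)
    have "dist z x = \<eta> * N" unfolding dist_norm zx N_def using \<eta> by simp
    then have "z \<in> \<Omega>" using r(2) \<eta> by (auto simp: dist_commute)
    ultimately have "A *v z + b = A' *v z + b'" "A *v x + b = A' *v x + b'" using eq x by blast+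
    then have "(A *v z + b) - (A *v x + b) = (A' *v z + b') - (A' *v x + b')" by simp
    then have "?D *v (z - x) = 0"
      by (simp add: matrix_vector_mult_diff_distrib matrix_vector_mult_diff_rdistrib algebra_simps)
    then have "\<eta> *\<^sub>R (?D *v (y - x)) = 0" unfolding zx by (simp add: matrix_vector_mult_scaleR)
    then show ?thesis using \<eta>(1) by simp
  qed
  obtain p q s where pqs: "\<not> collinear {p, q, s}" "f = convex hull {p, q, s}"
    using triangle_vertices[OF f'(2)] .
  have mem: "p \<in> f" "q \<in> f" "s \<in> f" unfolding pqs(2) by (simp_all add: hull_inc)
  have diff: "?D *v (y - z) = 0" if "y \<in> f" "z \<in> f" for y z
    using D[OF that(1)] D[OF that(2)] by (simp add: matrix_vector_mult_diff_distrib)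
  define m where "m = cross3 (q - p) (s - p)"
  have "m \<noteq> 0" using pqs(1) cross_eq_0_collinear unfolding m_def by simp
  have m: "m = (m \<bullet> ?n) *\<^sub>R ?n" unfolding m_def by (rule cross_face_normal[OF f'(2) mem])
  have k: "m \<bullet> ?n \<noteq> 0" using m \<open>m \<noteq> 0\<close> by auto
  have "?D *v cross3 ?n v = 0" for v
  proof -
    \<comment> \<open>By the double cross product identity, m x v is a combination of two sides of
      the triangle.\<close>
    have "cross3 m v = (v \<bullet> (q - p)) *\<^sub>R (s - p) - (v \<bullet> (s - p)) *\<^sub>R (q - p)"
      unfolding m_def
      by (simp add: vec_eq_iff forall_3 cross3_def vector_3 inner_vec_def sum_3 algebra_simps)
    then have "?D *v cross3 m v = (v \<bullet> (q - p)) *\<^sub>R (?D *v (s - p)) - (v \<bullet> (s - p)) *\<^sub>R (?D *v (q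
        - p))"
      by (simp only: matrix_vector_mult_diff_distrib[of ?D "_ *\<^sub>R _"] matrix_vector_mult_scaleR)
    also have "\<dots> = 0" by (simp add: diff mem)
    finally have "?D *v cross3 m v = 0" .
    moreover have "cross3 m v = (m \<bullet> ?n) *\<^sub>R cross3 ?n v" by (subst m) (rule cross_mult_left)
    ultimately have "(m \<bullet> ?n) *\<^sub>R (?D *v cross3 ?n v) = 0" by (simp only: matrix_vector_mult_scaleR)
    then show ?thesis using k by simp
  qed
  then have "(?D ** mskw ?n) *v v = 0 *v v" for v
    by (simp add: matrix_vector_mul_assoc[symmetric] mskw_mult)
  then show ?thesis by (simp only: matrix_eq) blast
qed

lemma cell_affine_parts:
  assumes K: "K \<in> cells \<Delta>" and W: "W \<in> test_functions \<Omega>"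
  shows "integral K (\<lambda>x. (A *v x + b) \<bullet> div_field W x) + integral K (\<lambda>x. A \<bullet> W x) =
    (\<Sum>f\<in>interior_faces \<Delta> \<Omega>. eps K f * face_integral f (\<lambda>x. (A *v x + b) \<bullet> symb div_part
        (face_normal f) (W x)))"
proof -
  let ?u = "\<lambda>x. A *v x + b"
  let ?F = "\<lambda>j x. ?u x \<bullet> div_part j (W x)"
  have u: "C_k k ?u" for k
    by (intro C_k_add C_k_linear C_k_const matrix_vector_mul_bounded_linear)
  have pW: "(\<lambda>x. div_part j (W x)) \<in> test_functions \<Omega>" for j
    by (rule test_functions_linear[OF W linear_parts(3)])
  have F: "C_k (Suc 0) (?F j)" for j
    by (rule C_k_inner_fun[OF u test_functionsD(1)[OF pW]])
  have pu: "partial j ?u x = A *v axis j 1" for j x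
    by (rule partial_eqI[OF has_derivative_add_const[OF bounded_linear_imp_has_derivative[OF
        matrix_vector_mul_bounded_linear]]])
  have "(\<Sum>j\<in>UNIV. partial j (?F j) x) = ?u x \<bullet> div_field W x + A \<bullet> W x" for x
  proof -
    have "partial j (?F j) x = ?u x \<bullet> div_part j (partial j W x) + (A *v axis j 1) \<bullet> div_part j
        (W x)" for j
      by (subst partial_inner_fun[OF C_k_Suc_differentiable[OF u] test_functionsD(4)[OF pW]])
        (simp only: pu partial_linear[OF linear_parts(3) W])
    moreover have "(\<Sum>j\<in>UNIV. (A *v axis j 1) \<bullet> div_part j (W x)) = A \<bullet> W x"
      by (simp add: div_part_def inner_vec_def sum_3 matrix_vector_mult_def axis_def)
    ultimately show ?thesis
      by (simp add: sum.distrib div_field_pdo pdo_def inner_sum_right)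
  qed
  then have "integral K (\<lambda>x. ?u x \<bullet> div_field W x + A \<bullet> W x) =
      integral K (\<lambda>x. \<Sum>j\<in>UNIV. partial j (?F j) x)"
    by simp
  also have "\<dots> = (\<Sum>f\<in>faces. eps K f * face_integral f (\<lambda>x. ?u x \<bullet> symb div_part (face_normal f)
      (W x)))"
    unfolding gauss_cell_sum[OF K F] by (simp add: symb_def inner_sum_right)
  also have "\<dots> = (\<Sum>f\<in>interior_faces \<Delta> \<Omega>. eps K f * face_integral f (\<lambda>x. ?u x \<bullet> symb div_part
      (face_normal f) (W x)))"
    by (rule sum_faces_interior) (simp add: test_functionsD(6)[OF W] symb_def linear_0[OF
        linear_parts(3)])
  also have "integral K (\<lambda>x. ?u x \<bullet> div_field W x + A \<bullet> W x) =
      integral K (\<lambda>x. ?u x \<bullet> div_field W x) + integral K (\<lambda>x. A \<bullet> W x)"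
    by (intro Henstock_Kurzweil_Integration.integral_add compact_integrable cellsD(3)[OF K]
        continuous_intros
        C_k_continuous[OF u[of 0]] test_functionsD(5)[OF W] test_functionsD(5)[OF
            test_functions_fields(3)[OF W]])
  finally show ?thesis .
qed

text \<open>After integration by parts on each cell, the face terms carry the same integrand from
  all adjacent cells because \<open>u\<close> is single-valued, so \<open>eps_sum\<close> cancels
  them and the cellwise gradient remains.\<close>

lemma grad_Lag:
  assumes "v \<in> Lag \<Delta> \<Omega>"
  obtains G where "grad_distr \<Omega> v = regular \<Omega> G" "piecewise_constant \<Delta> G" "tt_continuous \<Delta> \<Omega>
      (\<lambda>x. symm (G x))"
proof -
  obtain u where u: "v = regular \<Omega> u" "piecewise_affine \<Delta> \<Omega> u"
    using assms unfolding Lag_def by blast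
  obtain A b where Ab: "\<And>K x. K \<in> cells \<Delta> \<Longrightarrow> x \<in> K \<Longrightarrow> x \<in> \<Omega> \<Longrightarrow> u x = A K *v x + b K"
    "cellwise u (\<lambda>K x. A K *v x + b K)"
    using piecewise_affine_cellwise[OF u(2)] by blast
  obtain G where G: "cellwise G (\<lambda>K x. A K)" using cellwise_exists by blast
  have "grad_distr \<Omega> v = regular \<Omega> G"
  proof
    fix W :: "vec3 \<Rightarrow> mat3"
    show "grad_distr \<Omega> v W = regular \<Omega> G W"
    proof (cases "W \<in> test_functions \<Omega>")
      case W: True
      have "regular \<Omega> u (div_field W) + regular \<Omega> G W =
          (\<Sum>K\<in>cells \<Delta>. integral K (\<lambda>x. (A K *v x + b K) \<bullet> div_field W x) + integral K
              (\<lambda>x. A K \<bullet> W x))"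
        unfolding cellwise_regular(2)[OF Ab(2) test_functions_fields(3)[OF W]]
            cellwise_regular(2)[OF G W]
        by (simp add: sum.distrib)
      also have "\<dots> = (\<Sum>K\<in>cells \<Delta>. \<Sum>f\<in>interior_faces \<Delta> \<Omega>. eps K f *
          face_integral f (\<lambda>x. u x \<bullet> symb div_part (face_normal f) (W x)))"
      proof (rule sum.cong[OF refl])
        fix K assume K: "K \<in> cells \<Delta>"
        show "integral K (\<lambda>x. (A K *v x + b K) \<bullet> div_field W x) + integral K (\<lambda>x. A K \<bullet> W x) =
          (\<Sum>f\<in>interior_faces \<Delta> \<Omega>. eps K f * face_integral f (\<lambda>x. u x \<bullet> symb div_part (face_normal f)
              (W x)))"
          unfolding cell_affine_parts[OF K W]
        proof (rule sum.cong[OF refl])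
          fix f assume f: "f \<in> interior_faces \<Delta> \<Omega>"
          show "eps K f * face_integral f (\<lambda>x. (A K *v x + b K) \<bullet> symb div_part (face_normal f)
              (W x)) =
            eps K f * face_integral f (\<lambda>x. u x \<bullet> symb div_part (face_normal f) (W x))"
          proof (cases "eps K f = 0")
            case False
            then have sub: "f \<subseteq> K" using eps_face[OF K] face_of_imp_subset by blast
            \<comment> \<open>The affine formula is known for \<open>u\<close> only inside the
              domain; elsewhere on the face the test function is 0.\<close>
            have "(A K *v x + b K) \<bullet> symb div_part (face_normal f) (W x) =
                u x \<bullet> symb div_part (face_normal f) (W x)"
              if "x \<in> f" for x
            proof (cases "x \<in> \<Omega>")
              case True
              then show ?thesis using Ab(1)[OF K] sub that by auto
            next
              case False
              then show ?thesis
                by (simp add: test_functionsD(6)[OF W] symb_def linear_0[OF linear_parts(3)])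
            qed
            then have "face_integral f (\<lambda>x. (A K *v x + b K) \<bullet> symb div_part (face_normal f)
                (W x)) =
                face_integral f (\<lambda>x. u x \<bullet> symb div_part (face_normal f) (W x))"
              using interior_facesD[OF f] by (intro face_integral_linear(3)) blast+
            then show ?thesis by (rule arg_cong)
          qed simp
        qed
      qed
      also have "\<dots> = (\<Sum>f\<in>interior_faces \<Delta> \<Omega>. (\<Sum>K\<in>cells \<Delta>. eps K f) *
          face_integral f (\<lambda>x. u x \<bullet> symb div_part (face_normal f) (W x)))"
        by (subst sum.swap) (simp add: sum_distrib_right)
      also have "\<dots> = 0" by (simp add: eps_sum)
      finally show ?thesis using W by (simp add: grad_distr_def on_tests_def u(1))
    qed (simp add: grad_distr_def regular_def on_tests_def)
  qed
  moreover have "tt_continuous \<Delta> \<Omega> (\<lambda>x. symm (G x))"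
    unfolding tt_continuous_def
  proof (intro ballI impI)
    fix f K K' x y
    assume f: "f \<in> interior_faces \<Delta> \<Omega>" and K: "K \<in> cells \<Delta>" "K' \<in> cells \<Delta>"
      and face: "f face_of K \<and> f face_of K'" and xy: "x \<in> interior K" "y \<in> interior K'"
    let ?n = "face_normal f"
    have sub: "f \<subseteq> K" "f \<subseteq> K'" using face face_of_imp_subset by blast+
    have "A K *v z + b K = A K' *v z + b K'" if z: "z \<in> f" "z \<in> \<Omega>" for z
    proof -
      have zK: "z \<in> K" "z \<in> K'" using sub z(1) by blast+
      show ?thesis by (rule trans[OF sym[OF Ab(1)[OF K(1) zK(1) z(2)]] Ab(1)[OF K(2) zK(2) z(2)]])
    qed
    then have "(A K - A K') ** mskw ?n = 0" by (rule affine_agree[OF f])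
    then have "mskw ?n ** symm (A K - A K') ** mskw ?n = 0" by (rule mskw_symm_mskw)
    moreover have "mskw ?n ** symm (A K - A K') ** mskw ?n =
        mskw ?n ** symm (A K) ** mskw ?n - mskw ?n ** symm (A K') ** mskw ?n"
      by (simp add: linear_diff matrix_matrix_mult_def vec_eq_iff sum_3 algebra_simps)
    moreover have "G x = A K" "G y = A K'" using G K xy unfolding cellwise_def by auto
    ultimately show "mskw ?n ** symm (G x) ** mskw ?n = mskw ?n ** symm (G y) ** mskw ?n" by simp
  qed
  ultimately show ?thesis using that cellwise_piecewise_constant[OF G] by blast
qed

lemma Vh1_eq: "Vh1 \<Delta> \<Omega> = {r + pointwise \<Omega> mskw w | r w. r \<in> Reg \<Delta> \<Omega> \<and> w \<in> Wh0 \<Delta> \<Omega>}"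
proof -
  have eq: "pointwise \<Omega> mskw (regular \<Omega> c) = regular \<Omega> (\<lambda>x. mskw (c x))" for c
    by (rule pointwise_regular) simp
  show ?thesis
  proof (intro equalityI subsetI)
    fix x assume "x \<in> Vh1 \<Delta> \<Omega>"
    then obtain r c where x: "x = r + regular \<Omega> (\<lambda>x. mskw (c x))" "r \<in> Reg \<Delta> \<Omega>" "piecewise_constant
        \<Delta> c"
      unfolding Vh1_def by auto
    show "x \<in> {r + pointwise \<Omega> mskw w | r w. r \<in> Reg \<Delta> \<Omega> \<and> w \<in> Wh0 \<Delta> \<Omega>}"
      by (rule CollectI, rule exI[of _ r], rule exI[of _ "regular \<Omega> c"])
        (use x eq in \<open>auto simp: Wh0_def\<close>)
  next
    fix x assume "x \<in> {r + pointwise \<Omega> mskw w | r w. r \<in> Reg \<Delta> \<Omega> \<and> w \<in> Wh0 \<Delta> \<Omega>}"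
    then obtain r c where x: "x = r + pointwise \<Omega> mskw (regular \<Omega> c)" "r \<in> Reg \<Delta> \<Omega>"
        "piecewise_constant \<Delta> c"
      unfolding Wh0_def by auto
    show "x \<in> Vh1 \<Delta> \<Omega>"
      unfolding Vh1_def by (rule CollectI, rule exI[of _ r], rule exI[of _ c]) (use x eq in auto)
  qed
qed

lemma grad_Lag_Vh1:
  assumes "v \<in> Lag \<Delta> \<Omega>"
  shows "grad_distr \<Omega> v \<in> Vh1 \<Delta> \<Omega>"
proof -
  obtain G where G: "grad_distr \<Omega> v = regular \<Omega> G" "piecewise_constant \<Delta> G" "tt_continuous \<Delta> \<Omega>
      (\<lambda>x. symm (G x))"
    using grad_Lag[OF assms] .
  have pc: "piecewise_constant \<Delta> (\<lambda>x. g (G x))" for g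
    using G(2) unfolding piecewise_constant_def constant_on_def by metis
  obtain s where s: "cellwise (\<lambda>x. symm (G x)) (\<lambda>K x. s K)"
      using piecewise_constant_cellwise[OF pc] .
  obtain t where t: "cellwise (\<lambda>x. mskw (vskw (G x))) (\<lambda>K x. t K)"
      using piecewise_constant_cellwise[OF pc] .
  have "symm M + mskw (vskw M) = M" for M
    by (simp add: symm_def vskw_eq mskw_nth mskw_adj_def mat3_simps field_simps)
  then have "grad_distr \<Omega> v = regular \<Omega> (\<lambda>x. symm (G x)) + regular \<Omega> (\<lambda>x. mskw (vskw (G x)))"
    using regular_linear(1)[OF s t] G(1) by simp
  moreover have "transpose (symm M) = symm M" for M by (simp add: symm_def mat3_simps add.commute)
  then have "regular \<Omega> (\<lambda>x. symm (G x)) \<in> Reg \<Delta> \<Omega>" unfolding Reg_def using pc G(3) by blast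
  moreover have "piecewise_constant \<Delta> (\<lambda>x. vskw (G x))" by (rule pc)
  ultimately show ?thesis
    unfolding Vh1_def by (intro CollectI exI[of _ "regular \<Omega> (\<lambda>x. symm (G x))"] exI[of _ "\<lambda>x. vskw
        (G x)"]) simp
qed

text \<open>Stokes' theorem on an interior face can produce edges in the boundary; they contribute
  nothing.\<close>

lemma delta_edge_boundary:
  assumes "e \<in> \<Delta>" "1 simplex e" "e \<notin> interior_edges \<Delta> \<Omega>"
  shows "delta_edge \<Omega> e a = 0"
  by (auto simp: fun_eq_iff delta_edge_def on_tests_def test_functionsD(6)[of _ \<Omega>]
      intro!: edge_integral_boundary[OF assms])

lemma curl_Wh1:
  assumes "w \<in> Wh1 \<Delta> \<Omega>"
  shows "curl_distr \<Omega> w \<in> Wh2 \<Delta> \<Omega>"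
  using assms unfolding Wh1_def Wh2_def
proof (rule span_map[rotated 2])
  show "linear (curl_distr \<Omega>)" by simp
  fix T assume "T \<in> {delta_face \<Omega> f (outer c (face_normal f)) | f c. f \<in> interior_faces \<Delta> \<Omega>}"
  then obtain f c where T: "T = delta_face \<Omega> f (outer c (face_normal f))" and f: "f \<in> interior_faces
      \<Delta> \<Omega>" by blast
  have f': "f \<in> \<Delta>" "2 simplex f" using interior_facesD[OF f] by auto
  obtain e :: "nat \<Rightarrow> vec3 set" and \<kappa> :: "nat \<Rightarrow> real"
      where e: "\<And>i. i < 3 \<Longrightarrow> e i face_of f" "\<And>i. i < 3 \<Longrightarrow> 1 simplex e i"
    and stokes: "\<And>F. C_k (Suc 0) F \<Longrightarrow> face_integral f (\<lambda>x. face_normal f \<bullet> curl_vec F x) =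
      (\<Sum>i<3. \<kappa> i * edge_integral (e i) (\<lambda>x. edge_tangent (e i) \<bullet> F x))"
    using stokes_triangle[OF f'(2)] by blast
  have "curl_distr \<Omega> T = (\<Sum>i<3. \<kappa> i *\<^sub>R delta_edge \<Omega> (e i) (outer c (edge_tangent (e i))))"
  proof
    fix W :: "vec3 \<Rightarrow> mat3"
    show "curl_distr \<Omega> T W = (\<Sum>i<3. \<kappa> i *\<^sub>R delta_edge \<Omega> (e i) (outer c (edge_tangent (e i)))) W"
    proof (cases "W \<in> test_functions \<Omega>")
      case W: True
      let ?F = "\<lambda>x. transpose (W x) *v c"
      have lin: "linear (\<lambda>B. transpose B *v c)"
        by (auto intro!: linearI simp: transpose_def matrix_vector_mult_def vec_eq_iff sum_3
            algebra_simps)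
      have F: "C_k (Suc 0) ?F" by (rule test_functionsD(1)[OF test_functions_linear[OF W lin]])
      have "partial j ?F x = transpose (partial j W x) *v c" for j x
        by (rule partial_linear[OF lin W])
      then have "outer c (face_normal f) \<bullet> curl_field W x = face_normal f \<bullet> curl_vec ?F x" for x
        unfolding curl_field_pdo pdo_def curl_vec_def inner_sum_right outer_curl_part
            by (simp only:)
      moreover have "t \<bullet> ?F x = outer c t \<bullet> W x" for t x
        by (simp add: outer_def inner_vec_def transpose_def matrix_vector_mult_def sum_3
            algebra_simps)
      ultimately show ?thesis
        using stokes[OF F] W
        by (simp add: T curl_distr_def delta_face_def delta_edge_def on_tests_def sum_fun_apply
            scaleR_fun_def test_functions_fields)
    qed (simp add: curl_distr_def delta_edge_def on_tests_def sum_fun_apply scaleR_fun_def)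
  qed
  also have "\<dots> \<in> span {delta_edge \<Omega> e (outer c (edge_tangent e)) | e c. e \<in> interior_edges \<Delta> \<Omega>}"
  proof (intro span_sum span_scale)
    fix i :: nat assume "i \<in> {..<3}"
    then have "e i \<in> \<Delta>" "1 simplex e i" using e mesh_face[OF f'(1)] by auto
    then show "delta_edge \<Omega> (e i) (outer c (edge_tangent (e i))) \<in>
        span {delta_edge \<Omega> e (outer c (edge_tangent e)) | e c. e \<in> interior_edges \<Delta> \<Omega>}"
    proof (cases "e i \<in> interior_edges \<Delta> \<Omega>")
      case True
      then show ?thesis by (intro span_base) blast
    next
      case False
      with \<open>e i \<in> \<Delta>\<close> \<open>1 simplex e i\<close> show ?thesis by (simp add: delta_edge_boundary span_zero)
    qed
  qed
  finally show "curl_distr \<Omega> T \<in> span {delta_edge \<Omega> e (outer c (edge_tangent e)) | e c. e \<in>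
      interior_edges \<Delta> \<Omega>}" .
qed

lemma div_Wh2:
  assumes "w \<in> Wh2 \<Delta> \<Omega>"
  shows "div_distr \<Omega> w \<in> Wh3 \<Delta> \<Omega>"
  using assms unfolding Wh2_def Wh3_def
proof (rule span_map[rotated 2])
  show "linear (div_distr \<Omega>)" by simp
  fix T assume "T \<in> {delta_edge \<Omega> e (outer c (edge_tangent e)) | e c. e \<in> interior_edges \<Delta> \<Omega>}"
  then obtain e c where T: "T = delta_edge \<Omega> e (outer c (edge_tangent e))" and e:
      "e \<in> interior_edges \<Delta> \<Omega>" by blast
  have e': "e \<in> \<Delta>" "1 simplex e" using interior_edgesD[OF e] by auto
  obtain a b \<kappa> where ab: "{a} face_of e" "{b} face_of e"
    and ftc: "\<And>F. C_k (Suc 0) F \<Longrightarrow> edge_integral e (dir_deriv (edge_tangent e) F) = \<kappa> * (F b - F a)"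
    using ftc_edge[OF e'(2)] by blast
  have "div_distr \<Omega> T = \<kappa> *\<^sub>R (delta_vertex \<Omega> a c - delta_vertex \<Omega> b c)"
  proof
    fix v :: "vec3 \<Rightarrow> vec3"
    show "div_distr \<Omega> T v = (\<kappa> *\<^sub>R (delta_vertex \<Omega> a c - delta_vertex \<Omega> b c)) v"
    proof (cases "v \<in> test_functions \<Omega>")
      case v: True
      have F: "C_k (Suc 0) (\<lambda>x. v x \<bullet> c)" by (rule C_k_inner[OF test_functionsD(1)[OF v]])
      have "outer c (edge_tangent e) \<bullet> grad_field v x = dir_deriv (edge_tangent e) (\<lambda>x. v x \<bullet> c) x"
          for x
        unfolding dir_deriv_def partial_inner[OF test_functionsD(1)[OF v]]
        by (simp add: grad_field_def outer_def inner_vec_def sum_3 algebra_simps)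
      then show ?thesis
        using ftc[OF F] v
        by (simp add: T div_distr_def delta_vertex_def delta_edge_def on_tests_def
            scaleR_fun_def test_functions_fields inner_commute algebra_simps)
    qed (simp add: div_distr_def delta_vertex_def on_tests_def scaleR_fun_def)
  qed
  also have "\<dots> \<in> span {delta_vertex \<Omega> x c | x c. x \<in> interior_vertices \<Delta> \<Omega>}"
  proof -
    have vertex: "delta_vertex \<Omega> x c \<in> span {delta_vertex \<Omega> x c | x c. x \<in> interior_vertices \<Delta> \<Omega>}"
        if "{x} face_of e" for x
    proof (cases "x \<in> interior_vertices \<Delta> \<Omega>")
      case False
      then have "x \<in> frontier \<Omega>" using mesh_face[OF e'(1) that] by (simp add: interior_vertices_def)
      then have "delta_vertex \<Omega> x c = 0"
        using frontier_dom by (auto simp: fun_eq_iff delta_vertex_def on_tests_def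
            test_functionsD(6)[of _ \<Omega>])
      then show ?thesis by (simp add: span_zero)
    qed (auto intro: span_base)
    show ?thesis by (intro span_scale span_diff vertex ab)
  qed
  finally show "div_distr \<Omega> T \<in> span {delta_vertex \<Omega> x c | x c. x \<in> interior_vertices \<Delta> \<Omega>}" .
qed

end

lemma delta_linear:
  fixes a b :: "'b::euclidean_space"
  shows "1 simplex e \<Longrightarrow> delta_edge \<Omega> e (a + b) = delta_edge \<Omega> e a + delta_edge \<Omega> e b"
    and "1 simplex e \<Longrightarrow> delta_edge \<Omega> e (c *\<^sub>R a) = c *\<^sub>R delta_edge \<Omega> e a"
    and "2 simplex f \<Longrightarrow> delta_face \<Omega> f (a + b) = delta_face \<Omega> f a + delta_face \<Omega> f b"
    and "2 simplex f \<Longrightarrow> delta_face \<Omega> f (c *\<^sub>R a) = c *\<^sub>R delta_face \<Omega> f a"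
  by (auto simp: fun_eq_iff delta_edge_def delta_face_def on_tests_def scaleR_fun_def inner_add_left
      edge_integral_linear(1,2) face_integral_linear(1,2) continuous_on_symb)

lemma delta_edge_0: "1 simplex e \<Longrightarrow> delta_edge \<Omega> e (0 :: 'b::euclidean_space) = 0"
  using delta_linear(2)[of e \<Omega> 0 0] by simp

lemma outer_0: "outer 0 b = 0"
  by (simp add: outer_def vec_eq_iff)

lemma orthonormal3_identity:
  assumes "orthonormal3 n t1 t2"
  shows "outer n n + outer t1 t1 + outer t2 t2 = mat 1"
proof -
  have "(outer n n + outer t1 t1 + outer t2 t2) *v x = mat 1 *v x" for x
    using orthonormal3_expand[OF assms, of x]
    by (simp add: matrix_vector_mult_add_rdistrib outer_mult inner_commute)
  then show ?thesis by (simp only: matrix_eq) blast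
qed

text \<open>The components of \<open>c\<close> in the face frame become the coefficients of the
  three generators of \<open>Vh2\<close>. The third one arises from the trace term, because the
  identity minus n (x) n is t1 (x) t1 + t2 (x) t2.\<close>

lemma S_map_outer:
  assumes "orthonormal3 n t1 t2"
  shows "S_map (outer c n) = (c \<bullet> t1) *\<^sub>R outer n t1 + (c \<bullet> t2) *\<^sub>R outer n t2 +
    (- (c \<bullet> n)) *\<^sub>R (outer t1 t1 + outer t2 t2)"
proof -
  have "S_map (outer c n) = outer n c - (c \<bullet> n) *\<^sub>R mat 1"
    by (simp add: S_map_def outer_def mat3_simps inner_vec_def algebra_simps)
  also have "outer n c = outer n ((c \<bullet> n) *\<^sub>R n + (c \<bullet> t1) *\<^sub>R t1 + (c \<bullet> t2) *\<^sub>R t2)"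
    using orthonormal3_expand[OF assms, of c] by simp
  finally show ?thesis
    unfolding orthonormal3_identity[OF assms, symmetric] outer_linear by (simp add: algebra_simps)
qed

text \<open>Used for a unit tangent t and a normal n of an edge: t x n is a preimage of n under c
  |-> c x t.\<close>

lemma cross_cross_same: "cross3 (cross3 t n) t = (t \<bullet> t) *\<^sub>R n - (t \<bullet> n) *\<^sub>R t"
  by (simp add: vec_eq_iff forall_3 cross3_def vector_3 inner_vec_def sum_3 algebra_simps)

lemma vskw_outer: "(- 2) *\<^sub>R vskw (outer c t) = cross3 c t"
  by (simp add: vskw_eq mskw_adj_def outer_def cross3_def vec_eq_iff forall_3 vector_3
      algebra_simps)

context mesh
begin

section \<open>The discrete spaces as subspaces, and the connecting maps between them\<close>

lemma piecewise_constant_comp: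
  "piecewise_constant \<Delta> u \<Longrightarrow> piecewise_constant \<Delta> v \<Longrightarrow> piecewise_constant \<Delta> (\<lambda>x. g (u x) (v x))"
  unfolding piecewise_constant_def constant_on_def by metis

lemma piecewise_constant_const: "piecewise_constant \<Delta> (\<lambda>x. c)"
  unfolding piecewise_constant_def constant_on_def by blast

lemma regular_zero: "regular \<Omega> (\<lambda>x. 0) = 0"
  by (auto simp: fun_eq_iff regular_def on_tests_def)

text \<open>Adding regular distributions requires integrability, which the predicate must supply
  through a cellwise representation.\<close>

lemma subspace_regular:
  fixes P :: "(vec3 \<Rightarrow> 'b::euclidean_space) \<Rightarrow> bool"
  assumes cw: "\<And>u. P u \<Longrightarrow> \<exists>h. cellwise u h" and zero: "P (\<lambda>x. 0)"
    and add: "\<And>u v. P u \<Longrightarrow> P v \<Longrightarrow> P (\<lambda>x. u x + v x)"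
    and scale: "\<And>u c. P u \<Longrightarrow> P (\<lambda>x. c *\<^sub>R u x)"
  shows "subspace {regular \<Omega> u | u. P u}"
proof (rule subspaceI)
  show "0 \<in> {regular \<Omega> u | u. P u}"
    by (rule CollectI, rule exI[of _ "\<lambda>x. 0"]) (simp add: regular_zero zero)
  fix x assume "x \<in> {regular \<Omega> u | u. P u}"
  then obtain u where u: "x = regular \<Omega> u" "P u" by auto
  obtain h where h: "cellwise u h" using cw[OF u(2)] by blast
  show "c *\<^sub>R x \<in> {regular \<Omega> u | u. P u}" for c
    by (rule CollectI, rule exI[of _ "\<lambda>x. c *\<^sub>R u x"]) (simp add: u(1) regular_linear(2)[OF h h]
        scale u(2))
  fix y assume "y \<in> {regular \<Omega> u | u. P u}"
  then obtain v where v: "y = regular \<Omega> v" "P v" by auto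
  obtain k where k: "cellwise v k" using cw[OF v(2)] by blast
  show "x + y \<in> {regular \<Omega> u | u. P u}"
    by (rule CollectI, rule exI[of _ "\<lambda>x. u x + v x"])
      (simp add: u(1) v(1) regular_linear(1)[OF h k] add u(2) v(2))
qed

lemma subspace_Wh0: "subspace (Wh0 \<Delta> \<Omega>)"
  unfolding Wh0_def
proof (rule subspace_regular)
  show "\<exists>h. cellwise u h" if "piecewise_constant \<Delta> u" for u :: "vec3 \<Rightarrow> vec3"
    using piecewise_constant_cellwise[OF that] by blast
  show "piecewise_constant \<Delta> (\<lambda>x. u x + v x)" "piecewise_constant \<Delta> (\<lambda>x. c *\<^sub>R u x)"
    if "piecewise_constant \<Delta> u" "piecewise_constant \<Delta> v" for u v :: "vec3 \<Rightarrow> vec3" and c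
    using piecewise_constant_comp[OF that] piecewise_constant_comp[OF that, of "\<lambda>a b. c *\<^sub>R a"]
        by blast+
qed (rule piecewise_constant_const)

lemma subspace_Lag: "subspace (Lag \<Delta> \<Omega>)"
  unfolding Lag_def
proof (rule subspace_regular)
  show "\<exists>h. cellwise u h" if "continuous_on \<Omega> u \<and> piecewise_affine \<Delta> \<Omega> u" for u
    using piecewise_affine_cellwise[of u] that by blast
  show "continuous_on \<Omega> (\<lambda>x. 0) \<and> piecewise_affine \<Delta> \<Omega> (\<lambda>x. 0)"
    unfolding piecewise_affine_def by (auto intro!: exI[of _ "0 :: mat3"] exI[of _ 0])
next
  fix u v assume *: "continuous_on \<Omega> u \<and> piecewise_affine \<Delta> \<Omega> u" "continuous_on \<Omega> v \<and>
      piecewise_affine \<Delta> \<Omega> v"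
  have "piecewise_affine \<Delta> \<Omega> (\<lambda>x. u x + v x)"
    unfolding piecewise_affine_def
  proof
    fix K assume "K \<in> cells \<Delta>"
    then obtain A b A' b' where "\<forall>x\<in>K \<inter> \<Omega>. u x = A *v x + b" "\<forall>x\<in>K \<inter> \<Omega>. v x = A' *v x + b'"
      using * unfolding piecewise_affine_def by meson
    then show "\<exists>A b. \<forall>x\<in>K \<inter> \<Omega>. u x + v x = A *v x + b"
      by (intro exI[of _ "A + A'"] exI[of _ "b + b'"]) (simp add: matrix_vector_mult_add_rdistrib)
  qed
  then show "continuous_on \<Omega> (\<lambda>x. u x + v x) \<and> piecewise_affine \<Delta> \<Omega> (\<lambda>x. u x + v x)"
    using * by (auto intro: continuous_on_add)
next
  fix u c assume *: "continuous_on \<Omega> u \<and> piecewise_affine \<Delta> \<Omega> u"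
  have "piecewise_affine \<Delta> \<Omega> (\<lambda>x. c *\<^sub>R u x)"
    unfolding piecewise_affine_def
  proof
    fix K assume "K \<in> cells \<Delta>"
    then obtain A b where "\<forall>x\<in>K \<inter> \<Omega>. u x = A *v x + b"
      using * unfolding piecewise_affine_def by meson
    then show "\<exists>A b. \<forall>x\<in>K \<inter> \<Omega>. c *\<^sub>R u x = A *v x + b"
      by (intro exI[of _ "c *\<^sub>R A"] exI[of _ "c *\<^sub>R b"])
        (simp add: scaleR_matrix_vector_assoc[symmetric] scaleR_add_right)
  qed
  then show "continuous_on \<Omega> (\<lambda>x. c *\<^sub>R u x) \<and> piecewise_affine \<Delta> \<Omega> (\<lambda>x. c *\<^sub>R u x)"
    using * by (auto intro: continuous_on_scaleR continuous_on_const)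
qed

lemma subspace_Reg: "subspace (Reg \<Delta> \<Omega>)"
  unfolding Reg_def
proof (rule subspace_regular)
  let ?P = "\<lambda>\<sigma>. piecewise_constant \<Delta> \<sigma> \<and> (\<forall>x. transpose (\<sigma> x) = \<sigma> x) \<and> tt_continuous \<Delta> \<Omega> \<sigma>"
  show "\<exists>h. cellwise u h" if "?P u" for u
    using piecewise_constant_cellwise[of u] that by blast
  show "?P (\<lambda>x. 0)"
    by (simp add: piecewise_constant_const tt_continuous_def linear_0)
  have lin: "linear (\<lambda>A. mskw n ** A ** mskw n)" for n
    by (auto intro!: linearI simp: matrix_matrix_mult_def vec_eq_iff sum_3 algebra_simps)
  show "?P (\<lambda>x. u x + v x)" if u: "?P u" and v: "?P v" for u v
  proof (intro conjI allI)
    show "piecewise_constant \<Delta> (\<lambda>x. u x + v x)" using piecewise_constant_comp u v by blast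
    show "transpose (u x + v x) = u x + v x" for x
      using u v by (simp add: linear_add)
    show "tt_continuous \<Delta> \<Omega> (\<lambda>x. u x + v x)"
      using u v unfolding tt_continuous_def linear_add[OF lin] by metis
  qed
  show "?P (\<lambda>x. c *\<^sub>R u x)" if u: "?P u" for u c
  proof (intro conjI allI)
    show "piecewise_constant \<Delta> (\<lambda>x. c *\<^sub>R u x)"
      using piecewise_constant_comp[of u u "\<lambda>a b. c *\<^sub>R a"] u by blast
    show "transpose (c *\<^sub>R u x) = c *\<^sub>R u x" for x
      using u by (simp add: linear_scale)
    show "tt_continuous \<Delta> \<Omega> (\<lambda>x. c *\<^sub>R u x)"
      using u unfolding tt_continuous_def linear_scale[OF lin] by metis
  qed
qed

lemma spaces_distrs:
  "v \<in> Lag \<Delta> \<Omega> \<Longrightarrow> v \<in> distrs \<Omega>" "w \<in> Wh0 \<Delta> \<Omega> \<Longrightarrow> w \<in> distrs \<Omega>" "\<sigma> \<in> Reg \<Delta> \<Omega> \<Longrightarrow> \<sigma> \<in> distrs \<Omega>"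
  "\<sigma> \<in> Vh1 \<Delta> \<Omega> \<Longrightarrow> \<sigma> \<in> distrs \<Omega>" "\<sigma> \<in> Wh1 \<Delta> \<Omega> \<Longrightarrow> \<sigma> \<in> distrs \<Omega>"
proof -
  have pc: "regular \<Omega> c \<in> distrs \<Omega>" if c: "piecewise_constant \<Delta> c"
      for c :: "vec3 \<Rightarrow> 'x::euclidean_space"
  proof -
    obtain s where "cellwise c (\<lambda>K x. s K)" using piecewise_constant_cellwise[OF c] .
    then show ?thesis using regular_linear(3) by blast
  qed
  show "v \<in> distrs \<Omega>" if v: "v \<in> Lag \<Delta> \<Omega>"
  proof -
    obtain u where u: "v = regular \<Omega> u" "piecewise_affine \<Delta> \<Omega> u" using v unfolding Lag_def by auto
    have "\<exists>h. cellwise u h" using piecewise_affine_cellwise[of u] u(2) by blast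
    then show ?thesis unfolding u(1) using regular_linear(3) by blast
  qed
  show W: "w \<in> Wh0 \<Delta> \<Omega> \<Longrightarrow> w \<in> distrs \<Omega>" for w
    unfolding Wh0_def using pc by auto
  show R: "\<sigma> \<in> Reg \<Delta> \<Omega> \<Longrightarrow> \<sigma> \<in> distrs \<Omega>" for \<sigma>
    unfolding Reg_def using pc by auto
  show "\<sigma> \<in> distrs \<Omega>" if \<sigma>: "\<sigma> \<in> Vh1 \<Delta> \<Omega>"
  proof -
    obtain r w where "\<sigma> = r + pointwise \<Omega> mskw w" "r \<in> Reg \<Delta> \<Omega>" "w \<in> Wh0 \<Delta> \<Omega>"
      using \<sigma> unfolding Vh1_eq by auto
    then show ?thesis
      using subspace_add[OF subspace_distrs R distrs_ops(1)[OF _ W]] by simp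
  qed
  have "Wh1 \<Delta> \<Omega> \<subseteq> distrs \<Omega>"
    unfolding Wh1_def by (rule span_minimal[OF _ subspace_distrs])
        (use interior_facesD delta_distrs(2) in auto)
  then show "\<sigma> \<in> Wh1 \<Delta> \<Omega> \<Longrightarrow> \<sigma> \<in> distrs \<Omega>" by blast
qed

lemma subspace_Vh1: "subspace (Vh1 \<Delta> \<Omega>)"
proof -
  have "Vh1 \<Delta> \<Omega> = {x + y | x y. x \<in> Reg \<Delta> \<Omega> \<and> y \<in> pointwise \<Omega> mskw ` Wh0 \<Delta> \<Omega>}"
    unfolding Vh1_eq by auto
  then show ?thesis
    using subspace_sums[OF subspace_Reg linear_subspace_image[OF linear_ops(1) subspace_Wh0]]
        by simp
qed

lemma Vh2_eq: "Vh2 \<Delta> \<Omega> = pointwise \<Omega> S_map ` Wh1 \<Delta> \<Omega>"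
proof (intro equalityI subsetI)
  fix T assume "T \<in> pointwise \<Omega> S_map ` Wh1 \<Delta> \<Omega>"
  then obtain w where w: "T = pointwise \<Omega> S_map w" "w \<in> Wh1 \<Delta> \<Omega>" by blast
  show "T \<in> Vh2 \<Delta> \<Omega>"
    unfolding w(1) Vh2_def
  proof (rule span_map[OF linear_ops(1) _ w(2)[unfolded Wh1_def]])
    fix s assume "s \<in> {delta_face \<Omega> f (outer c (face_normal f)) | f c. f \<in> interior_faces \<Delta> \<Omega>}"
    then obtain f c where s: "s = delta_face \<Omega> f (outer c (face_normal f))" and f:
        "f \<in> interior_faces \<Delta> \<Omega>" by blast
    have f2: "2 simplex f" using interior_facesD[OF f] by blast
    show "pointwise \<Omega> S_map s \<in> span (\<Union>f \<in> interior_faces \<Delta> \<Omega>.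
     {delta_face \<Omega> f (outer (face_normal f) (face_tangent1 f)),
      delta_face \<Omega> f (outer (face_normal f) (face_tangent2 f)),
      delta_face \<Omega> f (outer (face_tangent1 f) (face_tangent1 f) + outer (face_tangent2 f)
          (face_tangent2 f))})"
      unfolding s pointwise_delta(2)[OF linear_maps(3)] S_map_outer[OF face_frame(1)[OF f2]]
        delta_linear(3)[OF f2, of _ "_ *\<^sub>R outer _ _ + _ *\<^sub>R outer _ _"] delta_linear(3)[OF f2, of _
            "_ *\<^sub>R _" "_ *\<^sub>R _"]
        delta_linear(4)[OF f2]
      by (intro span_add span_scale span_base) (use f in blast)+
  qed
next
  fix T assume "T \<in> Vh2 \<Delta> \<Omega>"
  have "Vh2 \<Delta> \<Omega> \<subseteq> pointwise \<Omega> S_map ` Wh1 \<Delta> \<Omega>"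
    unfolding Vh2_def
  proof (rule span_minimal)
    show "subspace (pointwise \<Omega> S_map ` Wh1 \<Delta> \<Omega>)"
      unfolding Wh1_def by (intro linear_subspace_image linear_ops subspace_span)
    show "(\<Union>f \<in> interior_faces \<Delta> \<Omega>.
     {delta_face \<Omega> f (outer (face_normal f) (face_tangent1 f)),
      delta_face \<Omega> f (outer (face_normal f) (face_tangent2 f)),
      delta_face \<Omega> f (outer (face_tangent1 f) (face_tangent1 f) + outer (face_tangent2 f)
          (face_tangent2 f))})
      \<subseteq> pointwise \<Omega> S_map ` Wh1 \<Delta> \<Omega>"
    proof (rule UN_least)
      fix f assume f: "f \<in> interior_faces \<Delta> \<Omega>"
      let ?n = "face_normal f" and ?s = "face_tangent1 f" and ?t = "face_tangent2 f"
      have f2: "2 simplex f" using interior_facesD[OF f] by blast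
      note o = face_frame(1)[OF f2]
      \<comment> \<open>Taking c = t1, t2 and -n isolates the three generators.\<close>
      have S: "S_map (outer ?s ?n) = outer ?n ?s" "S_map (outer ?t ?n) = outer ?n ?t"
        "S_map (outer (- ?n) ?n) = outer ?s ?s + outer ?t ?t"
        using o unfolding S_map_outer[OF o]
            by (simp_all add: orthonormal3_def norm_eq_1 inner_commute)
      have "delta_face \<Omega> f (S_map (outer c ?n)) \<in> pointwise \<Omega> S_map ` Wh1 \<Delta> \<Omega>" for c
      proof (rule image_eqI)
        show "delta_face \<Omega> f (S_map (outer c ?n)) = pointwise \<Omega> S_map (delta_face \<Omega> f (outer c ?n))"
          by (simp add: pointwise_delta)
        show "delta_face \<Omega> f (outer c ?n) \<in> Wh1 \<Delta> \<Omega>" unfolding Wh1_def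
            by (intro span_base) (use f in blast)
      qed
      from this[of ?s] this[of ?t] this[of "- ?n"]
      show "{delta_face \<Omega> f (outer ?n ?s), delta_face \<Omega> f (outer ?n ?t), delta_face \<Omega> f (outer ?s ?s
          + outer ?t ?t)}
        \<subseteq> pointwise \<Omega> S_map ` Wh1 \<Delta> \<Omega>" unfolding S by blast
    qed
  qed
  then show "T \<in> pointwise \<Omega> S_map ` Wh1 \<Delta> \<Omega>" using \<open>T \<in> Vh2 \<Delta> \<Omega>\<close> by blast
qed

text \<open>Sign and factor of \<open>A2\<close> are absorbed here, so that the abstract
  differential has a plus sign.\<close>

definition S2 :: "mat3 distr \<Rightarrow> vec3 distr" where
  "S2 w = (- 2) *\<^sub>R pointwise \<Omega> vskw w"

lemma linear_S2: "linear S2"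
  unfolding S2_def[abs_def] by (rule linear_compose_scale_right) simp

lemma S2_delta:
  assumes "1 simplex e"
  shows "S2 (delta_edge \<Omega> e (outer c t)) = delta_edge \<Omega> e (cross3 c t)"
  unfolding S2_def pointwise_delta(1)[OF linear_vskw] delta_linear(2)[OF assms, symmetric]
      vskw_outer ..

lemma Vh3_eq: "Vh3 \<Delta> \<Omega> = S2 ` Wh2 \<Delta> \<Omega>"
proof (intro equalityI subsetI)
  fix T assume "T \<in> S2 ` Wh2 \<Delta> \<Omega>"
  then obtain w where w: "T = S2 w" "w \<in> Wh2 \<Delta> \<Omega>" by blast
  show "T \<in> Vh3 \<Delta> \<Omega>"
    unfolding w(1) Vh3_def
  proof (rule span_map[OF linear_S2 _ w(2)[unfolded Wh2_def]])
    fix s assume "s \<in> {delta_edge \<Omega> e (outer c (edge_tangent e)) | e c. e \<in> interior_edges \<Delta> \<Omega>}"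
    then obtain e c where s: "s = delta_edge \<Omega> e (outer c (edge_tangent e))" and e:
        "e \<in> interior_edges \<Delta> \<Omega>" by blast
    have e1: "1 simplex e" using interior_edgesD[OF e] by blast
    let ?x = "cross3 c (edge_tangent e)"
    have "(?x \<bullet> edge_normal1 e) *\<^sub>R edge_normal1 e + (?x \<bullet> edge_normal2 e) *\<^sub>R edge_normal2 e = ?x"
      using orthonormal3_expand[OF edge_frame(1)[OF e1], of ?x] by (simp add: dot_cross_self)
    then have "delta_edge \<Omega> e ?x = delta_edge \<Omega> e ((?x \<bullet> edge_normal1 e) *\<^sub>R edge_normal1 e
        + (?x \<bullet> edge_normal2 e) *\<^sub>R edge_normal2 e)"
      by simp
    also have "\<dots> = (?x \<bullet> edge_normal1 e) *\<^sub>R delta_edge \<Omega> e (edge_normal1 e) + (?x \<bullet> edge_normal2 e)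
        *\<^sub>R delta_edge \<Omega> e (edge_normal2 e)"
      by (simp only: delta_linear(1,2)[OF e1])
    also have "\<dots> \<in> span (\<Union>e \<in> interior_edges \<Delta> \<Omega>. {delta_edge \<Omega> e (edge_normal1 e), delta_edge \<Omega> e
        (edge_normal2 e)})"
      by (intro span_add span_scale span_base) (use e in blast)+
    finally show "S2 s \<in> span (\<Union>e \<in> interior_edges \<Delta> \<Omega>. {delta_edge \<Omega> e (edge_normal1 e), delta_edge
        \<Omega> e (edge_normal2 e)})"
      unfolding s S2_delta[OF e1] .
  qed
next
  fix T assume "T \<in> Vh3 \<Delta> \<Omega>"
  have "Vh3 \<Delta> \<Omega> \<subseteq> S2 ` Wh2 \<Delta> \<Omega>"
    unfolding Vh3_def
  proof (rule span_minimal)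
    show "subspace (S2 ` Wh2 \<Delta> \<Omega>)"
      unfolding Wh2_def by (intro linear_subspace_image linear_S2 subspace_span)
    show "(\<Union>e \<in> interior_edges \<Delta> \<Omega>. {delta_edge \<Omega> e (edge_normal1 e), delta_edge \<Omega> e (edge_normal2
        e)})
      \<subseteq> S2 ` Wh2 \<Delta> \<Omega>"
    proof (rule UN_least)
      fix e assume e: "e \<in> interior_edges \<Delta> \<Omega>"
      have e1: "1 simplex e" using interior_edgesD[OF e] by blast
      let ?t = "edge_tangent e"
      have t: "?t \<bullet> ?t = 1" "?t \<bullet> edge_normal1 e = 0" "?t \<bullet> edge_normal2 e = 0"
        using edge_frame(1)[OF e1] by (simp_all add: orthonormal3_def norm_eq_1)
      \<comment> \<open>The preimages of the two normal directions under c |-> c x t.\<close>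
      have n: "cross3 (cross3 ?t (edge_normal1 e)) ?t =
          edge_normal1 e" "cross3 (cross3 ?t (edge_normal2 e)) ?t = edge_normal2 e"
        unfolding cross_cross_same t by simp_all
      have "delta_edge \<Omega> e (cross3 c ?t) \<in> S2 ` Wh2 \<Delta> \<Omega>" for c
      proof (rule image_eqI[where f=S2, OF S2_delta[OF e1, symmetric]])
        show "delta_edge \<Omega> e (outer c ?t) \<in> Wh2 \<Delta> \<Omega>" unfolding Wh2_def
            by (intro span_base) (use e in blast)
      qed
      from this[of "cross3 ?t (edge_normal1 e)"] this[of "cross3 ?t (edge_normal2 e)"]
      have "delta_edge \<Omega> e (edge_normal1 e) \<in> S2 ` Wh2 \<Delta> \<Omega>" "delta_edge \<Omega> e (edge_normal2 e) \<in> S2 `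
          Wh2 \<Delta> \<Omega>"
        unfolding n .
      then show "{delta_edge \<Omega> e (edge_normal1 e), delta_edge \<Omega> e (edge_normal2 e)} \<subseteq> S2 ` Wh2 \<Delta> \<Omega>"
          by blast
    qed
  qed
  then show "T \<in> S2 ` Wh2 \<Delta> \<Omega>" using \<open>T \<in> Vh3 \<Delta> \<Omega>\<close> by blast
qed

text \<open>Collects a span element into one vector per edge, which is what testing edge by edge
  requires.\<close>

lemma Wh2_sum:
  assumes "w \<in> Wh2 \<Delta> \<Omega>"
  shows "\<exists>c. w = (\<Sum>e\<in>interior_edges \<Delta> \<Omega>. delta_edge \<Omega> e (outer (c e) (edge_tangent e)))"
  using assms unfolding Wh2_def
proof (induction rule: span_induct_alt)
  case base
  have "delta_edge \<Omega> e (outer 0 (edge_tangent e)) = 0" if "e \<in> interior_edges \<Delta> \<Omega>" for e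
    using interior_edgesD[OF that] by (simp add: outer_0 delta_edge_0)
  then show ?case by (intro exI[of _ "\<lambda>e. 0"]) simp
next
  case (step k x y)
  then obtain e0 c0 c where e0: "e0 \<in> interior_edges \<Delta> \<Omega>" and x: "x =
      delta_edge \<Omega> e0 (outer c0 (edge_tangent e0))"
    and y: "y = (\<Sum>e\<in>interior_edges \<Delta> \<Omega>. delta_edge \<Omega> e (outer (c e) (edge_tangent e)))" by blast
  let ?c = "\<lambda>e. (if e = e0 then k *\<^sub>R c0 else 0) + c e"
  have "delta_edge \<Omega> e (outer (?c e) (edge_tangent e)) = (if e = e0 then k *\<^sub>R x else 0)
      + delta_edge \<Omega> e (outer (c e) (edge_tangent e))"
    if "e \<in> interior_edges \<Delta> \<Omega>" for e
  proof -
    have "1 simplex e" using interior_edgesD[OF that] by blast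
    then show ?thesis by (cases "e = e0") (simp_all add: x outer_linear delta_linear outer_0
        delta_edge_0)
  qed
  then have "k *\<^sub>R x + y = (\<Sum>e\<in>interior_edges \<Delta> \<Omega>. delta_edge \<Omega> e (outer (?c e) (edge_tangent e)))"
    using finite_interior(2) e0 by (simp add: sum.distrib y sum.delta)
  then show ?case by (rule exI[of _ ?c])
qed

text \<open>The edge deltas are linearly independent, so a vanishing sum forces c x t = 0 on every
  single edge, that is, c parallel to t.\<close>

lemma ker_S2: "{w \<in> Wh2 \<Delta> \<Omega>. S2 w = 0} = Reg0_dual \<Delta> \<Omega>"
proof (intro equalityI subsetI)
  have "Reg0_dual \<Delta> \<Omega> \<subseteq> {w \<in> Wh2 \<Delta> \<Omega>. S2 w = 0}"
    unfolding Reg0_dual_def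
  proof (rule span_minimal)
    show "subspace {w \<in> Wh2 \<Delta> \<Omega>. S2 w = 0}"
      using subspace_span[of "{delta_edge \<Omega> e (outer c (edge_tangent e)) | e c. e \<in> interior_edges \<Delta>
          \<Omega>}"]
      unfolding Wh2_def[symmetric]
      by (auto simp: subspace_def linear_0[OF linear_S2] linear_add[OF linear_S2] linear_scale[OF
          linear_S2])
    show "{delta_edge \<Omega> e (outer (edge_tangent e) (edge_tangent e)) | e. e \<in> interior_edges \<Delta> \<Omega>}
      \<subseteq> {w \<in> Wh2 \<Delta> \<Omega>. S2 w = 0}"
    proof clarify
      fix e assume e: "e \<in> interior_edges \<Delta> \<Omega>"
      have e1: "1 simplex e" using interior_edgesD[OF e] by blast
      have "delta_edge \<Omega> e (outer (edge_tangent e) (edge_tangent e)) \<in> Wh2 \<Delta> \<Omega>"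
        unfolding Wh2_def by (intro span_base) (use e in blast)
      moreover have "S2 (delta_edge \<Omega> e (outer (edge_tangent e) (edge_tangent e))) = 0"
        unfolding S2_delta[OF e1] using delta_edge_0[OF e1] by simp
      ultimately show "delta_edge \<Omega> e (outer (edge_tangent e) (edge_tangent e)) \<in> Wh2 \<Delta> \<Omega> \<and>
        S2 (delta_edge \<Omega> e (outer (edge_tangent e) (edge_tangent e))) = 0" by blast
    qed
  qed
  then show "w \<in> {w \<in> Wh2 \<Delta> \<Omega>. S2 w = 0}" if "w \<in> Reg0_dual \<Delta> \<Omega>" for w using that by blast
next
  fix w assume "w \<in> {w \<in> Wh2 \<Delta> \<Omega>. S2 w = 0}"
  then have w: "w \<in> Wh2 \<Delta> \<Omega>" "S2 w = 0" by auto
  obtain c where c: "w = (\<Sum>e\<in>interior_edges \<Delta> \<Omega>. delta_edge \<Omega> e (outer (c e) (edge_tangent e)))"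
    using Wh2_sum[OF w(1)] by blast
  have S2w: "(\<Sum>e\<in>interior_edges \<Delta> \<Omega>. delta_edge \<Omega> e (cross3 (c e) (edge_tangent e))) = 0"
    using w(2) interior_edgesD unfolding c linear_sum[OF linear_S2] by (simp add: S2_delta)
  have "delta_edge \<Omega> e (outer (c e) (edge_tangent e)) \<in> Reg0_dual \<Delta> \<Omega>"
      if e: "e \<in> interior_edges \<Delta> \<Omega>" for e
  proof -
    have e': "e \<in> \<Delta>" "1 simplex e" "\<not> e \<subseteq> frontier \<Omega>" using interior_edgesD[OF e] by auto
    let ?t = "edge_tangent e" and ?x = "\<lambda>e. cross3 (c e) (edge_tangent e)"
    obtain \<phi> :: "vec3 \<Rightarrow> real" and x where \<phi>: "\<phi> \<in> test_functions \<Omega>" "\<And>y. 0 \<le> \<phi> y" "x \<in> e" "0 < \<phi> x"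
      "\<And>s' y. s' \<in> \<Delta> \<Longrightarrow> 1 simplex s' \<Longrightarrow> s' \<noteq> e \<Longrightarrow> y \<in> s' \<Longrightarrow> \<phi> y = 0"
      using simplex_bump[OF e'] by blast
    have lin: "linear (\<lambda>r. r *\<^sub>R ?x e)" by (auto intro!: linearI simp: algebra_simps)
    \<comment> \<open>The bump singles out \<open>e\<close>; its direction is the vector to be shown
      zero, so that the test yields its squared length times a positive integral.\<close>
    let ?\<psi> = "\<lambda>y. \<phi> y *\<^sub>R ?x e"
    have \<psi>: "?\<psi> \<in> test_functions \<Omega>" by (rule test_functions_linear[OF \<phi>(1) lin])
    have "delta_edge \<Omega> g (?x g) ?\<psi> = (if g = e then (?x e \<bullet> ?x e) * edge_integral e \<phi> else 0)"
      if g: "g \<in> interior_edges \<Delta> \<Omega>" for g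
    proof -
      have g': "g \<in> \<Delta>" "1 simplex g" using interior_edgesD[OF g] by auto
      have "delta_edge \<Omega> g (?x g) ?\<psi> = edge_integral g (\<lambda>y. (?x g \<bullet> ?x e) * \<phi> y)"
        using \<psi> by (simp add: delta_edge_def on_tests_def mult.commute)
      then have A: "delta_edge \<Omega> g (?x g) ?\<psi> = (?x g \<bullet> ?x e) * edge_integral g \<phi>"
        by (simp only: edge_integral_linear(2)[OF g'(2)])
      have B: "edge_integral g \<phi> = 0" if "g \<noteq> e"
      proof -
        have "edge_integral g \<phi> = edge_integral g (\<lambda>y. 0 * \<phi> y)"
          by (rule edge_integral_linear(3)[OF g'(2)]) (simp add: \<phi>(5)[OF g' that])
        also have "\<dots> = 0" using edge_integral_linear(2)[OF g'(2), of 0 \<phi>] by simp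
        finally show ?thesis .
      qed
      show ?thesis
      proof (cases "g = e")
        case True
        then show ?thesis using A by (simp only: simp_thms if_True)
      next
        case False
        then show ?thesis using A B[OF False] by (simp only: if_False mult_zero_right)
      qed
    qed
    then have "(?x e \<bullet> ?x e) * edge_integral e \<phi> = (\<Sum>g\<in>interior_edges \<Delta> \<Omega>. delta_edge \<Omega> g (?x g)
        ?\<psi>)"
      using finite_interior(2) e by (simp add: sum.delta)
    also have "\<dots> = 0" using fun_cong[OF S2w, of ?\<psi>] by (simp add: sum_fun_apply)
    finally have "?x e = 0"
      using edge_integral_pos[OF e'(2) test_functionsD(5)[OF \<phi>(1)] \<phi>(2,3,4)] by simp
    then have "cross3 ?t (cross3 ?t (c e)) = 0" using cross_skew[of "c e" ?t] by simp
    moreover have "?t \<bullet> ?t = 1" using edge_frame(1)[OF e'(2)]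
        by (simp add: orthonormal3_def norm_eq_1)
    \<comment> \<open>Crossing twice with the unit tangent returns the normal part of
      \<open>c e\<close> up to sign.\<close>
    ultimately have "c e = (?t \<bullet> c e) *\<^sub>R ?t" using Lagrange[of ?t ?t "c e"] by simp
    then have "outer (c e) ?t = (?t \<bullet> c e) *\<^sub>R outer ?t ?t" by (metis outer_linear(2))
    then have "delta_edge \<Omega> e (outer (c e) ?t) = (?t \<bullet> c e) *\<^sub>R delta_edge \<Omega> e (outer ?t ?t)"
      using delta_linear(2)[OF e'(2)] by metis
    also have "\<dots> \<in> Reg0_dual \<Delta> \<Omega>"
      unfolding Reg0_dual_def by (intro span_scale span_base) (use e in blast)
    finally show ?thesis .
  qed
  then show "w \<in> Reg0_dual \<Delta> \<Omega>" unfolding c Reg0_dual_def by (intro span_sum)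
qed

lemma symm_Reg: "\<sigma> \<in> Reg \<Delta> \<Omega> \<Longrightarrow> pointwise \<Omega> symm \<sigma> = \<sigma>"
  unfolding Reg_def by (auto simp: pointwise_regular symm_def scaleR_2[symmetric])

lemma symm_Reg0_dual:
  assumes "T \<in> Reg0_dual \<Delta> \<Omega>"
  shows "pointwise \<Omega> symm T = T"
proof -
  have "Reg0_dual \<Delta> \<Omega> \<subseteq> {T. pointwise \<Omega> symm T = T}"
    unfolding Reg0_dual_def
  proof (rule span_minimal)
    show "subspace {T. pointwise \<Omega> symm T = T}"
      by (auto simp: subspace_def linear_0 linear_add linear_scale)
    have "symm (outer t t) = outer t t" for t
      by (simp add: symm_def outer_def mat3_simps algebra_simps)
    then show "{delta_edge \<Omega> e (outer (edge_tangent e) (edge_tangent e)) | e. e \<in> interior_edges \<Delta>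
        \<Omega>}
      \<subseteq> {T. pointwise \<Omega> symm T = T}" by (auto simp: pointwise_delta)
  qed
  then show ?thesis using assms by blast
qed

text \<open>Both rows use the same three operators. Taking symmetric parts projects onto
  \<open>Reg\<close> along the skew fields, as \<open>symm_Reg\<close> and
  \<open>symm_mskw_distr\<close> state.\<close>

sublocale bgg_diagram "Lag \<Delta> \<Omega>" "Vh1 \<Delta> \<Omega>" "Vh2 \<Delta> \<Omega>" "Vh3 \<Delta> \<Omega>"
  "Wh0 \<Delta> \<Omega>" "Wh1 \<Delta> \<Omega>" "Wh2 \<Delta> \<Omega>" "Wh3 \<Delta> \<Omega>"
  "grad_distr \<Omega>" "curl_distr \<Omega>" "div_distr \<Omega>" "grad_distr \<Omega>" "curl_distr \<Omega>" "div_distr \<Omega>"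
  "pointwise \<Omega> mskw" "pointwise \<Omega> S_map" S2 "pointwise \<Omega> S_inv" "Reg \<Delta> \<Omega>" "pointwise \<Omega> symm"
proof (rule bgg_diagram.intro)
  show "subspace (Vh2 \<Delta> \<Omega>)" "subspace (Vh3 \<Delta> \<Omega>)" "subspace (Wh1 \<Delta> \<Omega>)" "subspace (Wh2 \<Delta> \<Omega>)" "subspace
      (Wh3 \<Delta> \<Omega>)"
    unfolding Vh2_def Vh3_def Wh1_def Wh2_def Wh3_def by (rule subspace_span)+
  show "div_distr \<Omega> (pointwise \<Omega> S_map w) = - S2 (curl_distr \<Omega> w)" if "w \<in> Wh1 \<Delta> \<Omega>" for w
    using div_S_distr[OF spaces_distrs(5)[OF that]] by (simp add: S2_def)
  show "curl_distr \<Omega> v \<in> Vh2 \<Delta> \<Omega>" if "v \<in> Reg \<Delta> \<Omega>" for v by (rule curl_Reg[OF that])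
  show "w = 0" if "w \<in> Wh0 \<Delta> \<Omega>" "pointwise \<Omega> mskw w = 0" for w
    by (rule mskw_distr_inj[OF spaces_distrs(2)[OF that(1)] that(2)])
qed (auto simp: subspace_Lag subspace_Vh1 subspace_Wh0 subspace_Reg linear_S2 grad_Lag_Vh1 grad_Wh0
    curl_Wh1 div_Wh2 Vh1_eq[symmetric] Vh2_eq Vh3_eq spaces_distrs distrs_ops curl_grad_distr
        div_curl_distr
    curl_mskw_distr S_inv_S_distr symm_Reg symm_mskw_distr)

lemma K2_eq: "K2 = Reg0_dual \<Delta> \<Omega>"
  unfolding K2_def by (rule ker_S2)

lemma D0_eq: "D0 = def_distr \<Omega>"
  by (simp add: fun_eq_iff D0_def def_distr_def)

text \<open>For symmetric \<open>\<sigma>\<close> the matrix \<open>curl \<sigma>\<close> is trace-free, so that \<open>S_inv\<close> acts on it as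
    transposition.\<close>

lemma D1_eq:
  assumes "\<sigma> \<in> Reg \<Delta> \<Omega>"
  shows "D1 \<sigma> = inc_distr \<Omega> \<sigma>"
proof -
  \<comment> \<open>\<open>inc_distr\<close> ends with a symmetrisation that \<open>D1\<close>
    lacks; it changes nothing, since \<open>D1 \<sigma>\<close> is a combination of edge deltas of t
    (x) t.\<close>
  have "pointwise \<Omega> symm (D1 \<sigma>) = D1 \<sigma>"
    using symm_Reg0_dual D1_K2 RV1 assms K2_eq by blast
  then show ?thesis
    unfolding inc_distr_def S_inv_curl_symmetric[OF symm_Reg[OF assms], symmetric] D1_def by simp
qed

lemma B_eq: "B0 = A0 \<Omega>" "B1 = A1 \<Omega>" "B2 = A2 \<Omega>"
  by (auto simp: fun_eq_iff B0_def B1_def B2_def A0_def A1_def A2_def S2_def)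

text \<open>\<open>D1\<close> and \<open>inc_distr\<close> are only known to agree on
  \<open>Reg\<close>, so linearity of \<open>inc_distr\<close> on the whole type is supplied
  separately by \<open>linear_def_inc\<close>.\<close>

lemma regge_complex:
  "is_complex (Lag \<Delta> \<Omega>) (def_distr \<Omega>) (Reg \<Delta> \<Omega>) (inc_distr \<Omega>) (Reg0_dual \<Delta> \<Omega>) (div_distr \<Omega>)
      (Lag0_dual \<Delta> \<Omega>)"
proof -
  have "Lag0_dual \<Delta> \<Omega> = Wh3 \<Delta> \<Omega>" unfolding Lag0_dual_def Wh3_def ..
  moreover have "def_distr \<Omega> x \<in> Reg \<Delta> \<Omega>" if "x \<in> Lag \<Delta> \<Omega>" for x
    using derived_complex that unfolding is_complex_def D0_eq by blast
  ultimately show ?thesis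
    using derived_complex unfolding is_complex_def K2_eq D0_eq
        by (auto simp: D1_eq image_subset_iff)
qed

end

theorem theorem4p1:
  fixes \<Omega> :: "vec3 set" and \<Delta> :: "vec3 set set"
  assumes "polyhedral_domain \<Omega>"
    and "triangulation_of \<Delta> \<Omega>"
  shows "is_complex (Vh0 \<Delta> \<Omega> \<times> Wh0 \<Delta> \<Omega>) (A0 \<Omega>) (Vh1 \<Delta> \<Omega> \<times> Wh1 \<Delta> \<Omega>) (A1 \<Omega>)
           (Vh2 \<Delta> \<Omega> \<times> Wh2 \<Delta> \<Omega>) (A2 \<Omega>) (Vh3 \<Delta> \<Omega> \<times> Wh3 \<Delta> \<Omega>)
  \<and> is_complex (Lag \<Delta> \<Omega>) (def_distr \<Omega>) (Reg \<Delta> \<Omega>) (inc_distr \<Omega>)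
           (Reg0_dual \<Delta> \<Omega>) (div_distr \<Omega>) (Lag0_dual \<Delta> \<Omega>)
  \<and> quotients_isomorphic
           (ker_on (Vh0 \<Delta> \<Omega> \<times> Wh0 \<Delta> \<Omega>) (A0 \<Omega>)) {0}
           (ker_on (Lag \<Delta> \<Omega>) (def_distr \<Omega>)) {0}
  \<and> quotients_isomorphic
           (ker_on (Vh1 \<Delta> \<Omega> \<times> Wh1 \<Delta> \<Omega>) (A1 \<Omega>)) (A0 \<Omega> ` (Vh0 \<Delta> \<Omega> \<times> Wh0 \<Delta> \<Omega>))
           (ker_on (Reg \<Delta> \<Omega>) (inc_distr \<Omega>)) (def_distr \<Omega> ` Lag \<Delta> \<Omega>)
  \<and> quotients_isomorphic
           (ker_on (Vh2 \<Delta> \<Omega> \<times> Wh2 \<Delta> \<Omega>) (A2 \<Omega>)) (A1 \<Omega> ` (Vh1 \<Delta> \<Omega> \<times> Wh1 \<Delta> \<Omega>))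
           (ker_on (Reg0_dual \<Delta> \<Omega>) (div_distr \<Omega>)) (inc_distr \<Omega> ` Reg \<Delta> \<Omega>)
  \<and> quotients_isomorphic
           (Vh3 \<Delta> \<Omega> \<times> Wh3 \<Delta> \<Omega>) (A2 \<Omega> ` (Vh2 \<Delta> \<Omega> \<times> Wh2 \<Delta> \<Omega>))
           (Lag0_dual \<Delta> \<Omega>) (div_distr \<Omega> ` Reg0_dual \<Delta> \<Omega>)"
proof -
  interpret mesh \<Omega> \<Delta> using assms by (rule mesh.intro)
  \<comment> \<open>Agreement on \<open>Reg\<close> suffices to exchange kernel and image, though
    not the operators themselves.\<close>
  have inc: "ker_on (Reg \<Delta> \<Omega>) D1 = ker_on (Reg \<Delta> \<Omega>) (inc_distr \<Omega>)"
      "D1 ` Reg \<Delta> \<Omega> = inc_distr \<Omega> ` Reg \<Delta> \<Omega>"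
    by (auto simp: ker_on_def D1_eq)
  have L: "Lag0_dual \<Delta> \<Omega> = Wh3 \<Delta> \<Omega>" unfolding Lag0_dual_def Wh3_def ..
  show ?thesis
    using twisted_complex regge_complex cohomology0 cohomology1 cohomology2 cohomology3
    unfolding B_eq D0_eq K2_eq Vh0_def inc L by blast
qed

end
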